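(* Let $n\ge 2$, $q>0$ and $-q^*<p<0$. Let $G$ be a closed subgroup of $O(n)$ without a non-zero fixed point (i.e. the only $x\in\mathbb{R}^n$ with $gx=x$ for all $g\in G$ is $x=0$), and let $Q$ be a $G$-invariant star body in $\mathbb{R}^n$. Let $\mu$ be a non-trivial (non-zero), $G$-invariant, finite Borel measure on $S^{n-1}$ with a density function $f\in L^s(S^{n-1})$, where $s>1$ if $q\le 1$, and $s=\frac{1}{1+p/q^*}>1$ if $q>1$. Then there exists a $G$-invariant convex body $K$ in $\mathbb{R}^n$ (containing the origin in its interior) such that $$\widetilde{C}_{p,q}(K,Q;\cdot)=\mu .$$
   Context: For $q>0$ define $$q^*=\begin{cases}\frac{q}{q-n+1}&\text{if } q\ge n,\\ \frac{(n-1)q}{q-1}&\text{if }1<q<n,\\ \infty&\text{if }0<q\le 1.\end{cases}$$ (When $q^*=\infty$ the condition $-q^*<p<0$ just means $p<0$.) A convex body is a compact convex set in $\mathbb{R}^n$ with non-empty interior; $\mathcal{K}^n_o$ is the family of convex bodies containing the origin in their interior. $h_K(y)=\max\{\langle x,y\rangle:x\in K\}$ is the support function. For a compact set $Q$ that is star-shaped with respect to the origin, $\rho_Q(x)=\max\{\lambda:\lambda x\in Q\}$ ($x\neq0$) is its radial function; $Q$ is a star body if $\rho_Q$ is positive and continuous. A set $E\subset\mathbb{R}^n$ is $G$-invariant if $gE=E$ for all $g\in G$; a Borel measure $\mu$ on $S^{n-1}$ is $G$-invariant if $\mu(gE)=\mu(E)$ for all $g\in G$ and all Borel $E\subset S^{n-1}$.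 Densities and $L^s(S^{n-1})$ are with respect to the spherical Lebesgue measure $du=\mathcal{H}^{n-1}$ on $S^{n-1}$. For $K\in\mathcal{K}^n_o$ and a Borel set $\eta\subset S^{n-1}$, let $\boldsymbol{\alpha}^*_K(\eta)$ be the set of all $u\in S^{n-1}$ such that $\langle\rho_K(u)u,v\rangle=h_K(v)$ for some $v\in\eta$. For a star body $Q$ and $q\in\mathbb{R}$, the $q$th dual curvature measure of $K$ with respect to $Q$ is the Borel measure on $S^{n-1}$ $$\widetilde{C}_q(K,Q;\eta)=\frac1n\int_{\boldsymbol{\alpha}^*_K(\eta)}\rho_K(u)^{q}\rho_Q(u)^{n-q}\,du,$$ and the $L_p$ $q$th dual curvature measure $\widetilde{C}_{p,q}(K,Q;\cdot)$ is defined by $d\widetilde{C}_{p,q}(K,Q;\cdot)=h_K^{-p}\,d\widetilde{C}_q(K,Q;\cdot)$. *)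

theory Defs
  imports "HOL-Analysis.Analysis" "HOL-Algebra.Group"
begin

section \<open>Spherical Lebesgue measure\<close>

text \<open>
  The normalisation makes the \<open>s\<close>-dimensional Hausdorff measure agree with Lebesgue measure for
  integer \<open>s\<close>. Boundedness is required because \<^const>\<open>diameter\<close> is unspecified on unbounded sets;
  since \<open>0 powr s = 0\<close>, empty sets in a cover cost nothing. Only meant for \<open>s > 0\<close>.
\<close>

definition hausdorff_content :: "real \<Rightarrow> real \<Rightarrow> 'a::metric_space set \<Rightarrow> ennreal" where
  "hausdorff_content s \<delta> A =
     (INF C \<in> {C :: nat \<Rightarrow> 'a set. A \<subseteq> (\<Union>i. C i) \<and> (\<forall>i. bounded (C i) \<and> diameter (C i) \<le> \<delta>)}.
        \<Sum>i. ennreal (unit_ball_vol s * (diameter (C i) / 2) powr s))"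

definition hausdorff_outer :: "real \<Rightarrow> 'a::metric_space set \<Rightarrow> ennreal" where
  "hausdorff_outer s A = (SUP \<delta> \<in> {0<..}. hausdorff_content s \<delta> A)"

abbreviation unit_sphere :: "(real ^ 'n) set" where
  "unit_sphere \<equiv> sphere 0 1"

abbreviation borel_sphere :: "(real ^ 'n) measure" where
  "borel_sphere \<equiv> restrict_space borel unit_sphere"

definition sphere_measure :: "(real ^ 'n) measure" where
  "sphere_measure =
     measure_of unit_sphere (sets borel_sphere) (hausdorff_outer (real CARD('n) - 1))"

definition L_sphere :: "real \<Rightarrow> (real ^ 'n \<Rightarrow> real) set" where
  "L_sphere s = {f \<in> borel_measurable sphere_measure.
     integrable sphere_measure (\<lambda>u. \<bar>f u\<bar> powr s)}"

section \<open>Convex bodies and star bodies\<close>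

definition convex_body :: "(real ^ 'n) set \<Rightarrow> bool" where
  "convex_body K \<longleftrightarrow> compact K \<and> convex K \<and> interior K \<noteq> {}"

definition convex_bodies_o :: "(real ^ 'n) set set" where
  "convex_bodies_o = {K. convex_body K \<and> 0 \<in> interior K}"

text \<open>
  The suprema below are maxima in the cases of interest: nonempty compact \<open>K\<close>, and compact \<open>Q\<close>
  containing the origin with \<open>x \<noteq> 0\<close>, respectively.
\<close>

definition support_fun :: "(real ^ 'n) set \<Rightarrow> real ^ 'n \<Rightarrow> real" where
  "support_fun K y = (SUP x \<in> K. x \<bullet> y)"

definition radial_fun :: "(real ^ 'n) set \<Rightarrow> real ^ 'n \<Rightarrow> real" where
  "radial_fun Q x = Sup {t. t *\<^sub>R x \<in> Q}"

definition star_body :: "(real ^ 'n) set \<Rightarrow> bool" where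
  "star_body Q \<longleftrightarrow> compact Q \<and> 0 \<in> Q \<and> (\<forall>x\<in>Q. closed_segment 0 x \<subseteq> Q) \<and>
     (\<forall>x. x \<noteq> 0 \<longrightarrow> radial_fun Q x > 0) \<and> continuous_on (- {0}) (radial_fun Q)"

section \<open>Dual curvature measures\<close>

definition reverse_radial_Gauss_image :: "(real ^ 'n) set \<Rightarrow> (real ^ 'n) set \<Rightarrow> (real ^ 'n) set" where
  "reverse_radial_Gauss_image K \<eta> =
     {u \<in> unit_sphere. \<exists>v\<in>\<eta>. (radial_fun K u *\<^sub>R u) \<bullet> v = support_fun K v}"

text \<open>
  For Borel \<open>\<eta>\<close> the set \<open>reverse_radial_Gauss_image K \<eta>\<close> is in general only Lebesgue measurable
  on the sphere, hence the completion.
\<close>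

definition dual_curvature_measure ::
    "real \<Rightarrow> (real ^ 'n) set \<Rightarrow> (real ^ 'n) set \<Rightarrow> (real ^ 'n) measure" where
  "dual_curvature_measure q K Q =
     measure_of unit_sphere (sets borel_sphere)
       (\<lambda>\<eta>. ennreal (1 / real CARD('n)) *
          (\<integral>\<^sup>+u\<in>reverse_radial_Gauss_image K \<eta>.
             ennreal (radial_fun K u powr q * radial_fun Q u powr (real CARD('n) - q))
           \<partial>completion sphere_measure))"

definition Lp_dual_curvature_measure ::
    "real \<Rightarrow> real \<Rightarrow> (real ^ 'n) set \<Rightarrow> (real ^ 'n) set \<Rightarrow> (real ^ 'n) measure" where
  "Lp_dual_curvature_measure p q K Q =
     density (dual_curvature_measure q K Q) (\<lambda>v. ennreal (support_fun K v powr (- p)))"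

section \<open>Symmetry groups\<close>

definition orthogonal_group :: "(real ^ 'n ^ 'n) monoid" where
  "orthogonal_group = \<lparr>carrier = Collect orthogonal_matrix, mult = (**), one = mat 1\<rparr>"

lemma group_orthogonal_group: "group (orthogonal_group :: (real ^ 'n ^ 'n) monoid)"
proof (rule groupI)
  fix A :: "real ^ 'n ^ 'n"
  assume "A \<in> carrier orthogonal_group"
  then have "orthogonal_matrix A" by (simp add: orthogonal_group_def)
  then show "\<exists>B\<in>carrier orthogonal_group. B \<otimes>\<^bsub>orthogonal_group\<^esub> A = \<one>\<^bsub>orthogonal_group\<^esub>"
    by (intro bexI[of _ "transpose A"])
       (auto simp: orthogonal_group_def orthogonal_matrix_def)
qed (auto simp: orthogonal_group_def orthogonal_matrix_mul orthogonal_matrix_id matrix_mul_assoc)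

definition invariant_set :: "(real ^ 'n ^ 'n) set \<Rightarrow> (real ^ 'n) set \<Rightarrow> bool" where
  "invariant_set G E \<longleftrightarrow> (\<forall>g\<in>G. (*v) g ` E = E)"

definition invariant_measure :: "(real ^ 'n ^ 'n) set \<Rightarrow> (real ^ 'n) measure \<Rightarrow> bool" where
  "invariant_measure G \<mu> \<longleftrightarrow> (\<forall>g\<in>G. \<forall>E\<in>sets \<mu>. emeasure \<mu> ((*v) g ` E) = emeasure \<mu> E)"

section \<open>The critical exponent\<close>

definition q_star :: "nat \<Rightarrow> real \<Rightarrow> ereal" where
  "q_star n q =
     (if q \<ge> real n then ereal (q / (q - real n + 1))
      else if 1 < q then ereal ((real n - 1) * q / (q - 1))
      else \<infinity>)"

end

theory Submission
  imports Defs "HOL-Complex_Analysis.Great_Picard"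
begin

text \<open>
  Among positive continuous \<open>G\<close>-invariant functions \<open>h\<close> on the sphere one maximises the scale
  invariant quantity \<open>V(h)\<^bsup>1/q\<^esup> I(h)\<^bsup>-1/p\<^esup>\<close>, where \<open>V\<close> is the dual volume of the Wulff shape of \<open>h\<close> and \<open>I\<close>
  is the integral of \<open>h\<^sup>p\<close> against \<open>\<mu>\<close>. Since no direction is fixed, an invariant body \<open>K\<close> satisfies
  \<open>-K \<subseteq> n K\<close> and is comparable to a box. Evaluating both integrals on boxes gives a
  Blaschke-Santalo type bound for the pair of exponents \<open>(q, q\<^sup>*)\<close>, and decay for eccentric boxes in the
  subcritical range; together with the integrability of the density this forces maximising
  sequences to stay non-degenerate. At the maximiser the first variation, computed through the
  almost everywhere unique normals, says that the dual curvature measure and \<open>h\<^sup>p \<mu>\<close> have the same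
  integrals against invariant functions. As both are invariant, they agree up to a factor, which
  is removed by scaling.
\<close>

section \<open>Hausdorff measure on the sphere\<close>

text \<open>Both branches of \<open>q_star\<close> encode one relation, 1/Q + (n-1)/R = 1, where R
  is the exponent that is at least n and Q the other one; the branch decides which of them is q. It
  says that the L^R norm over one body times the L^Q norm over the polar one is bounded for a box
  and its polar box, whatever the eccentricity. The obstacle is that s is exactly conjugate to this
  critical pairing, so Hoelder's inequality bounds the functional on eccentric bodies without making
  it small. Decay is recovered by truncating the density: its bounded part tolerates a smaller
  exponent, for which the product does decay, and its tail has small L^s norm. Competitors range
  over all invariant positive functions and not over support functions. Hence a multiplicative
  perturbation stays in the class, while passing to the support function of the Wulff shape never
  lowers the functional. The spherical measure enters through finiteness, rotation invariance, null
  sets and upper bounds for thin sets, all accessible by comparison with the volume of cones. That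
  it is not zero is read off from \<open>\<mu>\<close>.\<close>

lemma translation_invariant_measure_cross:
  fixes M :: "'a::euclidean_space measure"
  assumes "sigma_finite_measure M" and sets[measurable_cong]: "sets M = sets borel"
    and inv: "\<And>a. distr M borel (\<lambda>x. x + a) = M"
    and [measurable]: "A \<in> sets borel" "B \<in> sets borel"
  shows "emeasure M A * emeasure lborel B = emeasure M B * emeasure lborel A"
proof -
  interpret M: sigma_finite_measure M by fact
  interpret pair_sigma_finite M lborel
    by (simp add: pair_sigma_finite_def M.sigma_finite_measure_axioms lborel.sigma_finite_measure_axioms)
  have lb: "(\<integral>\<^sup>+y. indicator B (x + y) \<partial>lborel) = emeasure lborel B" for x
  proof -
    have "(\<integral>\<^sup>+y. indicator B (x + y) \<partial>lborel) = (\<integral>\<^sup>+y. indicator B y \<partial>distr lborel borel ((+) x))"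
      by (subst nn_integral_distr) auto
    then show ?thesis by (simp add: lborel_distr_plus)
  qed
  have la: "(\<integral>\<^sup>+y. indicator A (x - y) \<partial>lborel) = emeasure lborel A" for x
  proof -
    have "(\<integral>\<^sup>+y. indicator A y \<partial>lborel) = (\<integral>\<^sup>+y. indicator A y \<partial>density (distr lborel borel (\<lambda>y. x + (-1) *\<^sub>R y)) (\<lambda>_. ennreal (\<bar>-1\<bar>^DIM('a))))"
      by (subst lborel_affine[of "-1" x]) auto
    also have "\<dots> = (\<integral>\<^sup>+y. indicator A (x - y) \<partial>lborel)"
      by (simp add: nn_integral_density nn_integral_distr del: nn_integral_indicator)
    finally show ?thesis by simp
  qed
  have tr: "(\<integral>\<^sup>+x. indicator A x * indicator B (x + y) \<partial>M) = (\<integral>\<^sup>+x. indicator B x * indicator A (x - y) \<partial>M)" for y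
  proof -
    have "(\<integral>\<^sup>+x. indicator A x * indicator B (x + y) \<partial>M) =
        (\<integral>\<^sup>+x. indicator A (x - y) * (indicator B x::ennreal) \<partial>distr M borel (\<lambda>x. x + y))"
      by (subst nn_integral_distr) auto
    then show ?thesis by (simp add: inv mult.commute)
  qed
  \<comment> \<open>Uniqueness of Haar measure: the double integral of 1_A(x) 1_B(x + y), with y
    integrated first, gives the left side. Shifting x under \<open>M\<close> by step
    \<open>tr\<close> turns the integrand into 1_B(x) 1_A(x - y), and integrating y first again
    gives the right side.\<close>
  have "emeasure M A * emeasure lborel B = (\<integral>\<^sup>+x. indicator A x * emeasure lborel B \<partial>M)"
    by (subst nn_integral_multc) (auto simp: sets)
  also have "\<dots> = (\<integral>\<^sup>+x. \<integral>\<^sup>+y. indicator A x * indicator B (x + y) \<partial>lborel \<partial>M)"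
    by (intro nn_integral_cong) (simp add: nn_integral_cmult lb)
  also have "\<dots> = (\<integral>\<^sup>+y. \<integral>\<^sup>+x. indicator A x * indicator B (x + y) \<partial>M \<partial>lborel)"
    by (rule Fubini'[symmetric]) measurable
  also have "\<dots> = (\<integral>\<^sup>+y. \<integral>\<^sup>+x. indicator B x * indicator A (x - y) \<partial>M \<partial>lborel)"
    by (simp add: tr)
  also have "\<dots> = (\<integral>\<^sup>+x. \<integral>\<^sup>+y. indicator B x * indicator A (x - y) \<partial>lborel \<partial>M)"
    by (rule Fubini') measurable
  also have "\<dots> = (\<integral>\<^sup>+x. indicator B x * emeasure lborel A \<partial>M)"
    by (intro nn_integral_cong) (simp add: nn_integral_cmult la)
  also have "\<dots> = emeasure M B * emeasure lborel A"
    by (subst nn_integral_multc) (auto simp: sets)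
  finally show ?thesis .
qed

section \<open>Lebesgue measure under orthogonal maps\<close>

lemma orthogonal_transformation_measurable [measurable_dest]:
  fixes f :: "'a::euclidean_space \<Rightarrow> 'a"
  shows "orthogonal_transformation f \<Longrightarrow> f \<in> borel_measurable borel"
  by (intro borel_measurable_continuous_onI linear_continuous_on)
     (simp add: linear_linear orthogonal_transformation_linear)

text \<open>The image measure is again translation invariant, hence a multiple of Lebesgue measure
  by \<open>translation_invariant_measure_cross\<close>; the unit ball, which is its own preimage,
  shows that the factor is 1.\<close>

lemma distr_lborel_orthogonal:
  fixes f :: "'a::euclidean_space \<Rightarrow> 'a"
  assumes f: "orthogonal_transformation f"
  shows "distr lborel borel f = lborel"
proof (rule measure_eqI)
  let ?M = "distr lborel borel f"
  have [measurable]: "f \<in> borel_measurable borel" using f by (rule orthogonal_transformation_measurable)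
  have lin: "linear f" using f by (rule orthogonal_transformation_linear)
  have ball: "emeasure ?M (ball 0 r) = emeasure lborel (ball (0::'a) r)" for r
  proof -
    have "f -` ball 0 r = ball 0 r"
      using orthogonal_transformation_norm[OF f] by (auto simp: vimage_def)
    then show ?thesis by (subst emeasure_distr) auto
  qed
  have sf: "sigma_finite_measure ?M"
  proof
    let ?A = "range (\<lambda>n::nat. ball (0::'a) (real n))"
    have "(\<Union>?A) = (UNIV::'a set)"
      using reals_Archimedean2 by (auto simp: dist_norm)
    then show "\<exists>A. countable A \<and> A \<subseteq> sets ?M \<and> \<Union>A = space ?M \<and> (\<forall>a\<in>A. emeasure ?M a \<noteq> \<infinity>)"
      by (intro exI[of _ ?A]) (auto simp: ball intro!: less_imp_neq[OF emeasure_lborel_ball_finite, unfolded infinity_ennreal_def])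
  qed
  have inv: "distr ?M borel (\<lambda>x. x + a) = ?M" for a
  proof -
    obtain b where b: "a = f b" using orthogonal_transformation_surj[OF f] by (metis surjD)
    have "distr ?M borel (\<lambda>x. x + a) = distr lborel borel (\<lambda>x. f x + a)"
      by (subst distr_distr) (auto simp: comp_def)
    also have "\<dots> = distr lborel borel (f \<circ> (+) b)"
      using lin by (simp add: b linear_add comp_def add.commute)
    also have "\<dots> = distr (distr lborel borel ((+) b)) borel f"
      by (subst distr_distr) auto
    finally show ?thesis by (simp add: lborel_distr_plus)
  qed
  fix A assume A: "A \<in> sets ?M"
  have "emeasure ?M A * emeasure lborel (ball (0::'a) 1) = emeasure ?M (ball 0 1) * emeasure lborel A"
    by (rule translation_invariant_measure_cross[OF sf _ inv]) (use A in auto)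
  moreover have "emeasure lborel (ball (0::'a) 1) \<noteq> \<infinity>" "emeasure lborel (ball (0::'a) 1) \<noteq> 0"
    using emeasure_lborel_ball_finite[of "0::'a" 1] emeasure_ball[of 1 "0::'a"] unit_ball_vol_pos[of "real DIM('a)"]
    by (auto simp del: unit_ball_vol_pos)
  moreover have "emeasure ?M (ball 0 1) = emeasure lborel (ball (0::'a) 1)" by (rule ball)
  ultimately show "emeasure ?M A = emeasure lborel A"
    using ennreal_mult_cancel_left[of "emeasure lborel (ball (0::'a) 1)" "emeasure ?M A" "emeasure lborel A"]
    by (auto simp: mult.commute)
qed simp

text \<open>Volume of the part of the unit ball lying over a set of directions. It is a measure on
  the whole space, so it applies directly to open and Borel sets there; the convention
  \<open>sgn 0 = 0\<close> affects only the Lebesgue null set containing the origin.\<close>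

definition cone_measure :: "(real ^ 'n) measure" where
  "cone_measure = distr (density lborel (indicator (cball 0 1))) borel sgn"

lemma sgn_borel_measurable [measurable]: "(sgn :: 'a::euclidean_space \<Rightarrow> 'a) \<in> borel_measurable borel"
  unfolding sgn_div_norm by measurable

lemma sets_cone_measure [simp, measurable_cong]: "sets cone_measure = sets borel"
  by (simp add: cone_measure_def)

lemma space_cone_measure [simp]: "space cone_measure = UNIV"
  by (simp add: cone_measure_def)

lemma emeasure_cone_measure:
  assumes [measurable]: "A \<in> sets borel"
  shows "emeasure cone_measure A = emeasure lborel {x \<in> cball 0 1. sgn x \<in> A}"
proof -
  have [measurable]: "{x. sgn x \<in> A} \<in> sets borel"
    using measurable_sets[OF sgn_borel_measurable assms] by (simp add: vimage_def)
  have "emeasure cone_measure A = emeasure (density lborel (indicator (cball 0 1))) {x. sgn x \<in> A}"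
    unfolding cone_measure_def by (subst emeasure_distr) (auto simp: vimage_def)
  also have "\<dots> = emeasure lborel {x \<in> cball 0 1. sgn x \<in> A}"
  proof -
    have "{x \<in> cball 0 1. sgn x \<in> A} = cball 0 1 \<inter> {x. sgn x \<in> A}" by auto
    then have [measurable]: "{x \<in> cball 0 1. sgn x \<in> A} \<in> sets borel" by auto
    show ?thesis
      by (subst emeasure_density)
         (auto intro!: nn_integral_cong borel_measurable_indicator simp: indicator_def simp flip: nn_integral_indicator)
  qed
  finally show ?thesis .
qed

lemma finite_cone_measure: "finite_measure (cone_measure :: (real^'n) measure)"
proof
  have "emeasure cone_measure (space (cone_measure::(real^'n) measure)) = emeasure lborel (cball (0::real^'n) 1)"
    by (subst emeasure_cone_measure) (auto simp: cball_def dist_norm)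
  then show "emeasure cone_measure (space (cone_measure::(real^'n) measure)) \<noteq> \<infinity>"
    using emeasure_lborel_cball_finite[of "0::real^'n" 1] by (simp add: less_top)
qed

lemma emeasure_lborel_cbox_cart:
  fixes a b :: "real^'n"
  assumes "\<And>i. a $ i \<le> b $ i"
  shows "emeasure lborel (cbox a b) = ennreal (\<Prod>i\<in>UNIV. b $ i - a $ i)"
proof -
  have "cbox a b \<noteq> {}" using assms by (auto simp: interval_ne_empty_cart)
  then show ?thesis
    using content_cbox_cart[of a b]
    by (subst emeasure_eq_ennreal_measure) (use emeasure_lborel_cbox_finite[of a b] in \<open>auto simp: less_top\<close>)
qed

lemma emeasure_lborel_orthogonal_image:
  fixes f :: "'a::euclidean_space \<Rightarrow> 'a"
  assumes f: "orthogonal_transformation f" and A: "A \<in> sets borel" and fA: "f ` A \<in> sets borel"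
  shows "emeasure lborel (f ` A) = emeasure lborel A"
proof -
  have "f -` f ` A = A"
    using orthogonal_transformation_inj[OF f] by (rule inj_vimage_image_eq)
  then have "emeasure (distr lborel borel f) (f ` A) = emeasure lborel A"
    by (subst emeasure_distr) (use f fA in \<open>auto intro: orthogonal_transformation_measurable\<close>)
  then show ?thesis by (simp add: distr_lborel_orthogonal[OF f])
qed

text \<open>A thin box around the segment from 1/2 to 3/4 on a coordinate axis lies in the cone over
  a cap, and its volume is the bound. An orthogonal map turns the axis towards
  \<open>x\<close>.\<close>

lemma cone_measure_ball_ge:
  fixes x :: "real^'n"
  assumes x: "norm x = 1" and r: "0 < r" "r \<le> 1"
  shows "ennreal (1/4 * (r / (4 * CARD('n))) ^ (CARD('n) - 1)) \<le> emeasure cone_measure (ball x r)"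
proof -
  let ?n = "real CARD('n)"
  obtain k :: 'n where True by simp
  let ?e = "axis k 1 :: real^'n"
  obtain f where f: "orthogonal_transformation f" and fe: "f ?e = x"
    using x orthogonal_transformation_exists_1[of ?e x] by (auto simp: norm_axis_1)
  \<comment> \<open>Half-width r / (8n) keeps the part transverse to the axis below r / 8. Height at
    least 1/2 costs at most a factor 2 on normalising, and height at most 3/4 leaves the box inside
    the unit ball.\<close>
  define l :: "real^'n" where "l = (\<chi> i. if i = k then 1/2 else - (r / (8 * ?n)))"
  define u :: "real^'n" where "u = (\<chi> i. if i = k then 3/4 else r / (8 * ?n))"
  have sub: "f ` cbox l u \<subseteq> {x' \<in> cball 0 1. sgn x' \<in> ball x r}"
  proof clarify
    fix y assume "y \<in> cbox l u"
    then have yi: "\<And>i. l $ i \<le> y $ i" "\<And>i. y $ i \<le> u $ i" by (auto simp: mem_box_cart)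
    have yk: "1/2 \<le> y $ k" "y $ k \<le> 3/4" using yi[of k] by (auto simp: l_def u_def)
    define w where "w = y - (y $ k) *\<^sub>R ?e"
    have "norm w \<le> (\<Sum>i\<in>UNIV. \<bar>w $ i\<bar>)" by (rule norm_le_l1_cart)
    also have "\<dots> \<le> (\<Sum>i\<in>(UNIV::'n set). r / (8 * ?n))"
    proof (rule sum_mono)
      fix i
      show "\<bar>w $ i\<bar> \<le> r / (8 * ?n)"
      proof (cases "i = k")
        case True then show ?thesis using r by (simp add: w_def axis_def)
      next
        case False then show ?thesis using yi[of i] by (auto simp: w_def axis_def l_def u_def abs_le_iff)
      qed
    qed
    also have "\<dots> = r / 8" by simp
    finally have w: "norm w \<le> r / 8" .
    have ny1: "norm y \<le> norm w + y $ k"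
      using norm_triangle_ineq[of w "(y $ k) *\<^sub>R ?e"] yk by (simp add: w_def norm_axis_1)
    have ny2: "y $ k \<le> norm y" using component_le_norm_cart[of y k] yk by linarith
    have "norm (y - norm y *\<^sub>R ?e) = norm (w - (norm y - y $ k) *\<^sub>R ?e)"
      by (simp add: w_def algebra_simps)
    also have "\<dots> \<le> norm w + \<bar>norm y - y $ k\<bar>"
      using norm_triangle_ineq4[of w "(norm y - y $ k) *\<^sub>R ?e"] by (simp add: norm_axis_1)
    also have "\<dots> \<le> r / 4" using w ny1 ny2 by simp
    finally have d: "norm (y - norm y *\<^sub>R ?e) \<le> r / 4" .
    have y0: "norm y \<ge> 1/2" using yk ny2 by linarith
    then have "y \<noteq> 0" by auto
    then have eq: "sgn y - ?e = (y - norm y *\<^sub>R ?e) /\<^sub>R norm y"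
      by (simp add: sgn_div_norm algebra_simps)
    have "norm (sgn y - ?e) = norm (y - norm y *\<^sub>R ?e) / norm y"
      unfolding eq norm_scaleR abs_inverse abs_norm_cancel by (rule divide_inverse_commute[symmetric])
    also have "\<dots> \<le> (r / 4) / norm y"
      by (rule divide_right_mono[OF d norm_ge_zero])
    also have "\<dots> \<le> (r / 4) / (1/2)" using y0 r by (intro divide_left_mono) auto
    also have "\<dots> < r" using r by simp
    finally have s: "norm (sgn y - ?e) < r" .
    have lin: "linear f" using f by (rule orthogonal_transformation_linear)
    have "sgn (f y) - x = f (sgn y - ?e)"
      using lin orthogonal_transformation_norm[OF f] by (simp add: sgn_div_norm linear_diff linear_scale fe)
    then have "norm (sgn (f y) - x) < r" using s orthogonal_transformation_norm[OF f] by simp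
    moreover have "norm (f y) \<le> 1" using orthogonal_transformation_norm[OF f, of y] w ny1 yk r by linarith
    ultimately show "f y \<in> cball 0 1 \<and> sgn (f y) \<in> ball x r"
      by (simp add: dist_norm norm_minus_commute)
  qed
  have "(\<Prod>i\<in>UNIV. u $ i - l $ i) = (u $ k - l $ k) * (\<Prod>i\<in>UNIV - {k}. u $ i - l $ i)"
    by (rule prod.remove) auto
  also have "(\<Prod>i\<in>UNIV - {k}. u $ i - l $ i) = (\<Prod>i\<in>UNIV - {k}. r / (4 * ?n))"
    by (intro prod.cong) (auto simp: u_def l_def field_simps)
  also have "u $ k - l $ k = 1/4" by (simp add: u_def l_def)
  finally have pr: "(\<Prod>i\<in>UNIV. u $ i - l $ i) = 1/4 * (r / (4 * ?n)) ^ (CARD('n) - 1)"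
    by (simp add: card_Diff_singleton)
  have "emeasure lborel (cbox l u) = ennreal (\<Prod>i\<in>UNIV. u $ i - l $ i)"
    by (rule emeasure_lborel_cbox_cart) (use r in \<open>auto simp: l_def u_def\<close>)
  moreover have "compact (f ` cbox l u)"
    using f by (intro compact_continuous_image linear_continuous_on)
      (auto simp: linear_linear orthogonal_transformation_linear)
  then have "f ` cbox l u \<in> sets borel" by (simp add: borel_compact)
  then have "emeasure lborel (f ` cbox l u) = emeasure lborel (cbox l u)"
    by (intro emeasure_lborel_orthogonal_image f) auto
  moreover have "{x' \<in> cball 0 1. sgn x' \<in> ball x r} \<in> sets borel"
    using measurable_sets[OF sgn_borel_measurable, of "ball x r"]
    by (simp add: vimage_def Collect_conj_eq sets.Int)
  then have "emeasure lborel (f ` cbox l u) \<le> emeasure lborel {x' \<in> cball 0 1. sgn x' \<in> ball x r}"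
    using sub by (intro emeasure_mono) auto
  ultimately show ?thesis by (simp add: pr emeasure_cone_measure)
qed

section \<open>Hausdorff outer measure: subadditivity, separated sets, isometries\<close>

abbreviation hcost :: "real \<Rightarrow> 'a::metric_space set \<Rightarrow> ennreal" where
  "hcost s A \<equiv> ennreal (unit_ball_vol s * (diameter A / 2) powr s)"

lemma hausdorff_content_le:
  assumes "A \<subseteq> (\<Union>i. C i)" "\<And>i. bounded (C i)" "\<And>i. diameter (C i) \<le> \<delta>"
  shows "hausdorff_content s \<delta> A \<le> (\<Sum>i. hcost s (C i))"
  unfolding hausdorff_content_def using assms by (intro INF_lower) auto

lemma hausdorff_content_mono: "A \<subseteq> B \<Longrightarrow> hausdorff_content s \<delta> A \<le> hausdorff_content s \<delta> B"
  unfolding hausdorff_content_def by (intro INF_superset_mono) auto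

lemma hausdorff_content_antimono: "\<delta> \<le> \<delta>' \<Longrightarrow> hausdorff_content s \<delta>' A \<le> hausdorff_content s \<delta> A"
  unfolding hausdorff_content_def by (intro INF_superset_mono) (auto intro: order_trans)

lemma hausdorff_outer_mono: "A \<subseteq> B \<Longrightarrow> hausdorff_outer s A \<le> hausdorff_outer s B"
  unfolding hausdorff_outer_def by (intro SUP_mono' hausdorff_content_mono)

lemma hausdorff_content_le_outer: "\<delta> > 0 \<Longrightarrow> hausdorff_content s \<delta> A \<le> hausdorff_outer s A"
  unfolding hausdorff_outer_def by (intro SUP_upper) auto

lemma hausdorff_outer_empty [simp]: "hausdorff_outer s {} = 0"
proof -
  have "hausdorff_content s \<delta> ({} :: 'a::metric_space set) = 0" if "\<delta> > 0" for \<delta>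
    using hausdorff_content_le[of "{}::'a set" "\<lambda>_. {}" \<delta> s] that by simp
  then show ?thesis by (simp add: hausdorff_outer_def SUP_eq_const)
qed

lemma hausdorff_content_UN:
  "hausdorff_content s \<delta> (\<Union>i::nat. A i) \<le> (\<Sum>i. hausdorff_content s \<delta> (A i))"
proof (cases "(\<Sum>i. hausdorff_content s \<delta> (A i)) = \<infinity>")
  case False
  show ?thesis
  proof (rule ennreal_le_epsilon)
    fix e :: real assume "e > 0"
    have fin: "hausdorff_content s \<delta> (A i) \<noteq> \<infinity>" for i
      using False ennreal_suminf_lessD[of "\<lambda>i. hausdorff_content s \<delta> (A i)" \<infinity> i] by (simp add: less_top)
    have "\<exists>C. A i \<subseteq> (\<Union>j. C j) \<and> (\<forall>j. bounded (C j) \<and> diameter (C j) \<le> \<delta>) \<and>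
        (\<Sum>j. hcost s (C j)) < hausdorff_content s \<delta> (A i) + ennreal (e * (1/2) ^ Suc i)" for i
    proof -
      have "\<exists>C \<in> {C :: nat \<Rightarrow> 'a set. A i \<subseteq> (\<Union>i. C i) \<and> (\<forall>i. bounded (C i) \<and> diameter (C i) \<le> \<delta>)}.
          (\<Sum>j. hcost s (C j)) < hausdorff_content s \<delta> (A i) + ennreal (e * (1/2) ^ Suc i)"
        by (rule INF_approx_ennreal[OF _ hausdorff_content_def]) (use \<open>e > 0\<close> fin[of i] in auto)
      then show ?thesis by blast
    qed
    then obtain C where C: "\<And>i. A i \<subseteq> (\<Union>j. C i j)" "\<And>i j. bounded (C i j)" "\<And>i j. diameter (C i j) \<le> \<delta>"
        "\<And>i. (\<Sum>j. hcost s (C i j)) \<le> hausdorff_content s \<delta> (A i) + ennreal (e * (1/2) ^ Suc i)"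
      by (metis less_imp_le)
    define D where "D k = (case prod_decode k of (i, j) \<Rightarrow> C i j)" for k
    have "(\<Union>i. A i) \<subseteq> (\<Union>k. D k)"
    proof
      fix x assume "x \<in> (\<Union>i. A i)"
      then obtain i j where "x \<in> C i j" using C(1) by blast
      then have "x \<in> D (prod_encode (i, j))" by (simp add: D_def)
      then show "x \<in> (\<Union>k. D k)" by blast
    qed
    then have "hausdorff_content s \<delta> (\<Union>i. A i) \<le> (\<Sum>k. hcost s (D k))"
      by (rule hausdorff_content_le) (auto simp: D_def C split: prod.split)
    also have "(\<Sum>k. hcost s (D k)) = (\<Sum>k. (\<lambda>(i, j). hcost s (C i j)) (prod_decode k))"
      by (simp add: D_def case_prod_unfold)
    also have "\<dots> = (\<Sum>i. \<Sum>j. hcost s (C i j))"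
      by (subst suminf_ennreal_2dimen[symmetric]) (auto simp: comp_def)
    also have "\<dots> \<le> (\<Sum>i. hausdorff_content s \<delta> (A i) + ennreal (e * (1/2) ^ Suc i))"
      by (intro suminf_le C) auto
    also have "\<dots> = (\<Sum>i. hausdorff_content s \<delta> (A i)) + (\<Sum>i. ennreal (e * (1/2) ^ Suc i))"
      by (intro suminf_add[symmetric]) auto
    also have "(\<Sum>i. ennreal (e * (1/2) ^ Suc i)) = ennreal e"
    proof -
      have "(\<lambda>i. e * (1/2) ^ Suc i) sums (e * 1)" by (intro sums_mult power_half_series)
      then show ?thesis using \<open>e > 0\<close> by (intro suminf_ennreal_eq) auto
    qed
    finally show "hausdorff_content s \<delta> (\<Union>i. A i) \<le> (\<Sum>i. hausdorff_content s \<delta> (A i)) + ennreal e" .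
  qed
qed simp

lemma hausdorff_outer_UN: "hausdorff_outer s (\<Union>i::nat. A i) \<le> (\<Sum>i. hausdorff_outer s (A i))"
proof -
  have "hausdorff_content s \<delta> (\<Union>i. A i) \<le> (\<Sum>i. hausdorff_outer s (A i))" if "\<delta> > 0" for \<delta>
    by (rule order_trans[OF hausdorff_content_UN]) (intro suminf_le hausdorff_content_le_outer that; simp)
  then show ?thesis by (subst hausdorff_outer_def) (auto intro: SUP_least)
qed

lemma hausdorff_outer_Un: "hausdorff_outer s (A \<union> B) \<le> hausdorff_outer s A + hausdorff_outer s B"
proof -
  have "hausdorff_outer s (\<Union>i. binaryset A B i) \<le> (\<Sum>i. hausdorff_outer s (binaryset A B i))"
    by (rule hausdorff_outer_UN)
  also have "\<dots> = hausdorff_outer s A + hausdorff_outer s B"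
    by (subst suminf_finite[of "{0,1}"]) (auto simp: binaryset_def)
  finally show ?thesis by (simp add: UN_binaryset_eq)
qed

text \<open>A set of diameter below \<open>d\<close> cannot meet both \<open>A\<close> and
  \<open>B\<close>, so every sufficiently fine cover of the union splits into a cover of
  each.\<close>

lemma hausdorff_outer_separated:
  assumes d: "d > 0" "\<And>x y. x \<in> A \<Longrightarrow> y \<in> B \<Longrightarrow> d \<le> dist x y"
  shows "hausdorff_outer s A + hausdorff_outer s B \<le> hausdorff_outer s (A \<union> B)"
proof -
  have le: "hausdorff_content s \<delta> A + hausdorff_content s \<delta> B \<le> hausdorff_outer s (A \<union> B)"
    if \<delta>: "\<delta> > 0" "\<delta> < d" for \<delta>
  proof -
    have "hausdorff_content s \<delta> A + hausdorff_content s \<delta> B \<le> (\<Sum>i. hcost s (C i))"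
      if C: "A \<union> B \<subseteq> (\<Union>i. C i)" "\<forall>i. bounded (C i) \<and> diameter (C i) \<le> \<delta>" for C :: "nat \<Rightarrow> 'a set"
    proof -
      \<comment> \<open>Members that miss the set are replaced by the empty set, whose cost is 0, so
        the cover remains indexed by all natural numbers.\<close>
      define CA where "CA i = (if C i \<inter> A = {} then {} else C i)" for i
      define CB where "CB i = (if C i \<inter> B = {} then {} else C i)" for i
      have excl: "C i \<inter> A = {} \<or> C i \<inter> B = {}" for i
      proof (rule ccontr)
        assume "\<not> ?thesis"
        then obtain x y where xy: "x \<in> C i" "x \<in> A" "y \<in> C i" "y \<in> B" by blast
        then have "dist x y \<le> diameter (C i)" using C(2) by (intro diameter_bounded_bound) auto
        then show False using d(2)[OF xy(2,4)] C(2) \<delta> by (meson less_le_trans not_le order_trans)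
      qed
      have "hausdorff_content s \<delta> A + hausdorff_content s \<delta> B \<le> (\<Sum>i. hcost s (CA i)) + (\<Sum>i. hcost s (CB i))"
        using C \<delta> by (intro add_mono hausdorff_content_le) (fastforce simp: CA_def CB_def)+
      also have "\<dots> = (\<Sum>i. hcost s (CA i) + hcost s (CB i))"
        by (intro suminf_add) auto
      also have "\<dots> \<le> (\<Sum>i. hcost s (C i))"
        using excl by (intro suminf_le) (auto simp: CA_def CB_def)
      finally show ?thesis .
    qed
    then have "hausdorff_content s \<delta> A + hausdorff_content s \<delta> B \<le> hausdorff_content s \<delta> (A \<union> B)"
      by (subst (3) hausdorff_content_def) (intro INF_greatest, blast)
    also have "\<dots> \<le> hausdorff_outer s (A \<union> B)" by (rule hausdorff_content_le_outer) fact
    finally show ?thesis .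
  qed
  have "hausdorff_content s \<delta> A + hausdorff_content s \<delta>' B \<le> hausdorff_outer s (A \<union> B)"
    if "\<delta> > 0" "\<delta>' > 0" for \<delta> \<delta>'
  proof -
    \<comment> \<open>The two outer measures are separate suprema, so their scales vary
      independently; both are lowered to a common scale below \<open>d\<close>.\<close>
    let ?m = "min (min \<delta> \<delta>') (d / 2)"
    have "hausdorff_content s \<delta> A + hausdorff_content s \<delta>' B \<le> hausdorff_content s ?m A + hausdorff_content s ?m B"
      by (intro add_mono hausdorff_content_antimono) auto
    also have "\<dots> \<le> hausdorff_outer s (A \<union> B)" using that d(1) by (intro le) auto
    finally show ?thesis .
  qed
  then have "hausdorff_content s \<delta> A + hausdorff_outer s B \<le> hausdorff_outer s (A \<union> B)" if "\<delta> > 0" for \<delta>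
    using that unfolding hausdorff_outer_def[of s B]
    by (subst ennreal_SUP_add_right) (auto intro!: SUP_least)
  then show ?thesis
    unfolding hausdorff_outer_def[of s A]
    by (subst ennreal_SUP_add_left[symmetric]) (auto intro!: SUP_least)
qed

text \<open>Covers are pushed forward without changing diameters. Equality follows by applying the
  bound to the inverse isometry as well.\<close>

lemma hausdorff_outer_isometry_le:
  fixes f :: "'a::metric_space \<Rightarrow> 'b::metric_space"
  assumes f: "\<And>x y. dist (f x) (f y) = dist x y"
  shows "hausdorff_outer s (f ` A) \<le> hausdorff_outer s A"
proof -
  have "hausdorff_content s \<delta> (f ` A) \<le> hausdorff_content s \<delta> A" for \<delta>
    unfolding hausdorff_content_def[of _ _ A]
  proof (intro INF_greatest, clarify)
    fix C :: "nat \<Rightarrow> 'a set"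
    assume C: "A \<subseteq> (\<Union>i. C i)" "\<forall>i. bounded (C i) \<and> diameter (C i) \<le> \<delta>"
    have diam: "diameter (f ` X) = diameter X" for X
      by (auto simp: diameter_def f image_image case_prod_unfold intro!: SUP_cong arg_cong[where f = Sup])
         (metis (no_types, lifting) f fst_conv snd_conv SigmaI image_eqI)+
    have bdd: "bounded (f ` X)" if "bounded X" for X
      using that unfolding bounded_def by (metis f imageE)
    have "hausdorff_content s \<delta> (f ` A) \<le> (\<Sum>i. hcost s (f ` C i))"
      using C by (intro hausdorff_content_le) (fastforce simp: diam intro!: bdd)+
    then show "hausdorff_content s \<delta> (f ` A) \<le> (\<Sum>i. hcost s (C i))" by (simp add: diam)
  qed
  then show ?thesis unfolding hausdorff_outer_def by (intro SUP_mono') auto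
qed

text \<open>
  The Vitali covering lemma turns the lower bound for caps into an upper bound for the Hausdorff
  measure. Only this one-sided comparison of the two measures is needed.
\<close>

lemma hausdorff_outer_open_le:
  assumes n: "CARD('n) \<ge> 2"
  obtains c where "c > 0"
    "\<And>U. open U \<Longrightarrow> hausdorff_outer (real CARD('n) - 1) (U \<inter> sphere (0::real^'n) 1) \<le> ennreal c * emeasure cone_measure U"
proof -
  let ?n = "CARD('n)" let ?s = "real CARD('n) - 1" let ?S = "sphere (0::real^'n) 1"
  \<comment> \<open>\<open>c0\<close> r^(n-1) is the lower bound of
    \<open>cone_measure_ball_ge\<close> for a cap of radius r, and \<open>c1\<close> r^(n-1) is the
    Hausdorff cost of a ball of radius 5r.\<close>
  define c0 where "c0 = 1/4 * (1 / (4 * real ?n)) ^ (?n - 1)"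
  define c1 where "c1 = unit_ball_vol ?s * 5 ^ (?n - 1)"
  have c0: "c0 > 0" unfolding c0_def by simp
  have c1: "c1 > 0" unfolding c1_def using n by (intro mult_pos_pos unit_ball_vol_pos) auto
  have "hausdorff_outer ?s (U \<inter> ?S) \<le> ennreal (c1 / c0) * emeasure cone_measure U" if U: "open U" for U :: "(real^'n) set"
    unfolding hausdorff_outer_def
  proof (rule SUP_least)
    fix \<delta> :: real assume "\<delta> \<in> {0<..}"
    then have \<delta>: "\<delta> > 0" by simp
    \<comment> \<open>The bound \<open>\<delta> / 10\<close> leaves diameter at most
      \<open>\<delta>\<close> after the fivefold enlargement of the covering lemma; the bound 1 is
      the range of \<open>cone_measure_ball_ge\<close>.\<close>
    have "\<exists>r. 0 < r \<and> r \<le> 1 \<and> r \<le> \<delta> / 10 \<and> cball x r \<subseteq> U" if "x \<in> U" for x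
    proof -
      obtain e where "e > 0" "cball x e \<subseteq> U" using U \<open>x \<in> U\<close> by (meson open_contains_cball)
      then show ?thesis using \<delta> by (intro exI[of _ "min e (min 1 (\<delta> / 10))"]) auto
    qed
    then obtain r where r: "\<And>x. x \<in> U \<Longrightarrow> 0 < r x \<and> r x \<le> 1 \<and> r x \<le> \<delta> / 10 \<and> cball x (r x) \<subseteq> U"
      by metis
    obtain C where C: "countable C" "C \<subseteq> U \<inter> ?S"
        "pairwise (\<lambda>i j. disjnt (cball i (r i)) (cball j (r j))) C"
        "\<And>i. i \<in> U \<inter> ?S \<Longrightarrow> \<exists>j. j \<in> C \<and> \<not> disjnt (cball i (r i)) (cball j (r j)) \<and> cball i (r i) \<subseteq> ball j (5 * r j)"
      by (rule Vitali_covering_lemma_cballs_balls[of "U \<inter> ?S" r 1 "\<lambda>x. x"]) (use r in auto)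
    \<comment> \<open>\<open>C\<close> may be finite: \<open>D\<close> holds the indices in use, and
      all other members are empty. The \<open>B i\<close> are the disjoint small balls, the
      \<open>A i\<close> their enlargements, which cover.\<close>
    define D where "D = to_nat_on C ` C"
    define B where "B i = (if i \<in> D then ball (from_nat_into C i) (r (from_nat_into C i)) else {})" for i
    define A where "A i = (if i \<in> D then ball (from_nat_into C i) (5 * r (from_nat_into C i)) else {})" for i
    have fC: "from_nat_into C i \<in> C" if "i \<in> D" for i using that C(1) by (auto simp: D_def)
    have "disjoint_family B"
    unfolding disjoint_family_on_def
    proof (intro ballI impI)
      fix i j :: nat assume "i \<noteq> j"
      show "B i \<inter> B j = {}"
      proof (cases "i \<in> D \<and> j \<in> D")
        case True
        then have "from_nat_into C i \<noteq> from_nat_into C j"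
          using \<open>i \<noteq> j\<close> C(1) by (auto simp: D_def)
        then have "disjnt (cball (from_nat_into C i) (r (from_nat_into C i))) (cball (from_nat_into C j) (r (from_nat_into C j)))"
          using C(3) fC True by (auto simp: pairwise_def)
        then show ?thesis using ball_subset_cball True unfolding B_def disjnt_def by fastforce
      qed (auto simp: B_def)
    qed
    have "U \<inter> ?S \<subseteq> (\<Union>i. A i)"
    proof
      fix x assume x: "x \<in> U \<inter> ?S"
      then obtain j where j: "j \<in> C" "cball x (r x) \<subseteq> ball j (5 * r j)" using C(4) by blast
      moreover have "x \<in> cball x (r x)" using x r[of x] by simp
      ultimately have "x \<in> ball j (5 * r j)" by blast
      with j(1) have "x \<in> A (to_nat_on C j)" using C(1) by (simp add: A_def D_def)
      then show "x \<in> (\<Union>i. A i)" by blast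
    qed
    moreover have "diameter (A i) \<le> \<delta>" "bounded (A i)" for i
      using r[of "from_nat_into C i"] fC[of i] C(2) \<delta> by (auto simp: A_def diameter_ball)
    ultimately have "hausdorff_content ?s \<delta> (U \<inter> ?S) \<le> (\<Sum>i. hcost ?s (A i))"
      by (intro hausdorff_content_le) auto
    also have "\<dots> \<le> (\<Sum>i. ennreal (c1 / c0) * emeasure cone_measure (B i))"
    proof (intro suminf_le)
      fix i
      show "hcost ?s (A i) \<le> ennreal (c1 / c0) * emeasure cone_measure (B i)"
      proof (cases "i \<in> D")
        case True
        let ?x = "from_nat_into C i"
        have x: "?x \<in> U" "norm ?x = 1" using fC[OF True] C(2) by auto
        have "unit_ball_vol ?s * (diameter (A i) / 2) powr ?s = c1 * r ?x ^ (?n - 1)"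
        proof -
          have d: "diameter (A i) / 2 = 5 * r ?x" using True r[OF x(1)] by (simp add: A_def diameter_ball)
          have e: "?s = real (?n - 1)" using n by (simp add: of_nat_diff)
          have "(5 * r ?x) powr real (?n - 1) = (5 * r ?x) ^ (?n - 1)"
            using r[OF x(1)] by (intro powr_realpow) simp
          then have "(diameter (A i) / 2) powr ?s = (5 * r ?x) ^ (?n - 1)" by (simp only: d e)
          then show ?thesis by (simp add: c1_def power_mult_distrib)
        qed
        also have "\<dots> = c1 / c0 * (1/4 * (r ?x / (4 * real ?n)) ^ (?n - 1))"
          by (simp add: c0_def power_divide)
        finally have eq: "unit_ball_vol ?s * (diameter (A i) / 2) powr ?s = c1 / c0 * (1/4 * (r ?x / (4 * real ?n)) ^ (?n - 1))" .
        have "hcost ?s (A i) = ennreal (c1 / c0) * ennreal (1/4 * (r ?x / (4 * real ?n)) ^ (?n - 1))"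
          unfolding eq using c0 c1 r[OF x(1)] by (intro ennreal_mult) auto
        also have "\<dots> \<le> ennreal (c1 / c0) * emeasure cone_measure (B i)"
          using cone_measure_ball_ge[OF x(2)] r[OF x(1)] True by (intro mult_left_mono) (auto simp: B_def)
        finally show ?thesis .
      qed (simp add: A_def)
    qed auto
    also have "\<dots> = ennreal (c1 / c0) * (\<Sum>i. emeasure cone_measure (B i))"
      by (rule ennreal_suminf_cmult)
    also have "(\<Sum>i. emeasure cone_measure (B i)) = emeasure cone_measure (\<Union>i. B i)"
      by (rule suminf_emeasure[OF _ \<open>disjoint_family B\<close>]) (auto simp: B_def)
    also have "\<dots> \<le> emeasure cone_measure U"
    proof (intro emeasure_mono)
      show "(\<Union>i. B i) \<subseteq> U"
      proof (intro UN_least)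
        fix i show "B i \<subseteq> U"
        proof (cases "i \<in> D")
          case True
          then have "from_nat_into C i \<in> U" using fC C(2) by blast
          then have "cball (from_nat_into C i) (r (from_nat_into C i)) \<subseteq> U" using r by blast
          then show ?thesis using True order_trans[OF ball_subset_cball] by (simp add: B_def)
        qed (simp add: B_def)
      qed
    qed (use U in auto)
    finally show "hausdorff_content ?s \<delta> (U \<inter> ?S) \<le> ennreal (c1 / c0) * emeasure cone_measure U"
      by (simp add: mult_left_mono)
  qed
  then show ?thesis using that[of "c1 / c0"] c0 c1 by simp
qed

text \<open>Outer regularity of the finite measure \<open>cone_measure\<close> carries the bound
  from open sets to Borel sets.\<close>

lemma hausdorff_outer_le_cone_measure:
  assumes n: "CARD('n) \<ge> 2"
  obtains c where "c > 0"
    "\<And>E. E \<in> sets borel \<Longrightarrow> hausdorff_outer (real CARD('n) - 1) (E \<inter> sphere (0::real^'n) 1) \<le> ennreal c * emeasure cone_measure E"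
proof -
  obtain c where c: "c > 0"
    "\<And>U. open U \<Longrightarrow> hausdorff_outer (real CARD('n) - 1) (U \<inter> sphere (0::real^'n) 1) \<le> ennreal c * emeasure cone_measure U"
    by (rule hausdorff_outer_open_le[OF n]) blast
  interpret finite_measure "cone_measure :: (real^'n) measure" by (rule finite_cone_measure)
  have "hausdorff_outer (real CARD('n) - 1) (E \<inter> sphere 0 1) \<le> ennreal c * emeasure cone_measure E"
    if E: "E \<in> sets borel" for E :: "(real^'n) set"
  proof -
    show ?thesis
    proof (rule ennreal_le_epsilon)
      fix e :: real assume e: "e > 0"
      have "emeasure cone_measure E = (INF U\<in>{U. E \<subseteq> U \<and> open U}. emeasure cone_measure U)"
        using outer_regular[of cone_measure E] E emeasure_finite[of "UNIV"] by simp
      then have "\<exists>U\<in>{U. E \<subseteq> U \<and> open U}. emeasure cone_measure U < emeasure cone_measure E + ennreal (e / c)"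
        by (rule INF_approx_ennreal[rotated]) (use e c(1) emeasure_finite in auto)
      then obtain U where U: "E \<subseteq> U" "open U" "emeasure cone_measure U < emeasure cone_measure E + ennreal (e / c)"
        by blast
      have "hausdorff_outer (real CARD('n) - 1) (E \<inter> sphere 0 1) \<le> ennreal c * emeasure cone_measure U"
        using U(1) by (intro order_trans[OF hausdorff_outer_mono c(2)[OF U(2)]]) auto
      also have "\<dots> \<le> ennreal c * (emeasure cone_measure E + ennreal (e / c))"
        using U(3) by (intro mult_left_mono) auto
      also have "\<dots> = ennreal c * emeasure cone_measure E + ennreal e"
        using c(1) e by (simp add: distrib_left flip: ennreal_mult)
      finally show "hausdorff_outer (real CARD('n) - 1) (E \<inter> sphere 0 1) \<le> ennreal c * emeasure cone_measure E + ennreal e" .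
    qed
  qed
  then show ?thesis using that c(1) by blast
qed

text \<open>Closed sets are measurable for a metric outer measure. The usual summation over annuli
  is replaced by the comparison with a finite measure, under which the shells around
  \<open>F\<close> shrink to measure 0.\<close>

lemma hausdorff_outer_caratheodory:
  fixes F :: "(real^'n) set"
  assumes n: "CARD('n) \<ge> 2" and F: "closed F" and A: "A \<subseteq> sphere 0 1"
  shows "hausdorff_outer (real CARD('n) - 1) (A \<inter> F) + hausdorff_outer (real CARD('n) - 1) (A - F) =
    hausdorff_outer (real CARD('n) - 1) A"
proof (rule antisym)
  let ?H = "hausdorff_outer (real CARD('n) - 1) :: (real^'n) set \<Rightarrow> _"
  show "?H A \<le> ?H (A \<inter> F) + ?H (A - F)"
    using hausdorff_outer_Un[of "real CARD('n) - 1" "A \<inter> F" "A - F"] by (simp add: Int_Diff_Un)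
  obtain c where c: "c > 0" "\<And>E. E \<in> sets borel \<Longrightarrow> ?H (E \<inter> sphere 0 1) \<le> ennreal c * emeasure cone_measure E"
    by (rule hausdorff_outer_le_cone_measure[OF n]) blast
  interpret finite_measure "cone_measure :: (real^'n) measure" by (rule finite_cone_measure)
  show "?H (A \<inter> F) + ?H (A - F) \<le> ?H A"
  proof (cases "F = {}")
    case False
    \<comment> \<open>The shells leave out \<open>F\<close> itself, so that they have empty
      intersection. The case \<open>F = {}\<close> is separate because \<open>infdist\<close> to the
      empty set is 0 by convention.\<close>
    define T where "T k = {x. 0 < infdist x F \<and> infdist x F < 1 / real (Suc k)}" for k
    have [measurable]: "T k \<in> sets borel" for k
      unfolding T_def by (intro borel_open open_Collect_conj open_Collect_less continuous_intros)
    have "(\<lambda>k. emeasure cone_measure (T k)) \<longlonglongrightarrow> emeasure cone_measure (\<Inter>k. T k)"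
    proof (intro Lim_emeasure_decseq)
      show "decseq T"
      proof (rule decseq_SucI)
        fix k
        have "1 / real (Suc (Suc k)) \<le> 1 / real (Suc k)" by (simp add: field_simps)
        then show "T (Suc k) \<subseteq> T k" by (auto simp: T_def)
      qed
    qed (auto simp: emeasure_finite)
    moreover have "(\<Inter>k. T k) = {}"
    proof -
      have False if "x \<in> (\<Inter>k. T k)" for x
      proof -
        have "0 < infdist x F" using that by (auto simp: T_def)
        then obtain k where "1 / real (Suc k) < infdist x F" using nat_approx_posE by blast
        then show False using that by (auto simp: T_def) (meson less_asym)
      qed
      then show ?thesis by blast
    qed
    ultimately have "(\<lambda>k. emeasure cone_measure (T k)) \<longlonglongrightarrow> 0" by simp
    then have "(\<lambda>k. ?H A + ennreal c * emeasure cone_measure (T k)) \<longlonglongrightarrow> ?H A + ennreal c * 0"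
      by (intro tendsto_intros ennreal_tendsto_cmult) auto
    then have lim: "(\<lambda>k. ?H A + ennreal c * emeasure cone_measure (T k)) \<longlonglongrightarrow> ?H A" by simp
    have "?H (A \<inter> F) + ?H (A - F) \<le> ?H A + ennreal c * emeasure cone_measure (T k)" for k
    proof -
      \<comment> \<open>These points keep a positive distance from \<open>F\<close>, so additivity
        on separated sets applies to them; what they miss of \<open>A - F\<close> lies in the
        shell.\<close>
      define B where "B = {x \<in> A. 1 / real (Suc k) \<le> infdist x F}"
      have "A - F \<subseteq> B \<union> (T k \<inter> sphere 0 1)"
        using A in_closed_iff_infdist_zero[OF F False] infdist_nonneg[of _ F]
        by (auto simp: B_def T_def order_less_le)
      then have "?H (A - F) \<le> ?H B + ?H (T k \<inter> sphere 0 1)"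
        using hausdorff_outer_mono hausdorff_outer_Un order_trans by metis
      also have "\<dots> \<le> ?H B + ennreal c * emeasure cone_measure (T k)"
        by (intro add_left_mono c) auto
      finally have "?H (A \<inter> F) + ?H (A - F) \<le> (?H (A \<inter> F) + ?H B) + ennreal c * emeasure cone_measure (T k)"
        by (simp add: add.assoc add_left_mono)
      also have "?H (A \<inter> F) + ?H B \<le> ?H (A \<inter> F \<union> B)"
      proof (rule hausdorff_outer_separated[of "1 / real (Suc k)"])
        fix x y assume "x \<in> A \<inter> F" "y \<in> B"
        then show "1 / real (Suc k) \<le> dist x y"
          using infdist_le[of x F y] by (auto simp: B_def dist_commute)
      qed simp
      also have "?H (A \<inter> F \<union> B) \<le> ?H A" by (intro hausdorff_outer_mono) (auto simp: B_def)
      finally show ?thesis by (simp add: add_right_mono)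
    qed
    then show ?thesis using lim by (intro LIMSEQ_le_const) auto
  qed simp
qed

section \<open>The spherical measure on Borel sets\<close>

lemma space_borel_sphere: "space (borel_sphere :: (real^'n) measure) = unit_sphere"
  by (simp add: space_restrict_space)

lemma sets_borel_sphere: "sets (borel_sphere :: (real^'n) measure) = {A \<in> sets borel. A \<subseteq> unit_sphere}"
  by (rule Set.set_eqI) (simp add: sets_restrict_space_iff conj_commute)

lemma sets_borel_sphere_eq_sigma_closed:
  "sets (borel_sphere :: (real^'n) measure) = sigma_sets unit_sphere {F. closed F \<and> F \<subseteq> unit_sphere}"
proof -
  have "sets (borel_sphere :: (real^'n) measure) = sigma_sets unit_sphere ((\<inter>) unit_sphere ` Collect closed)"
    unfolding borel_eq_closed
    by (subst sets_restrict_space, subst sets_measure_of, simp)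
       (intro sigma_sets_Int, simp_all flip: borel_eq_closed sets_measure_of)
  also have "(\<inter>) unit_sphere ` Collect closed = {F :: (real^'n) set. closed F \<and> F \<subseteq> unit_sphere}"
    by (auto simp: image_iff intro: Int_absorb1[symmetric])
  finally show ?thesis .
qed

text \<open>\<open>measure_of\<close> returns the zero measure unless the given function is a
  measure, so the definition of \<open>sphere_measure\<close> gets its content here. The closed sets
  lie in the Caratheodory system and generate the Borel sets.\<close>

lemma measure_space_sphere:
  assumes n: "CARD('n) \<ge> 2"
  shows "measure_space unit_sphere (sets (borel_sphere :: (real^'n) measure)) (hausdorff_outer (real CARD('n) - 1))"
proof -
  let ?H = "hausdorff_outer (real CARD('n) - 1) :: (real^'n) set \<Rightarrow> _" let ?S = "unit_sphere :: (real^'n) set"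
  interpret sigma_algebra ?S "Pow ?S" by (rule sigma_algebra_Pow)
  have "outer_measure_space (Pow ?S) ?H"
    unfolding outer_measure_space_def positive_def increasing_def countably_subadditive_def
    by (auto intro: hausdorff_outer_mono hausdorff_outer_UN)
  then have ms: "measure_space ?S (lambda_system ?S (Pow ?S) ?H) ?H" by (rule caratheodory_lemma)
  then have sa: "sigma_algebra ?S (lambda_system ?S (Pow ?S) ?H)" by (simp add: measure_space_def)
  have "sets (borel_sphere :: (real^'n) measure) \<subseteq> lambda_system ?S (Pow ?S) ?H"
    unfolding sets_borel_sphere_eq_sigma_closed
  proof (rule sigma_algebra.sigma_sets_subset[OF sa], clarify)
    fix F :: "(real^'n) set" assume "closed F" "F \<subseteq> ?S"
    then show "F \<in> lambda_system ?S (Pow ?S) ?H"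
      by (subst lambda_system_eq) (auto intro: hausdorff_outer_caratheodory[OF n])
  qed
  moreover have "sigma_algebra ?S (sets (borel_sphere :: (real^'n) measure))"
    using sets.sigma_algebra_axioms[of "borel_sphere :: (real^'n) measure"] by (simp only: space_borel_sphere)
  ultimately show ?thesis
    using ms by (auto simp: measure_space_def positive_def countably_additive_def subset_iff)
qed

lemma sets_sphere_measure [simp, measurable_cong]: "sets sphere_measure = sets (borel_sphere :: (real^'n) measure)"
  unfolding sphere_measure_def
  by (metis sets.sets_measure_of_eq space_borel_sphere)

lemma space_sphere_measure [simp]: "space sphere_measure = (unit_sphere :: (real^'n) set)"
  unfolding sphere_measure_def by (simp add: space_measure_of_conv)

lemma emeasure_sphere_measure:
  assumes n: "CARD('n) \<ge> 2" and E: "E \<in> sets (borel_sphere :: (real^'n) measure)"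
  shows "emeasure sphere_measure E = hausdorff_outer (real CARD('n) - 1) E"
  using measure_space_sphere[OF n] E unfolding sphere_measure_def
  by (intro emeasure_measure_of_sigma) (auto simp: measure_space_def)

lemma sphere_measure_le_cone_measure:
  assumes n: "CARD('n) \<ge> 2"
  obtains c where "c > 0"
    "\<And>E. E \<in> sets borel_sphere \<Longrightarrow> emeasure sphere_measure (E :: (real^'n) set) \<le> ennreal c * emeasure cone_measure E"
proof -
  obtain c where c: "c > 0" "\<And>E. E \<in> sets borel \<Longrightarrow>
      hausdorff_outer (real CARD('n) - 1) (E \<inter> sphere (0::real^'n) 1) \<le> ennreal c * emeasure cone_measure E"
    by (rule hausdorff_outer_le_cone_measure[OF n]) blast
  have "emeasure sphere_measure E \<le> ennreal c * emeasure cone_measure E" if "E \<in> sets borel_sphere" for E :: "(real^'n) set"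
    using c(2)[of E] that by (simp add: emeasure_sphere_measure[OF n] sets_borel_sphere Int_absorb2)
  with c(1) show ?thesis using that by blast
qed

lemma finite_sphere_measure:
  assumes n: "CARD('n) \<ge> 2"
  shows "finite_measure (sphere_measure :: (real^'n) measure)"
proof
  obtain c where c: "c > 0"
    "\<And>E. E \<in> sets borel_sphere \<Longrightarrow> emeasure sphere_measure (E :: (real^'n) set) \<le> ennreal c * emeasure cone_measure E"
    by (rule sphere_measure_le_cone_measure[OF n]) blast
  interpret finite_measure "cone_measure :: (real^'n) measure" by (rule finite_cone_measure)
  have "emeasure sphere_measure (unit_sphere :: (real^'n) set) \<le> ennreal c * emeasure cone_measure (unit_sphere :: (real^'n) set)"
    by (rule c(2)) (auto simp: sets_borel_sphere)
  also have "\<dots> < \<infinity>"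
  proof -
    have "emeasure cone_measure (unit_sphere :: (real^'n) set) < \<infinity>"
      using emeasure_finite[of "unit_sphere"] unfolding less_top infinity_ennreal_def .
    then show ?thesis by (simp add: ennreal_mult_less_top)
  qed
  finally show "emeasure sphere_measure (space (sphere_measure :: (real^'n) measure)) \<noteq> \<infinity>" by simp
qed

lemma orthogonal_transformation_measurable_sphere:
  assumes f: "orthogonal_transformation (f :: real^'n \<Rightarrow> real^'n)"
  shows "f \<in> measurable borel_sphere borel_sphere"
  using orthogonal_transformation_measurable[OF f] orthogonal_transformation_norm[OF f]
  by (intro measurable_restrict_space3) auto

text \<open>Hausdorff measure depends on distances alone: \<open>f\<close> and its inverse are
  isometries, and each yields one inequality.\<close>

lemma distr_sphere_measure_orthogonal:
  assumes n: "CARD('n) \<ge> 2" and f: "orthogonal_transformation (f :: real^'n \<Rightarrow> real^'n)"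
  shows "distr sphere_measure borel_sphere f = sphere_measure"
proof (rule measure_eqI)
  fix E assume "E \<in> sets (distr sphere_measure borel_sphere f)"
  then have E: "E \<in> sets borel_sphere" by simp
  have fm: "f \<in> measurable sphere_measure borel_sphere"
    using orthogonal_transformation_measurable_sphere[OF f] by (simp cong: measurable_cong_sets)
  obtain g where g: "orthogonal_transformation g" "\<And>x. f (g x) = x" "\<And>x. g (f x) = x"
    using orthogonal_transformation_bij[OF f] orthogonal_transformation_inv[OF f]
    by (metis bij_inv_eq_iff)
  have eq: "f -` E \<inter> unit_sphere = g ` E"
    using E g orthogonal_transformation_norm[OF g(1)]
    by (auto simp: sets_borel_sphere image_iff) (metis)
  have fE: "f -` E \<inter> unit_sphere \<in> sets borel_sphere"
    using measurable_sets[OF fm E] by simp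
  have iso: "\<And>x y. dist (f x) (f y) = dist x y" "\<And>x y. dist (g x) (g y) = dist x y"
    using f g(1) by (auto simp: orthogonal_transformation_isometry)
  have "f ` g ` E = E" by (auto simp: image_image g)
  then have "hausdorff_outer (real CARD('n) - 1) (g ` E) = hausdorff_outer (real CARD('n) - 1) E"
    using hausdorff_outer_isometry_le[OF iso(2), of "real CARD('n) - 1" E]
      hausdorff_outer_isometry_le[OF iso(1), of "real CARD('n) - 1" "g ` E"] by simp
  then show "emeasure (distr sphere_measure borel_sphere f) E = emeasure sphere_measure E"
    using fm E fE by (simp add: emeasure_distr emeasure_sphere_measure[OF n] eq)
qed simp

section \<open>Wulff shapes\<close>

text \<open>The Wulff shape, or Aleksandrov body, of \<open>h\<close>. Values of \<open>h\<close>
  off the sphere have no influence.\<close>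

definition wulff :: "(real^'n \<Rightarrow> real) \<Rightarrow> (real^'n) set" where
  "wulff h = {x. \<forall>v\<in>unit_sphere. x \<bullet> v \<le> h v}"

text \<open>Minkowski functional of the Wulff shape, equivalently the support function of the points
  v / h v that generate the polar body. It is convex as a supremum of linear functions, and its
  reciprocal is the radial function (\<open>radial_fun_wulff\<close>).\<close>

definition wulff_gauge :: "(real^'n \<Rightarrow> real) \<Rightarrow> real^'n \<Rightarrow> real" where
  "wulff_gauge h x = (SUP v\<in>unit_sphere. x \<bullet> v / h v)"

lemma wulff_mono: "(\<And>v. v \<in> unit_sphere \<Longrightarrow> h v \<le> k v) \<Longrightarrow> wulff h \<subseteq> wulff k"
  unfolding wulff_def by force

lemma unit_sphere_nonempty: "(unit_sphere :: (real^'n) set) \<noteq> {}"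
proof -
  have "axis undefined 1 \<in> (unit_sphere :: (real^'n) set)" by (simp add: norm_axis_1)
  then show ?thesis by blast
qed

lemma sgn_in_unit_sphere: "x \<noteq> 0 \<Longrightarrow> sgn x \<in> unit_sphere"
  by (simp add: norm_sgn)

section \<open>Support functions of bounded sets\<close>

lemma support_fun_bdd:
  assumes "bounded K"
  shows "bdd_above ((\<lambda>x. x \<bullet> v) ` K)"
proof -
  obtain R where R: "\<And>x. x \<in> K \<Longrightarrow> norm x \<le> R" using assms by (auto simp: bounded_iff)
  show ?thesis
  proof (rule bdd_aboveI2)
    fix x assume "x \<in> K"
    then show "x \<bullet> v \<le> R * norm v"
      using R[of x] norm_cauchy_schwarz[of x v] mult_right_mono[of "norm x" R "norm v"] by simp
  qed
qed

lemma support_fun_upper: "bounded K \<Longrightarrow> x \<in> K \<Longrightarrow> x \<bullet> v \<le> support_fun K v"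
  unfolding support_fun_def by (rule cSUP_upper[OF _ support_fun_bdd])

lemma support_fun_least: "K \<noteq> {} \<Longrightarrow> (\<And>x. x \<in> K \<Longrightarrow> x \<bullet> v \<le> c) \<Longrightarrow> support_fun K v \<le> c"
  unfolding support_fun_def by (rule cSUP_least)

lemma support_fun_lipschitz:
  assumes "K \<noteq> {}" and R: "\<And>x. x \<in> K \<Longrightarrow> norm x \<le> R"
  shows "\<bar>support_fun K v - support_fun K w\<bar> \<le> R * norm (v - w)"
proof -
  have bdd: "bounded K" using R by (auto simp: bounded_iff)
  have "support_fun K v \<le> support_fun K w + R * norm (v - w)" for v w
  proof (rule support_fun_least[OF assms(1)])
    fix x assume x: "x \<in> K"
    have "x \<bullet> v = x \<bullet> w + x \<bullet> (v - w)" by (simp add: inner_diff_right)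
    also have "x \<bullet> (v - w) \<le> norm x * norm (v - w)" by (rule norm_cauchy_schwarz)
    also have "\<dots> \<le> R * norm (v - w)" using R[OF x] by (intro mult_right_mono) auto
    finally show "x \<bullet> v \<le> support_fun K w + R * norm (v - w)"
      using support_fun_upper[OF bdd x, of w] by simp
  qed
  from this[of v w] this[of w v] show ?thesis by (simp add: norm_minus_commute abs_le_iff)
qed

locale positive_on_sphere =
  fixes h :: "real^'n \<Rightarrow> real"
  assumes cont: "continuous_on unit_sphere h" and pos: "v \<in> unit_sphere \<Longrightarrow> 0 < h v"
begin

lemma nonzero: "v \<in> unit_sphere \<Longrightarrow> h v \<noteq> 0"
  using pos by force

lemma continuous_ratio: "continuous_on unit_sphere (\<lambda>v. x \<bullet> v / h v)"
  by (intro continuous_intros cont ballI nonzero)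

lemma gauge_attained: "\<exists>v\<in>unit_sphere. wulff_gauge h x = x \<bullet> v / h v"
proof -
  obtain v where v: "v \<in> unit_sphere" "\<And>w. w \<in> unit_sphere \<Longrightarrow> x \<bullet> w / h w \<le> x \<bullet> v / h v"
    using continuous_attains_sup[OF compact_sphere unit_sphere_nonempty continuous_ratio] by blast
  then have "wulff_gauge h x = x \<bullet> v / h v"
    unfolding wulff_gauge_def by (intro cSup_eq_maximum) auto
  with v(1) show ?thesis by blast
qed

lemma gauge_upper:
  assumes "v \<in> unit_sphere" shows "x \<bullet> v / h v \<le> wulff_gauge h x"
proof -
  have "bdd_above ((\<lambda>v. x \<bullet> v / h v) ` unit_sphere)"
    by (intro bounded_imp_bdd_above compact_imp_bounded compact_continuous_image continuous_ratio compact_sphere)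
  then show ?thesis unfolding wulff_gauge_def using assms by (rule cSUP_upper[rotated])
qed

lemma gauge_upper': "v \<in> unit_sphere \<Longrightarrow> x \<bullet> v \<le> wulff_gauge h x * h v"
  using gauge_upper[of v x] pos[of v] by (simp add: pos_divide_le_eq)

lemma gauge_least: "(\<And>v. v \<in> unit_sphere \<Longrightarrow> x \<bullet> v \<le> c * h v) \<Longrightarrow> wulff_gauge h x \<le> c"
  using gauge_attained[of x] pos by (metis pos_divide_le_eq)

lemma gauge_scaleR: assumes "0 \<le> c" shows "wulff_gauge h (c *\<^sub>R x) = c * wulff_gauge h x"
proof (rule antisym)
  show "wulff_gauge h (c *\<^sub>R x) \<le> c * wulff_gauge h x"
    by (rule gauge_least) (use gauge_upper' assms in \<open>simp add: mult.assoc mult_left_mono\<close>)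
  obtain v where v: "v \<in> unit_sphere" "wulff_gauge h x = x \<bullet> v / h v" using gauge_attained by blast
  show "c * wulff_gauge h x \<le> wulff_gauge h (c *\<^sub>R x)"
    using gauge_upper[OF v(1), of "c *\<^sub>R x"] by (simp add: v(2))
qed

lemma gauge_convex: "convex_on UNIV (wulff_gauge h)"
proof (rule convex_onI)
  fix t :: real and x y :: "real^'n" assume t: "0 < t" "t < 1"
  show "wulff_gauge h ((1 - t) *\<^sub>R x + t *\<^sub>R y) \<le> (1 - t) * wulff_gauge h x + t * wulff_gauge h y"
  proof (rule gauge_least)
    fix v :: "real^'n" assume v: "v \<in> unit_sphere"
    have "(1 - t) * (x \<bullet> v) + t * (y \<bullet> v) \<le> (1 - t) * (wulff_gauge h x * h v) + t * (wulff_gauge h y * h v)"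
      using t by (intro add_mono mult_left_mono gauge_upper' v) auto
    then show "((1 - t) *\<^sub>R x + t *\<^sub>R y) \<bullet> v \<le> ((1 - t) * wulff_gauge h x + t * wulff_gauge h y) * h v"
      by (simp add: inner_add_left algebra_simps)
  qed
qed simp

lemma gauge_continuous: "continuous_on A (wulff_gauge h)"
  using convex_on_continuous[OF open_UNIV gauge_convex] by (rule continuous_on_subset) simp

lemma gauge_pos: assumes "x \<noteq> 0" shows "0 < wulff_gauge h x"
proof -
  have "x \<bullet> sgn x = norm x" by (simp add: sgn_div_norm norm_eq_sqrt_inner real_div_sqrt divide_inverse_commute[symmetric])
  then have "0 < x \<bullet> sgn x / h (sgn x)" using assms pos[OF sgn_in_unit_sphere[OF assms]] by simp
  also have "\<dots> \<le> wulff_gauge h x" using sgn_in_unit_sphere[OF assms] by (rule gauge_upper)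
  finally show ?thesis .
qed

lemma mem_wulff: "x \<in> wulff h \<longleftrightarrow> wulff_gauge h x \<le> 1"
proof
  assume "x \<in> wulff h" then show "wulff_gauge h x \<le> 1" by (intro gauge_least) (simp add: wulff_def)
next
  assume g: "wulff_gauge h x \<le> 1"
  show "x \<in> wulff h" unfolding wulff_def
  proof clarify
    fix v :: "real^'n" assume v: "v \<in> unit_sphere"
    have "x \<bullet> v \<le> wulff_gauge h x * h v" using v by (rule gauge_upper')
    also have "\<dots> \<le> 1 * h v" using g pos[OF v] by (intro mult_right_mono) auto
    finally show "x \<bullet> v \<le> h v" by simp
  qed
qed

lemma radial_fun_wulff: assumes "x \<noteq> 0" shows "radial_fun (wulff h) x = 1 / wulff_gauge h x"
  unfolding radial_fun_def
proof (rule cSup_eq_maximum)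
  show "1 / wulff_gauge h x \<in> {t. t *\<^sub>R x \<in> wulff h}"
    using gauge_pos[OF assms] by (simp add: mem_wulff gauge_scaleR)
  fix t assume "t \<in> {t. t *\<^sub>R x \<in> wulff h}"
  then have t: "wulff_gauge h (t *\<^sub>R x) \<le> 1" by (simp add: mem_wulff)
  show "t \<le> 1 / wulff_gauge h x"
  proof (cases "0 \<le> t")
    case True with t show ?thesis using gauge_pos[OF assms] by (simp add: gauge_scaleR field_simps)
  next
    case False
    then show ?thesis using gauge_pos[OF assms] by (meson divide_nonneg_pos less_eq_real_def not_le order_trans zero_le_one)
  qed
qed

lemma radial_pos: "x \<noteq> 0 \<Longrightarrow> 0 < radial_fun (wulff h) x"
  using gauge_pos by (simp add: radial_fun_wulff)

lemma radial_continuous: "continuous_on unit_sphere (radial_fun (wulff h))"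
proof -
  have nz: "x \<noteq> 0" if "x \<in> unit_sphere" for x :: "real^'n" using that by auto
  have "continuous_on unit_sphere (\<lambda>x. 1 / wulff_gauge h x)"
    by (intro continuous_intros gauge_continuous ballI) (metis gauge_pos less_irrefl nz)
  then show ?thesis by (rule continuous_on_eq) (simp add: radial_fun_wulff nz)
qed

lemma radial_mem: "x \<noteq> 0 \<Longrightarrow> radial_fun (wulff h) x *\<^sub>R x \<in> wulff h"
  using gauge_pos[of x] by (simp add: mem_wulff radial_fun_wulff gauge_scaleR)

lemma zero_in_wulff: "0 \<in> wulff h"
  using pos by (auto simp: wulff_def intro: less_imp_le)

lemma norm_le_of_mem_wulff:
  assumes R: "\<And>v. v \<in> unit_sphere \<Longrightarrow> h v \<le> R" and x: "x \<in> wulff h"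
  shows "norm x \<le> R"
proof (cases "x = 0")
  case False
  have "norm x = x \<bullet> sgn x" by (simp add: sgn_div_norm norm_eq_sqrt_inner real_div_sqrt divide_inverse_commute[symmetric])
  also have "\<dots> \<le> R" using x R[OF sgn_in_unit_sphere[OF False]] sgn_in_unit_sphere[OF False]
    by (force simp: wulff_def)
  finally show ?thesis .
next
  case True
  obtain v where "v \<in> (unit_sphere :: (real^'n) set)" using unit_sphere_nonempty by blast
  then show ?thesis using R[of v] pos[of v] True by simp
qed

lemma bounds: obtains m M where "0 < m" "m \<le> M" "\<And>v. v \<in> unit_sphere \<Longrightarrow> m \<le> h v \<and> h v \<le> M"
proof -
  obtain v where v: "v \<in> unit_sphere" "\<And>w. w \<in> unit_sphere \<Longrightarrow> h v \<le> h w"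
    using continuous_attains_inf[OF compact_sphere unit_sphere_nonempty cont] by blast
  obtain w where w: "w \<in> unit_sphere" "\<And>x. x \<in> unit_sphere \<Longrightarrow> h x \<le> h w"
    using continuous_attains_sup[OF compact_sphere unit_sphere_nonempty cont] by blast
  show ?thesis using that[of "h v" "h w"] v w pos by blast
qed

lemma bounded_wulff: "bounded (wulff h)"
proof -
  obtain m M where "0 < m" "m \<le> M" "\<And>v. v \<in> unit_sphere \<Longrightarrow> m \<le> h v \<and> h v \<le> M" using bounds by blast
  then have "norm x \<le> M" if "x \<in> wulff h" for x using that by (intro norm_le_of_mem_wulff) auto
  then show ?thesis by (auto simp: bounded_iff)
qed

lemma closed_wulff: "closed (wulff h)"
proof -
  have "wulff h = {x. wulff_gauge h x \<le> 1}" by (auto simp: mem_wulff)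
  then show ?thesis by (simp add: closed_Collect_le gauge_continuous)
qed

lemma compact_wulff: "compact (wulff h)"
  using bounded_wulff closed_wulff by (simp add: compact_eq_bounded_closed)

lemma convex_wulff: "convex (wulff h)"
proof -
  have "wulff h = (\<Inter>v\<in>unit_sphere. {x. v \<bullet> x \<le> h v})" by (auto simp: wulff_def inner_commute)
  then show ?thesis by (simp add: convex_INT convex_halfspace_le)
qed

lemma ball_subset_wulff: assumes "\<And>v. v \<in> unit_sphere \<Longrightarrow> m \<le> h v" shows "ball 0 m \<subseteq> wulff h"
proof
  fix x :: "real^'n" assume "x \<in> ball 0 m"
  then show "x \<in> wulff h"
    unfolding wulff_def using assms norm_cauchy_schwarz[of x] by (fastforce intro: order_trans)
qed

lemma wulff_convex_body: "wulff h \<in> convex_bodies_o"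
proof -
  obtain m M where m: "0 < m" "\<And>v. v \<in> unit_sphere \<Longrightarrow> m \<le> h v \<and> h v \<le> M" using bounds by metis
  have "0 \<in> interior (wulff h)"
    using ball_subset_wulff[of m] m by (intro interiorI[of "ball 0 m"]) auto
  then show ?thesis
    unfolding convex_bodies_o_def convex_body_def using compact_wulff convex_wulff by auto
qed

lemma support_le: "v \<in> unit_sphere \<Longrightarrow> support_fun (wulff h) v \<le> h v"
  using zero_in_wulff by (intro support_fun_least) (blast, simp add: wulff_def)

lemma support_upper: "x \<in> wulff h \<Longrightarrow> x \<bullet> v \<le> support_fun (wulff h) v"
  using bounded_wulff by (rule support_fun_upper)

lemma support_ge: assumes "\<And>v. v \<in> unit_sphere \<Longrightarrow> m \<le> h v" "v \<in> unit_sphere" shows "m \<le> support_fun (wulff h) v"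
proof -
  have "m *\<^sub>R v \<in> wulff h" if "0 < m"
    unfolding wulff_def
  proof clarify
    fix w :: "real^'n" assume w: "w \<in> unit_sphere"
    have "v \<bullet> w \<le> 1" using norm_cauchy_schwarz[of v w] assms(2) w by simp
    then have "m * (v \<bullet> w) \<le> m * 1" using that by (intro mult_left_mono) auto
    then show "m *\<^sub>R v \<bullet> w \<le> h w" using assms(1)[OF w] by simp
  qed
  then have "m \<le> support_fun (wulff h) v" if "0 < m"
    using support_upper[of "m *\<^sub>R v" v] that assms(2) by (simp add: dot_square_norm)
  moreover have "0 \<le> support_fun (wulff h) v" using support_upper[OF zero_in_wulff, of v] by simp
  ultimately show ?thesis by linarith
qed

text \<open>Lowering \<open>h\<close> to the support function moves every half-space in until it
  touches the body, which cuts off nothing. This is the way back from arbitrary positive functions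
  to support functions.\<close>

lemma wulff_support: "wulff (support_fun (wulff h)) = wulff h"
proof
  show "wulff (support_fun (wulff h)) \<subseteq> wulff h"
    by (rule wulff_mono) (rule support_le)
  show "wulff h \<subseteq> wulff (support_fun (wulff h))"
    using support_upper by (auto simp: wulff_def[of "support_fun (wulff h)"])
qed

lemma positive_on_sphere_support: "positive_on_sphere (support_fun (wulff h))"
proof
  obtain m M where m: "0 < m" "\<And>v. v \<in> unit_sphere \<Longrightarrow> m \<le> h v \<and> h v \<le> M" using bounds by metis
  show "0 < support_fun (wulff h) v" if "v \<in> unit_sphere" for v
    using support_ge[of m v] m that by force
  have "M-lipschitz_on unit_sphere (support_fun (wulff h))"
  proof (rule lipschitz_onI)
    show "0 \<le> M" using m unit_sphere_nonempty by fastforce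
    fix v w :: "real^'n"
    show "dist (support_fun (wulff h) v) (support_fun (wulff h) w) \<le> M * dist v w"
      unfolding dist_norm real_norm_def using zero_in_wulff norm_le_of_mem_wulff[of M] m
      by (intro support_fun_lipschitz) auto
  qed
  then show "continuous_on unit_sphere (support_fun (wulff h))" by (rule lipschitz_on_continuous_on)
qed

end

text \<open>Many functions generate the same Wulff shape; the assumption selects its support function.\<close>

locale support_on_sphere = positive_on_sphere h for h :: "real^'n \<Rightarrow> real" +
  assumes supp: "v \<in> unit_sphere \<Longrightarrow> support_fun (wulff h) v = h v"
begin

text \<open>The outer normals at the boundary point in direction \<open>u\<close> are the maximisers
  in the definition of \<open>wulff_gauge h u\<close>; multiplying by the gauge removes the radial
  function from the condition.\<close>

lemma reverse_radial_Gauss_image_wulff: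
  assumes "\<eta> \<subseteq> unit_sphere"
  shows "reverse_radial_Gauss_image (wulff h) \<eta> = {u \<in> unit_sphere. \<exists>v\<in>\<eta>. u \<bullet> v = wulff_gauge h u * h v}"
proof -
  have "(radial_fun (wulff h) u *\<^sub>R u) \<bullet> v = support_fun (wulff h) v \<longleftrightarrow> u \<bullet> v = wulff_gauge h u * h v"
    if "u \<in> unit_sphere" "v \<in> \<eta>" for u v
  proof -
    have "u \<noteq> 0" using that by auto
    then show ?thesis using gauge_pos[of u] supp[of v] that assms by (auto simp: radial_fun_wulff field_simps)
  qed
  then show ?thesis unfolding reverse_radial_Gauss_image_def by blast
qed

end

section \<open>Almost everywhere uniqueness of normals\<close>

text \<open>By translation invariance the measure of a set is the average of the lengths of its slices.\<close>

lemma null_set_of_countable_lines: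
  fixes A :: "'a::euclidean_space set"
  assumes A[measurable]: "A \<in> sets borel" and lines: "\<And>x. countable {s::real. x + s *\<^sub>R e \<in> A}"
  shows "emeasure lborel A = 0"
proof -
  have tr: "(\<integral>\<^sup>+x. indicator A (x + s *\<^sub>R e) \<partial>lborel) = emeasure lborel A" for s
  proof -
    have "(\<integral>\<^sup>+x. indicator A (x + s *\<^sub>R e) \<partial>lborel) = (\<integral>\<^sup>+x. indicator A x \<partial>distr lborel borel ((+) (s *\<^sub>R e)))"
      by (subst nn_integral_distr) (auto simp: add.commute)
    then show ?thesis by (simp add: lborel_distr_plus)
  qed
  have "emeasure lborel A = (\<integral>\<^sup>+s. emeasure lborel A * indicator {0..1::real} s \<partial>lborel)"
    by (subst nn_integral_cmult_indicator) auto
  also have "\<dots> = (\<integral>\<^sup>+s. \<integral>\<^sup>+x. indicator A (x + s *\<^sub>R e) * indicator {0..1::real} s \<partial>lborel \<partial>lborel)"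
    by (intro nn_integral_cong) (simp add: nn_integral_multc tr)
  also have "\<dots> = (\<integral>\<^sup>+x. \<integral>\<^sup>+s. indicator A (x + s *\<^sub>R e) * indicator {0..1::real} s \<partial>lborel \<partial>lborel)"
    by (rule lborel_pair.Fubini') measurable
  also have "\<dots> = (\<integral>\<^sup>+(x::'a). 0 \<partial>lborel)"
  proof (rule nn_integral_cong)
    fix x :: 'a
    have "AE s in lborel. \<not> x + s *\<^sub>R e \<in> A"
      using countable_imp_null_set_lborel[OF lines[of x]] by (auto intro: AE_I')
    then have "AE s in lborel. indicator A (x + s *\<^sub>R e) * indicator {0..1::real} s = (0::ennreal)"
      by eventually_elim simp
    then show "(\<integral>\<^sup>+s. indicator A (x + s *\<^sub>R e) * indicator {0..1::real} s \<partial>lborel) = (0::ennreal)"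
      by (subst nn_integral_0_iff_AE) auto
  qed
  finally show ?thesis by simp
qed

context positive_on_sphere
begin

text \<open>Points where both \<open>a\<close> and \<open>b\<close> are subgradient slopes of the
  gauge along the axis \<open>i\<close>; for \<open>a < b\<close> the gauge has a corner there.
  Phrased by inequalities between continuous functions, the set is visibly closed.\<close>

definition kink :: "'n \<Rightarrow> real \<Rightarrow> real \<Rightarrow> (real^'n) set" where
  "kink i a b = {x. \<forall>s. wulff_gauge h x + a * s \<le> wulff_gauge h (x + s *\<^sub>R axis i 1) \<and>
     wulff_gauge h x + b * s \<le> wulff_gauge h (x + s *\<^sub>R axis i 1)}"

text \<open>Rational slopes keep the union countable; between two distinct real slopes there are
  always two rational ones.\<close>

definition singular_directions :: "(real^'n) set" where
  "singular_directions = (\<Union>i. \<Union>a\<in>\<rat>. \<Union>b\<in>\<rat> \<inter> {a<..}. kink i a b \<inter> unit_sphere)"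

lemma closed_kink: "closed (kink i a b)"
  unfolding kink_def
  by (intro closed_Collect_all closed_Collect_conj closed_Collect_le continuous_intros
      continuous_on_compose2[OF gauge_continuous[of UNIV]]) auto

text \<open>Subgradient slopes of a convex function increase along a line: slope \<open>b\<close> at
  one point and slope \<open>a < b\<close> at a later one contradict each other. So each line in the
  axis direction meets the set at most once.\<close>

lemma emeasure_kink: assumes "a < b" shows "emeasure lborel (kink i a b) = 0"
proof (rule null_set_of_countable_lines)
  show "kink i a b \<in> sets borel" using closed_kink by (rule borel_closed)
  fix x
  let ?L = "{s. x + s *\<^sub>R axis i 1 \<in> kink i a b}"
  have "\<not> s < t" if st: "s \<in> ?L" "t \<in> ?L" for s t
  proof
    assume "s < t"
    define y where "y = x + s *\<^sub>R axis i 1" define z where "z = x + t *\<^sub>R axis i 1"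
    have yz: "z = y + (t - s) *\<^sub>R axis i 1" "y = z + (s - t) *\<^sub>R axis i 1" by (auto simp: y_def z_def algebra_simps)
    have "wulff_gauge h y + b * (t - s) \<le> wulff_gauge h z" using st(1) yz(1) by (auto simp: kink_def y_def)
    moreover have "wulff_gauge h z + a * (s - t) \<le> wulff_gauge h y" using st(2) yz(2) by (auto simp: kink_def z_def)
    ultimately have "(b - a) * (t - s) \<le> 0" by (simp add: algebra_simps)
    moreover have "(b - a) * (t - s) > 0" using \<open>s < t\<close> assms by simp
    ultimately show False by simp
  qed
  then have "\<forall>s\<in>?L. \<forall>t\<in>?L. s = t" by (meson linorder_neqE_linordered_idom)
  then have "?L = {} \<or> (\<exists>s. ?L = {s})" by blast
  then show "countable ?L" by auto
qed

text \<open>By homogeneity of the gauge the kinks form a cone, so a Lebesgue null set of points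
  becomes a null set of directions.\<close>

lemma kink_scaleR: assumes x: "x \<in> kink i a b" and c: "0 < c" shows "c *\<^sub>R x \<in> kink i a b"
proof -
  have "wulff_gauge h (c *\<^sub>R x) + d * s \<le> wulff_gauge h (c *\<^sub>R x + s *\<^sub>R axis i 1)"
    if "\<And>s. wulff_gauge h x + d * s \<le> wulff_gauge h (x + s *\<^sub>R axis i 1)" for d s
  proof -
    have "c *\<^sub>R x + s *\<^sub>R axis i 1 = c *\<^sub>R (x + (s / c) *\<^sub>R axis i 1)" using c by (simp add: algebra_simps)
    then have "wulff_gauge h (c *\<^sub>R x + s *\<^sub>R axis i 1) = c * wulff_gauge h (x + (s / c) *\<^sub>R axis i 1)"
      using c by (metis gauge_scaleR less_imp_le)
    also have "\<dots> \<ge> c * (wulff_gauge h x + d * (s / c))" using that[of "s / c"] c by (intro mult_left_mono) auto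
    finally show ?thesis using c by (simp add: gauge_scaleR distrib_left)
  qed
  then show ?thesis using x unfolding kink_def by blast
qed

lemma singular_directions_null:
  assumes n: "CARD('n) \<ge> 2"
  shows "singular_directions \<in> null_sets sphere_measure"
proof -
  obtain c where c: "c > 0"
    "\<And>E. E \<in> sets borel_sphere \<Longrightarrow> emeasure sphere_measure (E :: (real^'n) set) \<le> ennreal c * emeasure cone_measure E"
    by (rule sphere_measure_le_cone_measure[OF n]) blast
  have null: "kink i a b \<inter> unit_sphere \<in> null_sets sphere_measure" if "a < b" for i a b
  proof -
    have meas: "kink i a b \<inter> unit_sphere \<in> sets borel_sphere"
      using closed_kink[of i a b] by (auto simp: sets_borel_sphere borel_closed)
    have "emeasure cone_measure (kink i a b \<inter> unit_sphere) = emeasure lborel {x \<in> cball 0 1. sgn x \<in> kink i a b \<inter> unit_sphere}"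
      using meas by (intro emeasure_cone_measure) (simp add: sets_borel_sphere)
    also have "\<dots> \<le> emeasure lborel (kink i a b)"
    proof (rule emeasure_mono)
      show "{x \<in> cball 0 1. sgn x \<in> kink i a b \<inter> unit_sphere} \<subseteq> kink i a b"
      proof clarify
        fix x assume x: "sgn x \<in> kink i a b" "sgn x \<in> unit_sphere"
        then have "x \<noteq> 0" by auto
        then have "norm x *\<^sub>R sgn x \<in> kink i a b" using x(1) by (intro kink_scaleR) auto
        then show "x \<in> kink i a b" using \<open>x \<noteq> 0\<close> by (simp add: sgn_div_norm)
      qed
    qed (use closed_kink in \<open>auto intro: borel_closed\<close>)
    finally have "emeasure cone_measure (kink i a b \<inter> unit_sphere) = 0" by (simp add: emeasure_kink[OF that])
    then show ?thesis using c(2)[OF meas] meas by (intro null_setsI) auto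
  qed
  show ?thesis unfolding singular_directions_def
    by (intro null_sets_UN' null) (auto intro: countable_rat countable_subset[OF Int_lower1])
qed

text \<open>Normals \<open>v\<close> and \<open>w\<close> at the same boundary point give
  subgradients v / h v and w / h w of the gauge at \<open>u\<close>. These differ because
  \<open>v\<close> and \<open>w\<close> are distinct unit vectors, hence some coordinate shows two
  different slopes.\<close>

lemma two_normals_singular:
  assumes u: "u \<in> unit_sphere" and v: "v \<in> unit_sphere" "u \<bullet> v = wulff_gauge h u * h v"
    and w: "w \<in> unit_sphere" "u \<bullet> w = wulff_gauge h u * h w" and "v \<noteq> w"
  shows "u \<in> singular_directions"
proof -
  define y where "y = v /\<^sub>R h v" define z where "z = w /\<^sub>R h w"
  have hv: "0 < h v" "0 < h w" using pos v(1) w(1) by auto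
  have "y \<noteq> z"
  proof
    assume "y = z"
    then have "norm y = norm z" by simp
    then have "h v = h w" using v(1) w(1) hv by (simp add: y_def z_def)
    then show False using \<open>y = z\<close> \<open>v \<noteq> w\<close> hv by (simp add: y_def z_def)
  qed
  have sub: "wulff_gauge h u + (v' $ i / h v') * s \<le> wulff_gauge h (u + s *\<^sub>R axis i 1)"
    if "v' \<in> unit_sphere" "u \<bullet> v' = wulff_gauge h u * h v'" for v' i s
  proof -
    have "(u + s *\<^sub>R axis i 1) \<bullet> v' / h v' \<le> wulff_gauge h (u + s *\<^sub>R axis i 1)" using that(1) by (rule gauge_upper)
    then show ?thesis using that(2) pos[OF that(1)]
      by (simp add: inner_add_left inner_axis' add_divide_distrib mult.commute)
  qed
  have suby: "wulff_gauge h u + y $ i * s \<le> wulff_gauge h (u + s *\<^sub>R axis i 1)"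
    and subz: "wulff_gauge h u + z $ i * s \<le> wulff_gauge h (u + s *\<^sub>R axis i 1)" for i s
    using sub[OF v, of i s] sub[OF w, of i s] by (simp_all add: y_def z_def divide_inverse mult.commute)
  obtain i where "y $ i \<noteq> z $ i" using \<open>y \<noteq> z\<close> by (auto simp: vec_eq_iff)
  then have "min (y $ i) (z $ i) < max (y $ i) (z $ i)" by auto
  then obtain a where a: "a \<in> \<rat>" "min (y $ i) (z $ i) < a" "a < max (y $ i) (z $ i)" using Rats_dense_in_real by blast
  then obtain b where b: "b \<in> \<rat>" "a < b" "b < max (y $ i) (z $ i)" using Rats_dense_in_real by blast
  have between: "wulff_gauge h u + d * s \<le> wulff_gauge h (u + s *\<^sub>R axis i 1)"
    if "min (y $ i) (z $ i) < d" "d < max (y $ i) (z $ i)" for d s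
  proof -
    have "d * s \<le> max (y $ i) (z $ i) * s \<or> d * s \<le> min (y $ i) (z $ i) * s"
      using that by (cases "0 \<le> s") (auto intro: mult_right_mono mult_right_mono_neg)
    then show ?thesis using suby[of i s] subz[of i s] by (auto simp: min_def max_def split: if_splits)
  qed
  have "u \<in> kink i a b" unfolding kink_def using between a b by (auto intro: less_trans)
  then show ?thesis unfolding singular_directions_def using a b u by blast
qed

end

context support_on_sphere
begin

text \<open>The arbitrary constant value on the null set \<open>singular_directions\<close> makes
  the map Borel measurable without a selection theorem; at the remaining points of the sphere the
  choice is forced (\<open>normal_unique\<close>).\<close>

definition normal :: "real^'n \<Rightarrow> real^'n" where
  "normal u = (if u \<in> singular_directions then axis undefined 1
     else (SOME v. v \<in> unit_sphere \<and> u \<bullet> v = wulff_gauge h u * h v))"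

lemma normal_in_sphere: "normal u \<in> unit_sphere"
  and normal_eq: "u \<notin> singular_directions \<Longrightarrow> u \<bullet> normal u = wulff_gauge h u * h (normal u)"
proof -
  obtain v where "v \<in> unit_sphere" "wulff_gauge h u = u \<bullet> v / h v" using gauge_attained by blast
  then have "v \<in> unit_sphere \<and> u \<bullet> v = wulff_gauge h u * h v" using nonzero by auto
  then have *: "(SOME v. v \<in> unit_sphere \<and> u \<bullet> v = wulff_gauge h u * h v) \<in> unit_sphere \<and>
      u \<bullet> (SOME v. v \<in> unit_sphere \<and> u \<bullet> v = wulff_gauge h u * h v) =
      wulff_gauge h u * h (SOME v. v \<in> unit_sphere \<and> u \<bullet> v = wulff_gauge h u * h v)"
    by (rule someI)
  then show "normal u \<in> unit_sphere" by (auto simp: normal_def norm_axis_1)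
  show "u \<notin> singular_directions \<Longrightarrow> u \<bullet> normal u = wulff_gauge h u * h (normal u)"
    using * by (simp add: normal_def)
qed

lemma normal_unique:
  assumes "u \<in> unit_sphere" "u \<notin> singular_directions" "v \<in> unit_sphere" "u \<bullet> v = wulff_gauge h u * h v"
  shows "v = normal u"
  using two_normals_singular[OF assms(1,3,4) normal_in_sphere normal_eq[OF assms(2)]] assms(2) by blast

text \<open>Projection of a compact set of pairs of a direction and a normal belonging to
  it.\<close>

lemma closed_reverse_image:
  assumes F: "closed F" "F \<subseteq> unit_sphere"
  shows "closed {u \<in> unit_sphere. \<exists>v\<in>F. u \<bullet> v = wulff_gauge h u * h v}"
proof -
  let ?X = "unit_sphere \<times> F"
  have cF: "compact F" using compact_Int_closed[OF compact_sphere[of 0 1] F(1)] F(2) by (simp add: Int_absorb1)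
  have "continuous_on ?X (\<lambda>z. fst z \<bullet> snd z - wulff_gauge h (fst z) * h (snd z))"
    using F(2) by (intro continuous_intros continuous_on_compose2[OF gauge_continuous[of UNIV]]
        continuous_on_compose2[OF cont]) auto
  then have "closed {z \<in> ?X. fst z \<bullet> snd z - wulff_gauge h (fst z) * h (snd z) = 0}"
    using F by (intro continuous_closed_preimage_constant closed_Times closed_sphere) auto
  then have "compact (?X \<inter> {z \<in> ?X. fst z \<bullet> snd z - wulff_gauge h (fst z) * h (snd z) = 0})"
    using cF by (intro compact_Int_closed compact_Times compact_sphere)
  then have "compact (fst ` (?X \<inter> {z \<in> ?X. fst z \<bullet> snd z - wulff_gauge h (fst z) * h (snd z) = 0}))"
    by (intro compact_continuous_image continuous_on_fst continuous_on_id)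
  moreover have "fst ` (?X \<inter> {z \<in> ?X. fst z \<bullet> snd z - wulff_gauge h (fst z) * h (snd z) = 0}) =
      {u \<in> unit_sphere. \<exists>v\<in>F. u \<bullet> v = wulff_gauge h u * h v}"
    by (force simp: image_iff)
  ultimately show ?thesis by (simp only: compact_imp_closed)
qed

lemma singular_directions_sets [measurable]: "CARD('n) \<ge> 2 \<Longrightarrow> singular_directions \<in> sets borel_sphere"
  using singular_directions_null by force

lemma normal_measurable:
  assumes n: "CARD('n) \<ge> 2" shows "normal \<in> measurable borel_sphere borel_sphere"
proof (rule measurable_sigma_sets[OF sets_borel_sphere_eq_sigma_closed])
  show "{F :: (real^'n) set. closed F \<and> F \<subseteq> unit_sphere} \<subseteq> Pow unit_sphere" by auto
  show "normal \<in> space borel_sphere \<rightarrow> unit_sphere" using normal_in_sphere by auto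
  fix F :: "(real^'n) set" assume "F \<in> {F. closed F \<and> F \<subseteq> unit_sphere}"
  then have F: "closed F" "F \<subseteq> unit_sphere" by auto
  let ?R = "{u \<in> unit_sphere. \<exists>v\<in>F. u \<bullet> v = wulff_gauge h u * h v}"
  \<comment> \<open>Contribution of the default value of \<open>normal\<close>.\<close>
  let ?Z = "if axis undefined 1 \<in> F then singular_directions else {}"
  have "normal -` F \<inter> space borel_sphere = (?R - singular_directions) \<union> ?Z"
  proof (intro equalityI subsetI)
    fix u assume "u \<in> normal -` F \<inter> space borel_sphere"
    then have u: "normal u \<in> F" "u \<in> unit_sphere" by (auto simp: space_borel_sphere)
    show "u \<in> (?R - singular_directions) \<union> ?Z"
    proof (cases "u \<in> singular_directions")
      case True then show ?thesis using u by (simp add: normal_def)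
    next
      case False then show ?thesis using u normal_eq by blast
    qed
  next
    fix u assume u: "u \<in> (?R - singular_directions) \<union> ?Z"
    show "u \<in> normal -` F \<inter> space borel_sphere"
    proof (cases "u \<in> singular_directions")
      case True then show ?thesis using u by (auto simp: space_borel_sphere normal_def singular_directions_def split: if_splits)
    next
      case False
      then have "u \<in> ?R" using u by (auto split: if_splits)
      then show ?thesis using False normal_unique[of u] F(2) by (auto simp: space_borel_sphere)
    qed
  qed
  moreover have "?R \<in> sets borel_sphere"
    using closed_reverse_image[OF F] by (auto simp: sets_borel_sphere intro: borel_closed)
  ultimately show "normal -` F \<inter> space borel_sphere \<in> sets borel_sphere"
    using singular_directions_sets[OF n] by auto
qed

lemma radial_measurable [measurable]: "radial_fun (wulff h) \<in> borel_measurable borel_sphere"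
  using radial_continuous by (rule borel_measurable_continuous_on_restrict)

text \<open>The reverse radial Gauss image of a Borel set and its preimage under
  \<open>normal\<close> differ only within the null set of singular directions. Hence the integral
  over the completion is one over a Borel set, and the dual curvature measure is an image measure,
  in particular countably additive.\<close>

lemma dual_curvature_measure_wulff:
  fixes Q :: "(real^'n) set"
  assumes n: "CARD('n) \<ge> 2" and Q: "radial_fun Q \<in> borel_measurable borel_sphere"
  shows "dual_curvature_measure q (wulff h) Q = scale_measure (ennreal (1 / real CARD('n)))
    (distr (density sphere_measure (\<lambda>u. ennreal (radial_fun (wulff h) u powr q * radial_fun Q u powr (real CARD('n) - q))))
      borel_sphere normal)" (is "_ = ?N")
proof -
  let ?g = "\<lambda>u. ennreal (radial_fun (wulff h) u powr q * radial_fun Q u powr (real CARD('n) - q))"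
  let ?R = "reverse_radial_Gauss_image (wulff h)"
  have nm: "normal \<in> measurable (density sphere_measure ?g) borel_sphere"
    using normal_measurable[OF n] by (simp cong: measurable_cong_sets)
  have g: "?g \<in> borel_measurable sphere_measure"
    using Q by (auto cong: measurable_cong_sets)
  have eq: "ennreal (1 / real CARD('n)) * (\<integral>\<^sup>+u\<in>?R \<eta>. ?g u \<partial>completion sphere_measure) = emeasure ?N \<eta>"
    if \<eta>: "\<eta> \<in> sets borel_sphere" for \<eta>
  proof -
    have \<eta>S: "\<eta> \<subseteq> unit_sphere" using \<eta> by (simp add: sets_borel_sphere)
    have pre: "normal -` \<eta> \<inter> unit_sphere \<in> sets sphere_measure"
      using measurable_sets[OF normal_measurable[OF n] \<eta>] by (simp add: space_borel_sphere)
    have "AE u in sphere_measure. u \<notin> singular_directions" using singular_directions_null[OF n] by (rule AE_not_in)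
    then have "AE u in sphere_measure. ?g u * indicator (?R \<eta>) u = ?g u * indicator (normal -` \<eta> \<inter> unit_sphere) u"
    proof (rule AE_mp, intro AE_I2 impI)
      fix u assume u: "u \<in> space sphere_measure" "u \<notin> singular_directions"
      then have "u \<in> ?R \<eta> \<longleftrightarrow> u \<in> normal -` \<eta> \<inter> unit_sphere"
        unfolding reverse_radial_Gauss_image_wulff[OF \<eta>S] using normal_unique[of u] normal_eq[of u] \<eta>S by auto
      then show "?g u * indicator (?R \<eta>) u = ?g u * indicator (normal -` \<eta> \<inter> unit_sphere) u"
        by (simp add: indicator_def)
    qed
    then have "(\<integral>\<^sup>+u\<in>?R \<eta>. ?g u \<partial>completion sphere_measure) =
        (\<integral>\<^sup>+u\<in>normal -` \<eta> \<inter> unit_sphere. ?g u \<partial>completion sphere_measure)"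
      by (intro nn_integral_cong_AE AE_completion)
    also have "\<dots> = (\<integral>\<^sup>+u\<in>normal -` \<eta> \<inter> unit_sphere. ?g u \<partial>sphere_measure)"
      by (simp add: nn_integral_completion)
    also have "\<dots> = emeasure (density sphere_measure ?g) (normal -` \<eta> \<inter> unit_sphere)"
      by (rule emeasure_density[symmetric, OF g pre])
    also have "\<dots> = emeasure (distr (density sphere_measure ?g) borel_sphere normal) \<eta>"
      by (subst emeasure_distr[OF nm \<eta>]) simp
    finally show ?thesis by (simp add: emeasure_scale_measure)
  qed
  have "?N = measure_of (space ?N) (sets ?N) (emeasure ?N)" by (rule measure_of_of_measure[symmetric])
  also have "\<dots> = measure_of unit_sphere (sets borel_sphere) (emeasure ?N)"
    by (simp add: space_scale_measure space_borel_sphere)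
  also have "\<dots> = dual_curvature_measure q (wulff h) Q"
    unfolding dual_curvature_measure_def
  proof (rule measure_of_eq[symmetric])
    show "sets borel_sphere \<subseteq> Pow unit_sphere" by (auto simp: sets_borel_sphere)
    fix a :: "(real^'n) set" assume "a \<in> sigma_sets unit_sphere (sets borel_sphere)"
    then have "a \<in> sets borel_sphere"
      using sets.sigma_sets_eq[of "borel_sphere :: (real^'n) measure"] by (simp only: space_borel_sphere)
    then show "ennreal (1 / real CARD('n)) * (\<integral>\<^sup>+u\<in>?R a. ?g u \<partial>completion sphere_measure) = emeasure ?N a" by (rule eq)
  qed
  finally show ?thesis by simp
qed

end

section \<open>First variation\<close>

text \<open>Dominated convergence for difference quotients along sequences. Both the derivative and
  the Lipschitz bound refer to t = 0 alone, since the radial functions of perturbed Wulff shapes are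
  differentiated only there, and only almost everywhere.\<close>

lemma has_derivative_under_integral:
  fixes F :: "real \<Rightarrow> 'a \<Rightarrow> real"
  assumes int: "\<And>t. integrable M (F t)" and D[measurable]: "D \<in> borel_measurable M"
    and der: "AE x in M. ((\<lambda>t. F t x) has_real_derivative D x) (at 0)"
    and lip: "AE x in M. \<forall>t. \<bar>t\<bar> \<le> 1 \<longrightarrow> \<bar>F t x - F 0 x\<bar> \<le> C x * \<bar>t\<bar>" and C: "integrable M C"
  shows "((\<lambda>t. \<integral>x. F t x \<partial>M) has_real_derivative (\<integral>x. D x \<partial>M)) (at 0)"
proof -
  have "(\<lambda>i. ((\<integral>x. F (X i) x \<partial>M) - (\<integral>x. F 0 x \<partial>M)) / X i) \<longlonglongrightarrow> (\<integral>x. D x \<partial>M)"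
    if X: "\<And>i. X i \<noteq> 0" "X \<longlonglongrightarrow> 0" for X :: "nat \<Rightarrow> real"
  proof -
    obtain N where N: "\<And>i. i \<ge> N \<Longrightarrow> \<bar>X i\<bar> \<le> 1"
      using LIMSEQ_D[OF X(2), of 1] by (auto intro: less_imp_le)
    define Y where "Y i = X (i + N)" for i
    have Y: "Y i \<noteq> 0" "\<bar>Y i\<bar> \<le> 1" for i using X(1) N by (auto simp: Y_def)
    have Ylim: "Y \<longlonglongrightarrow> 0" unfolding Y_def using X(2) by (rule LIMSEQ_ignore_initial_segment)
    have [measurable]: "F t \<in> borel_measurable M" for t using int[of t] by simp
    have "(\<lambda>i. \<integral>x. (F (Y i) x - F 0 x) / Y i \<partial>M) \<longlonglongrightarrow> (\<integral>x. D x \<partial>M)"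
    proof (rule integral_dominated_convergence[where w = C])
      show "AE x in M. (\<lambda>i. (F (Y i) x - F 0 x) / Y i) \<longlonglongrightarrow> D x"
        using der
      proof eventually_elim
        case (elim x)
        then have "((\<lambda>t. (F t x - F 0 x) / (t - 0)) \<longlongrightarrow> D x) (at 0)"
          by (simp add: has_field_derivative_iff)
        then have "((\<lambda>t. (F t x - F 0 x) / (t - 0)) \<circ> Y) \<longlonglongrightarrow> D x"
          using Y Ylim by (subst (asm) tendsto_at_iff_sequentially) auto
        then show ?case by (simp add: comp_def)
      qed
      show "AE x in M. norm ((F (Y i) x - F 0 x) / Y i) \<le> C x" for i
        using lip by eventually_elim (use Y[of i] in \<open>auto simp: pos_divide_le_eq\<close>)
    qed (use C in auto)
    then have "(\<lambda>i. ((\<integral>x. F (Y i) x \<partial>M) - (\<integral>x. F 0 x \<partial>M)) / Y i) \<longlonglongrightarrow> (\<integral>x. D x \<partial>M)"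
      by (simp add: int)
    then show ?thesis unfolding Y_def by (rule LIMSEQ_offset)
  qed
  then have "((\<lambda>t. ((\<integral>x. F t x \<partial>M) - (\<integral>x. F 0 x \<partial>M)) / (t - 0)) \<longlongrightarrow> (\<integral>x. D x \<partial>M)) (at 0)"
    by (subst tendsto_at_iff_sequentially) (auto simp: comp_def)
  then show ?thesis by (simp add: has_field_derivative_iff)
qed

lemma abs_exp_minus_one_le: "\<bar>exp x - 1\<bar> \<le> \<bar>x\<bar> * exp \<bar>x\<bar>" for x :: real
proof (cases "0 \<le> x")
  case True
  have "1 - x \<le> exp (- x)" using exp_ge_add_one_self[of "- x"] by simp
  then have "(1 - x) * exp x \<le> 1" using mult_right_mono[of "1 - x" "exp (- x)" "exp x"] by (simp add: exp_minus)
  then show ?thesis using True by (simp add: algebra_simps)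
next
  case False
  have "1 - exp x \<le> - x" using exp_ge_add_one_self[of x] by linarith
  also have "\<dots> \<le> - x * exp (- x)" using False by simp
  finally show ?thesis using False by simp
qed

lemma abs_exp_mult_minus_one_le:
  fixes t x c :: real
  assumes "\<bar>t\<bar> \<le> 1" "\<bar>x\<bar> \<le> c" shows "\<bar>exp (t * x) - 1\<bar> \<le> c * exp c * \<bar>t\<bar>"
proof -
  have "\<bar>t * x\<bar> \<le> \<bar>t\<bar> * c" using assms by (simp add: abs_mult mult_left_mono)
  moreover have "\<bar>t\<bar> * c \<le> c" using assms by (intro mult_left_le_one_le) auto
  ultimately have "\<bar>t * x\<bar> * exp \<bar>t * x\<bar> \<le> (\<bar>t\<bar> * c) * exp c" using assms by (intro mult_mono) auto
  then show ?thesis using abs_exp_minus_one_le[of "t * x"] by (simp add: mult_ac)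
qed

context positive_on_sphere
begin

text \<open>A logarithmic variation: positive for every \<open>t\<close> of either sign, with
  \<open>\<phi>\<close> as the derivative of the logarithm.\<close>

definition perturb :: "(real^'n \<Rightarrow> real) \<Rightarrow> real \<Rightarrow> real^'n \<Rightarrow> real" where
  "perturb \<phi> t v = h v * exp (t * \<phi> v)"

lemma positive_perturb: "continuous_on unit_sphere \<phi> \<Longrightarrow> positive_on_sphere (perturb \<phi> t)"
  by unfold_locales (auto simp: perturb_def intro!: continuous_intros cont pos mult_pos_pos)

lemma perturb_ratio: "x \<bullet> v / perturb \<phi> t v = x \<bullet> v / h v * exp (- (t * \<phi> v))"
  by (simp add: perturb_def exp_minus divide_inverse)

text \<open>The perturbed gauge is a maximum over \<open>v\<close>. A normal of the unperturbed body
  is a competitor and gives the lower bound; a maximiser of the perturbed problem gives the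
  representation.\<close>

lemma gauge_perturb_bounds:
  assumes \<phi>: "continuous_on unit_sphere \<phi>" and u: "u \<in> unit_sphere"
  shows "v \<in> unit_sphere \<Longrightarrow> u \<bullet> v = wulff_gauge h u * h v \<Longrightarrow> wulff_gauge h u * exp (- (t * \<phi> v)) \<le> wulff_gauge (perturb \<phi> t) u"
    and "\<exists>v\<in>unit_sphere. wulff_gauge (perturb \<phi> t) u = u \<bullet> v / h v * exp (- (t * \<phi> v))"
proof -
  interpret p: positive_on_sphere "perturb \<phi> t" using \<phi> by (rule positive_perturb)
  show "wulff_gauge h u * exp (- (t * \<phi> v)) \<le> wulff_gauge (perturb \<phi> t) u"
    if "v \<in> unit_sphere" "u \<bullet> v = wulff_gauge h u * h v" for v
    using p.gauge_upper[OF that(1), of u] nonzero[OF that(1)] that(2) unfolding perturb_ratio by simp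
  show "\<exists>v\<in>unit_sphere. wulff_gauge (perturb \<phi> t) u = u \<bullet> v / h v * exp (- (t * \<phi> v))"
    using p.gauge_attained[of u] by (simp add: perturb_ratio)
qed

lemma radial_perturb_ratio:
  assumes \<phi>: "continuous_on unit_sphere \<phi>" and u: "u \<in> unit_sphere"
  shows "\<exists>v\<in>unit_sphere. radial_fun (wulff h) u * exp (t * \<phi> v) \<le> radial_fun (wulff (perturb \<phi> t)) u"
    and "v \<in> unit_sphere \<Longrightarrow> u \<bullet> v = wulff_gauge h u * h v \<Longrightarrow>
      radial_fun (wulff (perturb \<phi> t)) u \<le> radial_fun (wulff h) u * exp (t * \<phi> v)"
proof -
  interpret p: positive_on_sphere "perturb \<phi> t" using \<phi> by (rule positive_perturb)
  have "u \<noteq> 0" using u by auto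
  note g = gauge_pos[OF \<open>u \<noteq> 0\<close>] p.gauge_pos[OF \<open>u \<noteq> 0\<close>] radial_fun_wulff[OF \<open>u \<noteq> 0\<close>] p.radial_fun_wulff[OF \<open>u \<noteq> 0\<close>]
  obtain v where v: "v \<in> unit_sphere" "wulff_gauge (perturb \<phi> t) u = u \<bullet> v / h v * exp (- (t * \<phi> v))"
    using gauge_perturb_bounds(2)[OF \<phi> u] by blast
  then have "wulff_gauge (perturb \<phi> t) u \<le> wulff_gauge h u * exp (- (t * \<phi> v))"
    unfolding v(2) by (intro mult_right_mono gauge_upper v(1)) simp
  then have "exp (t * \<phi> v) / wulff_gauge h u \<le> 1 / wulff_gauge (perturb \<phi> t) u"
    using g(1,2) by (simp add: field_simps exp_minus)
  then have "radial_fun (wulff h) u * exp (t * \<phi> v) \<le> radial_fun (wulff (perturb \<phi> t)) u"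
    unfolding g(3,4) by simp
  then show "\<exists>v\<in>unit_sphere. radial_fun (wulff h) u * exp (t * \<phi> v) \<le> radial_fun (wulff (perturb \<phi> t)) u"
    using v(1) by blast
  show "v \<in> unit_sphere \<Longrightarrow> u \<bullet> v = wulff_gauge h u * h v \<Longrightarrow>
      radial_fun (wulff (perturb \<phi> t)) u \<le> radial_fun (wulff h) u * exp (t * \<phi> v)" for v
  proof -
    assume "v \<in> unit_sphere" "u \<bullet> v = wulff_gauge h u * h v"
    then have "wulff_gauge h u * exp (- (t * \<phi> v)) \<le> wulff_gauge (perturb \<phi> t) u"
      by (rule gauge_perturb_bounds(1)[OF \<phi> u])
    then have "1 / wulff_gauge (perturb \<phi> t) u \<le> 1 / wulff_gauge h u * exp (t * \<phi> v)"
      using g(1,2) by (simp add: field_simps exp_minus)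
    then show "radial_fun (wulff (perturb \<phi> t)) u \<le> radial_fun (wulff h) u * exp (t * \<phi> v)"
      by (simp only: g(3,4))
  qed
qed

end

section \<open>Continuous functions on the sphere under finite measures\<close>

lemma continuous_imp_borel_sphere:
  fixes f :: "real^'n \<Rightarrow> real"
  assumes "continuous_on unit_sphere f" and M: "sets M = sets borel_sphere"
  shows "f \<in> borel_measurable M"
  using borel_measurable_continuous_on_restrict[OF assms(1)] M by (simp cong: measurable_cong_sets)

lemma continuous_bounded_on_sphere:
  fixes f :: "real^'n \<Rightarrow> real"
  assumes "continuous_on unit_sphere f"
  obtains B where "0 \<le> B" "\<And>v. v \<in> unit_sphere \<Longrightarrow> \<bar>f v\<bar> \<le> B"
proof -
  have "bounded (f ` unit_sphere)"
    using compact_continuous_image[OF assms compact_sphere] by (rule compact_imp_bounded)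
  then obtain B where B: "\<forall>v\<in>unit_sphere. \<bar>f v\<bar> \<le> B" unfolding bounded_iff by auto
  moreover obtain v where "v \<in> (unit_sphere :: (real^'n) set)" using unit_sphere_nonempty by blast
  ultimately have "0 \<le> B" by (meson abs_ge_zero order_trans)
  then show ?thesis using that B by blast
qed

lemma continuous_integrable_sphere:
  fixes f :: "real^'n \<Rightarrow> real"
  assumes f: "continuous_on unit_sphere f" and M: "sets M = sets borel_sphere" "finite_measure M"
  shows "integrable M f"
proof -
  obtain B where "\<And>v. v \<in> unit_sphere \<Longrightarrow> \<bar>f v\<bar> \<le> B" using continuous_bounded_on_sphere[OF f] by metis
  moreover have "space M = unit_sphere" using sets_eq_imp_space_eq[OF M(1)] by (simp add: space_borel_sphere)
  ultimately show ?thesis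
    using continuous_imp_borel_sphere[OF f M(1)] M(2)
    by (intro finite_measure.integrable_const_bound[where B = B]) auto
qed

context positive_on_sphere
begin

lemma perturb_0 [simp]: "perturb \<phi> 0 = h"
  by (simp add: perturb_def fun_eq_iff)

text \<open>The majorant for differentiating the dual volume: by \<open>radial_perturb_ratio\<close>
  the radius changes at most by factors exp (t \<phi>) with \<phi> bounded by
  \<open>B\<close>.\<close>

lemma radial_powr_perturb_lipschitz:
  assumes \<phi>: "continuous_on unit_sphere \<phi>" "\<And>v. v \<in> unit_sphere \<Longrightarrow> \<bar>\<phi> v\<bar> \<le> B" and u: "u \<in> unit_sphere"
    and q: "0 < q" and t: "\<bar>t\<bar> \<le> 1"
  shows "\<bar>radial_fun (wulff (perturb \<phi> t)) u powr q - radial_fun (wulff h) u powr q\<bar> \<le>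
    radial_fun (wulff h) u powr q * (q * B * exp (q * B)) * \<bar>t\<bar>"
proof -
  let ?r = "radial_fun (wulff h) u" let ?rt = "radial_fun (wulff (perturb \<phi> t)) u"
  interpret p: positive_on_sphere "perturb \<phi> t" using \<phi>(1) by (rule positive_perturb)
  have "u \<noteq> 0" using u by auto
  then have r: "0 < ?r" "0 < ?rt" by (auto intro: radial_pos p.radial_pos)
  have ex: "\<bar>exp (t * (q * \<phi> v)) - 1\<bar> \<le> q * B * exp (q * B) * \<bar>t\<bar>" if "v \<in> unit_sphere" for v
    using \<phi>(2)[OF that] q t by (intro abs_exp_mult_minus_one_le) (auto simp: abs_mult mult_left_mono)
  have pe: "(?r * exp (t * \<phi> v)) powr q = ?r powr q * exp (t * (q * \<phi> v))" for v
    using r by (simp add: powr_mult powr_def[of "exp _"] mult_ac)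
  obtain v where v: "v \<in> unit_sphere" "?r * exp (t * \<phi> v) \<le> ?rt"
    using radial_perturb_ratio(1)[OF \<phi>(1) u] by blast
  obtain w where w: "w \<in> unit_sphere" "wulff_gauge h u = u \<bullet> w / h w" using gauge_attained by blast
  have "?rt \<le> ?r * exp (t * \<phi> w)"
    using w nonzero[OF w(1)] by (intro radial_perturb_ratio(2)[OF \<phi>(1) u]) auto
  then have "?rt powr q \<le> (?r * exp (t * \<phi> w)) powr q" using r q by (intro powr_mono2) auto
  then have up: "?rt powr q \<le> ?r powr q * exp (t * (q * \<phi> w))" by (simp only: pe)
  have "(?r * exp (t * \<phi> v)) powr q \<le> ?rt powr q" using v(2) r q by (intro powr_mono2) auto
  then have lo: "?r powr q * exp (t * (q * \<phi> v)) \<le> ?rt powr q" by (simp only: pe)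
  let ?C = "q * B * exp (q * B) * \<bar>t\<bar>"
  have "?r powr q * exp (t * (q * \<phi> w)) \<le> ?r powr q * (1 + ?C)"
    using ex[OF w(1)] by (intro mult_left_mono) auto
  moreover have "?r powr q * (1 - ?C) \<le> ?r powr q * exp (t * (q * \<phi> v))"
    using ex[OF v(1)] by (intro mult_left_mono) auto
  ultimately have "?rt powr q - ?r powr q \<le> ?r powr q * ?C" "?r powr q - ?rt powr q \<le> ?r powr q * ?C"
    using up lo by (simp_all add: algebra_simps)
  then show ?thesis by (simp add: abs_le_iff mult.assoc)
qed

end

context support_on_sphere
begin

text \<open>Envelope theorem for a maximum with a unique maximiser. The quotient lies between
  \<open>\<phi>\<close> at the normal and \<open>\<phi>\<close> at a maximiser \<open>V t\<close> of
  the perturbed problem, and uniqueness of the normal makes these values merge as t tends to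
  0.\<close>

lemma radial_perturb_log_derivative:
  assumes \<phi>: "continuous_on unit_sphere \<phi>" and u: "u \<in> unit_sphere" "u \<notin> singular_directions"
  shows "((\<lambda>t. ln (radial_fun (wulff (perturb \<phi> t)) u)) has_real_derivative \<phi> (normal u)) (at 0)"
proof -
  let ?r = "radial_fun (wulff h) u" let ?rt = "\<lambda>t. radial_fun (wulff (perturb \<phi> t)) u"
  let ?g = "wulff_gauge h u" let ?gt = "\<lambda>t. wulff_gauge (perturb \<phi> t) u" let ?v = "normal u"
  have "u \<noteq> 0" using u by auto
  have pp: "positive_on_sphere (perturb \<phi> t)" for t using \<phi> by (rule positive_perturb)
  have g: "0 < ?g" "\<And>t. 0 < ?gt t" using gauge_pos[OF \<open>u \<noteq> 0\<close>] positive_on_sphere.gauge_pos[OF pp \<open>u \<noteq> 0\<close>] by auto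
  have lnr: "ln (?rt t) = - ln (?gt t)" for t
    using positive_on_sphere.radial_fun_wulff[OF pp \<open>u \<noteq> 0\<close>] g(2)[of t] by (simp add: ln_div)
  have lnr0: "ln ?r = - ln ?g" using radial_fun_wulff[OF \<open>u \<noteq> 0\<close>] g(1) by (simp add: ln_div)
  obtain B where B: "\<And>v. v \<in> unit_sphere \<Longrightarrow> \<bar>\<phi> v\<bar> \<le> B" using continuous_bounded_on_sphere[OF \<phi>] by metis
  obtain V where V: "\<And>t. V t \<in> unit_sphere" "\<And>t. ?gt t = u \<bullet> V t / h (V t) * exp (- (t * \<phi> (V t)))"
    using gauge_perturb_bounds(2)[OF \<phi> u(1)] by metis
  have low: "?g * exp (- (t * \<phi> ?v)) \<le> ?gt t" for t
    by (rule gauge_perturb_bounds(1)[OF \<phi> u(1) normal_in_sphere normal_eq[OF u(2)]])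
  have upp: "?gt t \<le> ?g * exp (- (t * \<phi> (V t)))" for t
    unfolding V(2) by (intro mult_right_mono gauge_upper V(1)) simp
  \<comment> \<open>Convergence of the values \<open>\<phi> (V t)\<close> suffices here. On the
    compact set \<open>?K\<close> of directions where \<open>\<phi>\<close> is off by at least
    \<open>e\<close>, the ratio stays below some \<open>m < ?g\<close>, so a slightly perturbed
    maximum cannot be attained there.\<close>
  have ev: "\<forall>\<^sub>F t in at 0. \<bar>\<phi> (V t) - \<phi> ?v\<bar> < e" if e: "e > 0" for e
  proof -
    let ?K = "{w \<in> unit_sphere. e \<le> \<bar>\<phi> w - \<phi> ?v\<bar>}"
    obtain m where m: "0 \<le> m" "m < ?g" "\<And>w. w \<in> ?K \<Longrightarrow> u \<bullet> w / h w \<le> m"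
    proof (cases "?K = {}")
      case True then show ?thesis using that[of 0] g by auto
    next
      case False
      have "closed ((\<lambda>w. \<bar>\<phi> w - \<phi> ?v\<bar>) -` {e..} \<inter> unit_sphere)"
        by (intro continuous_on_closed_vimage[THEN iffD1, rule_format] continuous_intros \<phi>) auto
      moreover have "(\<lambda>w. \<bar>\<phi> w - \<phi> ?v\<bar>) -` {e..} \<inter> unit_sphere = ?K" by auto
      ultimately have "closed ?K" by simp
      then have "compact (unit_sphere \<inter> ?K)" by (intro compact_Int_closed compact_sphere)
      moreover have "unit_sphere \<inter> ?K = ?K" by blast
      ultimately have K: "compact ?K" by simp
      have "continuous_on ?K (\<lambda>w. u \<bullet> w / h w)" by (rule continuous_on_subset[OF continuous_ratio]) auto
      then obtain w where w: "w \<in> ?K" "\<And>x. x \<in> ?K \<Longrightarrow> u \<bullet> x / h x \<le> u \<bullet> w / h w"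
        using continuous_attains_sup[OF K False] by blast
      have "u \<bullet> w / h w \<noteq> ?g"
      proof
        assume "u \<bullet> w / h w = ?g"
        then have "u \<bullet> w = ?g * h w" using nonzero[of w] w(1) by (auto simp: field_simps)
        then have "w = ?v" using w(1) by (intro normal_unique u) auto
        then show False using w(1) e by auto
      qed
      moreover have "u \<bullet> w / h w \<le> ?g" using w(1) by (intro gauge_upper) auto
      ultimately show ?thesis using w(2) that[of "max 0 (u \<bullet> w / h w)"] g(1) by (simp add: max.coboundedI2)
    qed
    \<comment> \<open>The perturbation lowers the value at the normal by at most the factor exp
      (-|t|B) and raises values on \<open>?K\<close> by at most exp (|t|B), whence the factor
      2.\<close>
    have "((\<lambda>t. m * exp (2 * \<bar>t\<bar> * B)) \<longlongrightarrow> m * exp (2 * \<bar>0\<bar> * B)) (at (0::real))"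
      by (intro tendsto_intros)
    then have "\<forall>\<^sub>F t in at 0. m * exp (2 * \<bar>t\<bar> * B) < ?g"
      using m(2) by (intro order_tendstoD(2)[of _ m]) auto
    then show ?thesis
    proof eventually_elim
      case (elim t)
      show ?case
      proof (rule ccontr)
        assume "\<not> ?case"
        then have "V t \<in> ?K" using V(1) by auto
        have tB: "\<bar>t * \<phi> v\<bar> \<le> \<bar>t\<bar> * B" if "v \<in> unit_sphere" for v
          using B[OF that] by (simp add: abs_mult mult_left_mono)
        have "?g * exp (- (\<bar>t\<bar> * B)) \<le> ?g * exp (- (t * \<phi> ?v))"
          using tB[OF normal_in_sphere[of u]] g(1) by (intro mult_left_mono) auto
        also have "\<dots> \<le> ?gt t" by (rule low)
        also have "\<dots> \<le> m * exp (- (t * \<phi> (V t)))"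
          unfolding V(2) using m(3)[OF \<open>V t \<in> ?K\<close>] by (intro mult_right_mono) auto
        also have "\<dots> \<le> m * exp (\<bar>t\<bar> * B)"
          using tB[OF V(1), of t] m(1) by (intro mult_left_mono) auto
        finally have "?g * exp (- (\<bar>t\<bar> * B)) * exp (\<bar>t\<bar> * B) \<le> m * exp (\<bar>t\<bar> * B) * exp (\<bar>t\<bar> * B)"
          by (rule mult_right_mono) simp
        then have "?g \<le> m * exp (2 * \<bar>t\<bar> * B)" by (simp add: mult_ac flip: exp_add)
        then show False using elim by simp
      qed
    qed
  qed
  have "((\<lambda>t. (ln (?rt t) - ln (?rt 0)) / (t - 0)) \<longlongrightarrow> \<phi> ?v) (at 0)"
  proof (rule tendstoI)
    fix e :: real assume "0 < e"
    have "\<forall>\<^sub>F t in at (0::real). t \<noteq> 0" by (simp add: eventually_at_filter)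
    then show "\<forall>\<^sub>F t in at 0. dist ((ln (?rt t) - ln (?rt 0)) / (t - 0)) (\<phi> ?v) < e"
      using ev[OF \<open>0 < e\<close>]
    proof eventually_elim
      case (elim t)
      have "ln (?g * exp (- (t * \<phi> ?v))) \<le> ln (?gt t)" using low g by (intro ln_mono) auto
      then have 1: "ln (?rt t) - ln ?r \<le> t * \<phi> ?v" using g(1) by (simp add: lnr lnr0 ln_mult)
      have "ln (?gt t) \<le> ln (?g * exp (- (t * \<phi> (V t))))" using upp g by (intro ln_mono) auto
      then have 2: "t * \<phi> (V t) \<le> ln (?rt t) - ln ?r" using g(1) by (simp add: lnr lnr0 ln_mult)
      \<comment> \<open>The increment lies between t \<phi>(V t) and t \<phi>(?v). Absolute values
        treat both signs of \<open>t\<close> at once.\<close>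
      have "\<bar>ln (?rt t) - ln ?r - t * \<phi> ?v\<bar> \<le> \<bar>t * (\<phi> (V t) - \<phi> ?v)\<bar>"
        using 1 2 by (simp add: right_diff_distrib)
      then have "\<bar>ln (?rt t) - ln ?r - t * \<phi> ?v\<bar> / \<bar>t\<bar> \<le> \<bar>\<phi> (V t) - \<phi> ?v\<bar>"
        using elim(1) by (simp add: abs_mult pos_divide_le_eq mult.commute)
      moreover have "(ln (?rt t) - ln ?r) / t - \<phi> ?v = (ln (?rt t) - ln ?r - t * \<phi> ?v) / t"
        using elim(1) by (simp add: diff_divide_distrib)
      ultimately have "\<bar>(ln (?rt t) - ln ?r) / t - \<phi> ?v\<bar> \<le> \<bar>\<phi> (V t) - \<phi> ?v\<bar>"
        by (simp only: abs_divide)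
      then show ?case using elim(2) by (simp add: dist_real_def)
    qed
  qed
  then show ?thesis by (simp add: has_field_derivative_iff)
qed

lemma radial_perturb_derivative:
  assumes \<phi>: "continuous_on unit_sphere \<phi>" and u: "u \<in> unit_sphere" "u \<notin> singular_directions"
  shows "((\<lambda>t. radial_fun (wulff (perturb \<phi> t)) u powr q) has_real_derivative
    q * \<phi> (normal u) * radial_fun (wulff h) u powr q) (at 0)"
proof -
  have "u \<noteq> 0" using u by auto
  have pos: "0 < radial_fun (wulff (perturb \<phi> t)) u" for t
    using positive_on_sphere.radial_pos[OF positive_perturb[OF \<phi>] \<open>u \<noteq> 0\<close>] .
  have "((\<lambda>t. exp (q * ln (radial_fun (wulff (perturb \<phi> t)) u))) has_real_derivative
      exp (q * ln (radial_fun (wulff (perturb \<phi> 0)) u)) * (q * \<phi> (normal u))) (at 0)"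
    by (intro DERIV_fun_exp DERIV_cmult radial_perturb_log_derivative assms)
  moreover have "radial_fun (wulff (perturb \<phi> t)) u powr q = exp (q * ln (radial_fun (wulff (perturb \<phi> t)) u))" for t
    using pos[of t] by (simp add: powr_def)
  ultimately show ?thesis using pos[of 0] by (simp add: powr_def mult_ac)
qed

lemma dual_volume_derivative:
  assumes n: "CARD('n) \<ge> 2" and \<phi>: "continuous_on unit_sphere \<phi>" and w: "continuous_on unit_sphere w" and q: "0 < q"
  shows "((\<lambda>t. \<integral>u. radial_fun (wulff (perturb \<phi> t)) u powr q * w u \<partial>sphere_measure) has_real_derivative
    (\<integral>u. q * \<phi> (normal u) * (radial_fun (wulff h) u powr q * w u) \<partial>sphere_measure)) (at 0)"
proof -
  obtain B where B: "0 \<le> B" "\<And>v. v \<in> unit_sphere \<Longrightarrow> \<bar>\<phi> v\<bar> \<le> B" using continuous_bounded_on_sphere[OF \<phi>] by metis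
  have cr: "continuous_on unit_sphere (\<lambda>u. radial_fun (wulff (perturb \<phi> t)) u powr q)" for t
  proof (intro continuous_on_powr positive_on_sphere.radial_continuous[OF positive_perturb[OF \<phi>]] continuous_on_const ballI)
    fix u :: "real^'n" assume "u \<in> unit_sphere"
    then have "u \<noteq> 0" by auto
    then show "radial_fun (wulff (perturb \<phi> t)) u \<noteq> 0"
      using positive_on_sphere.radial_pos[OF positive_perturb[OF \<phi>], of u t] by simp
  qed
  have cr0: "continuous_on unit_sphere (\<lambda>u. radial_fun (wulff h) u powr q)" using cr[of 0] by simp
  note int = continuous_integrable_sphere[OF _ sets_sphere_measure finite_sphere_measure[OF n]]
  have nm: "normal \<in> measurable sphere_measure borel_sphere"
    using normal_measurable[OF n] by (simp cong: measurable_cong_sets)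
  have \<phi>n: "(\<lambda>u. \<phi> (normal u)) \<in> borel_measurable sphere_measure"
    by (rule measurable_compose[OF nm borel_measurable_continuous_on_restrict[OF \<phi>]])
  note [measurable] = \<phi>n continuous_imp_borel_sphere[OF w sets_sphere_measure] continuous_imp_borel_sphere[OF cr0 sets_sphere_measure]
  show ?thesis
  proof (rule has_derivative_under_integral[where C = "\<lambda>u. radial_fun (wulff h) u powr q * (q * B * exp (q * B)) * \<bar>w u\<bar>"])
    show "integrable sphere_measure (\<lambda>u. radial_fun (wulff (perturb \<phi> t)) u powr q * w u)" for t
      by (intro int continuous_on_mult cr w)
    show "integrable sphere_measure (\<lambda>u. radial_fun (wulff h) u powr q * (q * B * exp (q * B)) * \<bar>w u\<bar>)"
      by (intro int continuous_intros cr0 w)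
    show "(\<lambda>u. q * \<phi> (normal u) * (radial_fun (wulff h) u powr q * w u)) \<in> borel_measurable sphere_measure"
      by measurable
    have "AE u in sphere_measure. u \<notin> singular_directions" using singular_directions_null[OF n] by (rule AE_not_in)
    then show "AE u in sphere_measure. ((\<lambda>t. radial_fun (wulff (perturb \<phi> t)) u powr q * w u) has_real_derivative
        q * \<phi> (normal u) * (radial_fun (wulff h) u powr q * w u)) (at 0)"
      using AE_space
    proof eventually_elim
      case (elim u)
      then have "((\<lambda>t. radial_fun (wulff (perturb \<phi> t)) u powr q * w u) has_real_derivative
        (q * \<phi> (normal u) * radial_fun (wulff h) u powr q) * w u) (at 0)"
        by (intro DERIV_cmult_right radial_perturb_derivative \<phi>) auto
      then show ?case by (simp add: mult.assoc)
    qed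
    show "AE u in sphere_measure. \<forall>t. \<bar>t\<bar> \<le> 1 \<longrightarrow>
        \<bar>radial_fun (wulff (perturb \<phi> t)) u powr q * w u - radial_fun (wulff (perturb \<phi> 0)) u powr q * w u\<bar>
        \<le> radial_fun (wulff h) u powr q * (q * B * exp (q * B)) * \<bar>w u\<bar> * \<bar>t\<bar>"
    proof (intro AE_I2 allI impI)
      fix u :: "real^'n" and t :: real assume u: "u \<in> space sphere_measure" and t: "\<bar>t\<bar> \<le> 1"
      have "\<bar>radial_fun (wulff (perturb \<phi> t)) u powr q - radial_fun (wulff h) u powr q\<bar> * \<bar>w u\<bar> \<le>
          (radial_fun (wulff h) u powr q * (q * B * exp (q * B)) * \<bar>t\<bar>) * \<bar>w u\<bar>"
        using u by (intro mult_right_mono radial_powr_perturb_lipschitz \<phi> B q t) auto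
      then show "\<bar>radial_fun (wulff (perturb \<phi> t)) u powr q * w u - radial_fun (wulff (perturb \<phi> 0)) u powr q * w u\<bar>
        \<le> radial_fun (wulff h) u powr q * (q * B * exp (q * B)) * \<bar>w u\<bar> * \<bar>t\<bar>"
        by (simp only: left_diff_distrib[symmetric] abs_mult perturb_0) (simp only: mult_ac)
    qed
  qed
qed

end

text \<open>This factor of the functional contains \<open>h\<close> itself and not its Wulff shape,
  so it is differentiated pointwise at every \<open>v\<close>.\<close>

lemma (in positive_on_sphere) support_integral_derivative:
  fixes M :: "(real^'n) measure"
  assumes M: "sets M = sets borel_sphere" "finite_measure M" and \<phi>: "continuous_on unit_sphere \<phi>" and P: "0 < P"
  shows "((\<lambda>t. \<integral>v. perturb \<phi> t v powr (- P) \<partial>M) has_real_derivative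
    (\<integral>v. - P * \<phi> v * h v powr (- P) \<partial>M)) (at 0)"
proof -
  obtain B where B: "0 \<le> B" "\<And>v. v \<in> unit_sphere \<Longrightarrow> \<bar>\<phi> v\<bar> \<le> B" using continuous_bounded_on_sphere[OF \<phi>] by metis
  have sp: "space M = unit_sphere" using sets_eq_imp_space_eq[OF M(1)] by (simp add: space_borel_sphere)
  have ch: "continuous_on unit_sphere (\<lambda>v. h v powr (- P))"
    by (intro continuous_on_powr cont continuous_on_const ballI nonzero)
  have eq: "perturb \<phi> t v powr (- P) = h v powr (- P) * exp (t * (- P * \<phi> v))" if "v \<in> unit_sphere" for t v
    using pos[OF that] by (simp add: perturb_def powr_mult powr_def[of "exp _"] mult_ac)
  note int = continuous_integrable_sphere[OF _ M]
  have "((\<lambda>t. \<integral>v. h v powr (- P) * exp (t * (- P * \<phi> v)) \<partial>M) has_real_derivative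
    (\<integral>v. - P * \<phi> v * h v powr (- P) \<partial>M)) (at 0)"
  proof (rule has_derivative_under_integral[where C = "\<lambda>v. h v powr (- P) * (P * B * exp (P * B))"])
    show "integrable M (\<lambda>v. h v powr (- P) * exp (t * (- P * \<phi> v)))" for t
      by (intro int continuous_intros ch \<phi>)
    show "integrable M (\<lambda>v. h v powr (- P) * (P * B * exp (P * B)))"
      by (intro int continuous_intros ch)
    show "(\<lambda>v. - P * \<phi> v * h v powr (- P)) \<in> borel_measurable M"
      by (intro continuous_imp_borel_sphere M continuous_intros ch \<phi>)
    show "AE v in M. ((\<lambda>t. h v powr (- P) * exp (t * (- P * \<phi> v))) has_real_derivative - P * \<phi> v * h v powr (- P)) (at 0)"
      by (intro AE_I2) (auto intro!: derivative_eq_intros)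
    show "AE v in M. \<forall>t. \<bar>t\<bar> \<le> 1 \<longrightarrow>
        \<bar>h v powr (- P) * exp (t * (- P * \<phi> v)) - h v powr (- P) * exp (0 * (- P * \<phi> v))\<bar> \<le> h v powr (- P) * (P * B * exp (P * B)) * \<bar>t\<bar>"
    proof (intro AE_I2 allI impI)
      fix v and t :: real assume v: "v \<in> space M" and t: "\<bar>t\<bar> \<le> 1"
      have "\<bar>- P * \<phi> v\<bar> \<le> P * B" using B(2)[of v] v P by (simp add: sp abs_mult)
      then have "h v powr (- P) * \<bar>exp (t * (- P * \<phi> v)) - 1\<bar> \<le> h v powr (- P) * (P * B * exp (P * B) * \<bar>t\<bar>)"
        using t by (intro mult_left_mono abs_exp_mult_minus_one_le) auto
      moreover have "\<bar>h v powr (- P) * exp (t * (- P * \<phi> v)) - h v powr (- P) * exp (0 * (- P * \<phi> v))\<bar> =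
          h v powr (- P) * \<bar>exp (t * (- P * \<phi> v)) - 1\<bar>"
      proof -
        have "h v powr (- P) * exp (t * (- P * \<phi> v)) - h v powr (- P) * exp (0 * (- P * \<phi> v)) =
            h v powr (- P) * (exp (t * (- P * \<phi> v)) - 1)" by (simp add: right_diff_distrib)
        then show ?thesis by (simp only: abs_mult) simp
      qed
      ultimately show "\<bar>h v powr (- P) * exp (t * (- P * \<phi> v)) - h v powr (- P) * exp (0 * (- P * \<phi> v))\<bar> \<le>
          h v powr (- P) * (P * B * exp (P * B)) * \<bar>t\<bar>" by (simp add: mult.assoc)
    qed
  qed
  moreover have "(\<integral>v. perturb \<phi> t v powr (- P) \<partial>M) = (\<integral>v. h v powr (- P) * exp (t * (- P * \<phi> v)) \<partial>M)" for t
    by (intro Bochner_Integration.integral_cong) (auto simp: sp eq)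
  ultimately show ?thesis by simp
qed

section \<open>Boxes adapted to a convex body\<close>

lemma subgroup_orthogonal_group:
  fixes G :: "(real^'n^'n) set"
  assumes "subgroup G orthogonal_group"
  shows "mat 1 \<in> G" "\<And>g. g \<in> G \<Longrightarrow> orthogonal_matrix g" "\<And>g k. g \<in> G \<Longrightarrow> k \<in> G \<Longrightarrow> g ** k \<in> G"
    "\<And>g. g \<in> G \<Longrightarrow> transpose g \<in> G"
proof -
  show one: "mat 1 \<in> G" and orth: "\<And>g. g \<in> G \<Longrightarrow> orthogonal_matrix g" and "\<And>g k. g \<in> G \<Longrightarrow> k \<in> G \<Longrightarrow> g ** k \<in> G"
    using subgroup.one_closed[OF assms] subgroup.mem_carrier[OF assms] subgroup.m_closed[OF assms]
    by (auto simp: orthogonal_group_def)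
  fix g assume g: "g \<in> G"
  have "inv\<^bsub>orthogonal_group\<^esub> g = transpose g"
    by (rule group.inv_equality[OF group_orthogonal_group])
       (use orth[OF g] in \<open>auto simp: orthogonal_group_def orthogonal_matrix_def\<close>)
  then show "transpose g \<in> G" using subgroup.m_inv_closed[OF assms g] by simp
qed

lemma norm_orthogonal_matrix_mult: "orthogonal_matrix g \<Longrightarrow> norm (g *v x) = norm (x :: real^'n)"
  using orthogonal_transformation_matrix[of "(*v) g"] orthogonal_transformation_norm[of "(*v) g" x] by simp

lemma inner_orthogonal_matrix_mult: "orthogonal_matrix g \<Longrightarrow> (g *v x) \<bullet> (g *v y) = x \<bullet> (y :: real^'n)"
  using orthogonal_transformation_matrix[of "(*v) g"] by (simp add: orthogonal_transformation_def)

lemma orthogonal_matrix_transpose_mult: "orthogonal_matrix g \<Longrightarrow> g *v (transpose g *v x) = (x :: real^'n)"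
  "orthogonal_matrix g \<Longrightarrow> transpose g *v (g *v x) = x"
  unfolding orthogonal_matrix_def by (simp_all only: matrix_vector_mul_assoc matrix_vector_mul_lid)

lemma orthogonal_matrix_mem_sphere: "orthogonal_matrix g \<Longrightarrow> g *v x \<in> unit_sphere \<longleftrightarrow> x \<in> unit_sphere"
  by (simp add: norm_orthogonal_matrix_mult)

lemma compact_orthogonal_subgroup:
  fixes G :: "(real^'n^'n) set"
  assumes "closed G" "\<And>g. g \<in> G \<Longrightarrow> orthogonal_matrix g"
  shows "compact G"
proof -
  have "norm g \<le> real CARD('n)" if "g \<in> G" for g
  proof -
    have "orthogonal_matrix g" using that assms by blast
    then have "norm (row i g) = 1" for i using orthogonal_matrix_orthonormal_rows by blast
    then have "norm (g $ i) = 1" for i by (simp add: row_def vec_lambda_eta)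
    then show ?thesis using L2_set_le_sum[of UNIV "\<lambda>i. norm (g $ i)"] by (simp add: norm_vec_def)
  qed
  then have "bounded G" by (auto simp: bounded_iff)
  then show ?thesis using assms(1) by (simp add: compact_eq_bounded_closed)
qed

text \<open>
  The point of least norm in the convex hull of an orbit is fixed, hence it is the origin;
  Caratheodory's theorem yields the quantitative statement.
\<close>

lemma neg_in_convex_hull_orbit:
  fixes G :: "(real^'n^'n) set"
  assumes G: "subgroup G orthogonal_group" "closed G" and fix0: "\<And>x. (\<forall>g\<in>G. g *v x = x) \<Longrightarrow> x = 0"
  shows "- (1 / real CARD('n)) *\<^sub>R x \<in> convex hull ((\<lambda>g. g *v x) ` G)"
proof -
  let ?n = "real CARD('n)"
  note sub = subgroup_orthogonal_group[OF G(1)]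
  define Orb where "Orb = (\<lambda>g. g *v x) ` G"
  define P where "P = convex hull Orb"
  have lin: "linear (\<lambda>g :: real^'n^'n. g *v x)"
    by (rule linearI) (simp_all add: matrix_vector_mult_add_rdistrib scaleR_matrix_vector_assoc)
  have "compact Orb" unfolding Orb_def
    using lin compact_orthogonal_subgroup[OF G(2) sub(2)]
    by (intro compact_continuous_image linear_continuous_on) (auto simp: linear_linear)
  then have P: "compact P" "convex P" by (auto simp: P_def compact_convex_hull convex_convex_hull)
  have ne: "P \<noteq> {}" using sub(1) by (auto simp: P_def Orb_def)
  have inv: "g *v y \<in> P" if "g \<in> G" "y \<in> P" for g y
  proof -
    have "(*v) g ` Orb \<subseteq> Orb" using sub(3)[OF that(1)] by (auto simp: Orb_def matrix_vector_mul_assoc)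
    then have "convex hull ((*v) g ` Orb) \<subseteq> P" unfolding P_def by (rule hull_mono)
    moreover have "convex hull ((*v) g ` Orb) = (*v) g ` P"
      unfolding P_def by (rule convex_hull_linear_image[symmetric]) simp
    ultimately show ?thesis using that(2) by blast
  qed
  define z where "z = closest_point P 0"
  have z: "z \<in> P" unfolding z_def using P ne by (intro closest_point_in_set compact_imp_closed)
  have "g *v z = z" if "g \<in> G" for g
    unfolding z_def
  proof (rule closest_point_unique[OF P(2)])
    show "closed P" using P by (simp add: compact_imp_closed)
    show "g *v closest_point P 0 \<in> P" using inv[OF that z] by (simp add: z_def)
    show "\<forall>y\<in>P. dist 0 (g *v closest_point P 0) \<le> dist 0 y"
      using closest_point_le[of P _ 0] P norm_orthogonal_matrix_mult[OF sub(2)[OF that]] by (simp add: compact_imp_closed)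
  qed
  then have "z = 0" using fix0 by blast
  then have "0 \<in> convex hull Orb" using z by (simp add: P_def)
  then obtain S where S: "finite S" "S \<subseteq> Orb" "card S \<le> DIM(real^'n) + 1" "0 \<in> convex hull S"
    unfolding caratheodory[of Orb] by blast
  then obtain u where u: "\<And>s. s \<in> S \<Longrightarrow> 0 \<le> u s" "sum u S = 1" "(\<Sum>s\<in>S. u s *\<^sub>R s) = 0"
    by (auto simp: convex_hull_finite)
  \<comment> \<open>At most n + 1 points carry weights of sum 1, so one weight reaches the
    average.\<close>
  have "\<exists>s\<in>S. 1 / (?n + 1) \<le> u s"
  proof (rule ccontr)
    assume "\<not> ?thesis"
    then have *: "\<And>s. s \<in> S \<Longrightarrow> u s < 1 / (?n + 1)" by force
    have "S \<noteq> {}" using u(2) by auto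
    then have "sum u S < (\<Sum>s\<in>S. 1 / (?n + 1))" using S(1) * by (intro sum_strict_mono) auto
    also have "\<dots> = real (card S) / (?n + 1)" by simp
    also have "\<dots> \<le> 1" using S(3) by (simp add: pos_divide_le_eq)
    finally show False using u(2) by simp
  qed
  then obtain s where s: "s \<in> S" "1 / (?n + 1) \<le> u s" by blast
  \<comment> \<open>Take 1 / (n + 1) away from the weight of \<open>s\<close> and multiply by (n +
    1) / n: the weights stay non-negative, sum to 1, and now represent -s / n instead of 0.\<close>
  define w where "w t = ((?n + 1) * u t - (if t = s then 1 else 0)) / ?n" for t
  have "- (1 / ?n) *\<^sub>R s = (\<Sum>t\<in>S. w t *\<^sub>R t)"
  proof -
    have "(\<Sum>t\<in>S. w t *\<^sub>R t) = (\<Sum>t\<in>S. ((?n + 1) / ?n) *\<^sub>R (u t *\<^sub>R t) - (if t = s then (1 / ?n) *\<^sub>R t else 0))"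
      by (intro sum.cong) (auto simp: w_def diff_divide_distrib scaleR_left_diff_distrib)
    also have "\<dots> = ((?n + 1) / ?n) *\<^sub>R (\<Sum>t\<in>S. u t *\<^sub>R t) - (1 / ?n) *\<^sub>R s"
      using S(1) s(1) by (simp add: sum_subtractf scaleR_sum_right sum.delta)
    finally show ?thesis using u(3) by simp
  qed
  moreover have "sum w S = 1"
  proof -
    have "sum w S = (\<Sum>t\<in>S. ((?n + 1) / ?n) * u t - (if t = s then 1 / ?n else 0))"
      by (intro sum.cong) (auto simp: w_def diff_divide_distrib)
    also have "\<dots> = ((?n + 1) / ?n) * sum u S - 1 / ?n"
      using S(1) s(1) by (simp add: sum_subtractf sum_distrib_left sum.delta)
    finally show ?thesis using u(2) by (simp add: field_simps)
  qed
  moreover have "0 \<le> w t" if "t \<in> S" for t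
    using u(1)[OF that] s(2) by (auto simp: w_def field_simps)
  ultimately have "- (1 / ?n) *\<^sub>R s \<in> convex hull S"
    using S(1) by (auto simp: convex_hull_finite intro!: exI[of _ w])
  then have sP: "- (1 / ?n) *\<^sub>R s \<in> P" unfolding P_def using hull_mono[OF S(2)] by blast
  obtain g where g: "g \<in> G" "s = g *v x" using s(1) S(2) by (auto simp: Orb_def)
  \<comment> \<open>\<open>s\<close> is some point of the orbit and need not be \<open>x\<close>;
    the inverse of \<open>g\<close> carries -s / n to -x / n inside the invariant hull.\<close>
  have "transpose g *v (- (1 / ?n) *\<^sub>R s) \<in> P" using inv[OF sub(4)[OF g(1)] sP] .
  moreover have "transpose g *v (- (1 / ?n) *\<^sub>R s) = - (1 / ?n) *\<^sub>R x"
    using orthogonal_matrix_transpose_mult(2)[OF sub(2)[OF g(1)], of x] g(2)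
    by (metis matrix_vector_mult_scaleR)
  ultimately show ?thesis by (simp add: P_def Orb_def)
qed

text \<open>
  The axes are chosen greedily: each one points to a point of \<open>K\<close> at maximal distance from the span
  of the previous axes.
\<close>

lemma greedy_axes:
  fixes K :: "(real^'n) set"
  assumes K: "compact K" "ball 0 \<epsilon> \<subseteq> K" "\<epsilon> > 0" and "m \<le> CARD('n)"
  shows "\<exists>e a. (\<forall>i<m. 0 < a i) \<and> (\<forall>i<m. \<forall>j<m. e i \<bullet> e j = (if i = j then 1 else 0)) \<and>
    (\<forall>k<m. \<forall>y\<in>K. \<bar>y \<bullet> e k\<bar> \<le> a k) \<and>
    (\<forall>k<m. \<exists>x\<in>K. \<exists>c. x = a k *\<^sub>R e k + (\<Sum>j<k. c j *\<^sub>R e j) \<and> (\<forall>j<k. \<bar>c j\<bar> \<le> a j))"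
  using \<open>m \<le> CARD('n)\<close>
proof (induction m)
  case 0
  show ?case by simp
next
  case (Suc m)
  then obtain e :: "nat \<Rightarrow> real^'n" and a :: "nat \<Rightarrow> real" where IH: "\<forall>i<m. 0 < a i"
      "\<forall>i<m. \<forall>j<m. e i \<bullet> e j = (if i = j then 1 else 0)" "\<forall>k<m. \<forall>y\<in>K. \<bar>y \<bullet> e k\<bar> \<le> a k"
      "\<forall>k<m. \<exists>x\<in>K. \<exists>c. x = a k *\<^sub>R e k + (\<Sum>j<k. c j *\<^sub>R e j) \<and> (\<forall>j<k. \<bar>c j\<bar> \<le> a j)"
    by auto
  \<comment> \<open>Orthogonal projection away from the axes chosen so far; its norm is the distance
    to be maximised.\<close>
  define P where "P y = y - (\<Sum>j<m. (y \<bullet> e j) *\<^sub>R e j)" for y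
  have Pe: "P y \<bullet> e k = 0" if "k < m" for y k
  proof -
    have "(\<Sum>j<m. (y \<bullet> e j) *\<^sub>R e j) \<bullet> e k = (\<Sum>j<m. (y \<bullet> e j) * (e j \<bullet> e k))"
      by (simp add: inner_sum_left)
    also have "\<dots> = (\<Sum>j<m. if j = k then y \<bullet> e k else 0)"
      using IH(2) that by (intro sum.cong) auto
    also have "\<dots> = y \<bullet> e k" using that by simp
    finally show ?thesis by (simp add: P_def inner_diff_left)
  qed
  have contP: "continuous_on K (\<lambda>y. norm (P y))" unfolding P_def by (intro continuous_intros)
  have "K \<noteq> {}" using K(2,3) by auto
  then obtain x where x: "x \<in> K" "\<And>y. y \<in> K \<Longrightarrow> norm (P y) \<le> norm (P x)"
    using continuous_attains_sup[OF K(1) _ contP] by blast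
  have "dim (e ` {..<m}) < DIM(real^'n)"
  proof -
    have "dim (e ` {..<m}) \<le> card (e ` {..<m})" by (rule dim_le_card') simp
    also have "\<dots> \<le> m" using card_image_le[of "{..<m}" e] by simp
    finally show ?thesis using Suc.prems by simp
  qed
  then obtain z where z: "z \<noteq> 0" "\<And>y. y \<in> span (e ` {..<m}) \<Longrightarrow> orthogonal z y"
    using orthogonal_to_subspace_exists by blast
  \<comment> \<open>A point of the inner ball orthogonal to all previous axes. It shows that the
    maximal distance is positive.\<close>
  define y where "y = (\<epsilon> / 2 / norm z) *\<^sub>R z"
  have "y \<in> K" using K(2,3) z(1) by (intro subsetD[OF K(2)]) (simp add: y_def)
  have "y \<bullet> e j = 0" if "j < m" for j
    using z(2)[of "e j"] that by (auto simp: y_def orthogonal_def intro: span_base)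
  then have "P y = y" by (simp add: P_def)
  then have "0 < norm (P y)" using z(1) K(3) by (simp add: y_def)
  then have Px: "0 < norm (P x)" using x(2)[OF \<open>y \<in> K\<close>] by linarith
  define e' where "e' = e(m := P x /\<^sub>R norm (P x))"
  define a' where "a' = a(m := norm (P x))"
  have e'm: "e' m \<bullet> e j = 0" if "j < m" for j using Pe[OF that] by (simp add: e'_def)
  have e'n: "norm (e' m) = 1" using Px by (simp add: e'_def)
  show ?case
  proof (intro exI[of _ e'] exI[of _ a'] conjI)
    show "\<forall>i<Suc m. 0 < a' i" using IH(1) Px by (auto simp: a'_def less_Suc_eq)
    have "e' m \<bullet> e' m = 1" using e'n by (simp add: dot_square_norm)
    then show "\<forall>i<Suc m. \<forall>j<Suc m. e' i \<bullet> e' j = (if i = j then 1 else 0)"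
      using IH(2) e'm by (auto simp: less_Suc_eq e'_def inner_commute)
    have "\<bar>y \<bullet> e' m\<bar> \<le> a' m" if "y \<in> K" for y
    proof -
      have "y \<bullet> e' m = P y \<bullet> e' m + (\<Sum>j<m. (y \<bullet> e j) * (e j \<bullet> e' m))"
        by (simp add: P_def inner_diff_left inner_sum_left)
      also have "(\<Sum>j<m. (y \<bullet> e j) * (e j \<bullet> e' m)) = 0"
        using e'm by (intro sum.neutral) (auto simp: inner_commute)
      finally have "\<bar>y \<bullet> e' m\<bar> \<le> norm (P y)" using Cauchy_Schwarz_ineq2[of "P y" "e' m"] e'n by simp
      then show ?thesis using x(2)[OF that] by (simp add: a'_def)
    qed
    then show "\<forall>k<Suc m. \<forall>y\<in>K. \<bar>y \<bullet> e' k\<bar> \<le> a' k"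
      using IH(3) by (auto simp: less_Suc_eq e'_def a'_def)
    show "\<forall>k<Suc m. \<exists>x\<in>K. \<exists>c. x = a' k *\<^sub>R e' k + (\<Sum>j<k. c j *\<^sub>R e' j) \<and> (\<forall>j<k. \<bar>c j\<bar> \<le> a' j)"
    proof (intro allI impI)
      fix k assume "k < Suc m"
      then consider "k < m" | "k = m" by linarith
      then show "\<exists>x\<in>K. \<exists>c. x = a' k *\<^sub>R e' k + (\<Sum>j<k. c j *\<^sub>R e' j) \<and> (\<forall>j<k. \<bar>c j\<bar> \<le> a' j)"
      proof cases
        case 1
        then obtain x c where xc: "x \<in> K" "x = a k *\<^sub>R e k + (\<Sum>j<k. c j *\<^sub>R e j)" "\<forall>j<k. \<bar>c j\<bar> \<le> a j"
          using IH(4) by blast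
        moreover have "(\<Sum>j<k. c j *\<^sub>R e' j) = (\<Sum>j<k. c j *\<^sub>R e j)"
          using 1 by (intro sum.cong) (auto simp: e'_def)
        ultimately show ?thesis using 1 by (intro bexI[of _ x] exI[of _ c]) (auto simp: e'_def a'_def)
      next
        case 2
        have "(\<Sum>j<m. (x \<bullet> e j) *\<^sub>R e' j) = (\<Sum>j<m. (x \<bullet> e j) *\<^sub>R e j)"
          by (intro sum.cong) (auto simp: e'_def)
        then have "x = a' m *\<^sub>R e' m + (\<Sum>j<m. (x \<bullet> e j) *\<^sub>R e' j)"
          using Px by (simp add: a'_def e'_def P_def)
        moreover have "\<forall>j<m. \<bar>x \<bullet> e j\<bar> \<le> a' j" using IH(3) x(1) by (auto simp: a'_def)
        ultimately show ?thesis using x(1) 2 by (intro bexI[of _ x] exI[of _ "\<lambda>j. x \<bullet> e j"]) auto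
      qed
    qed
  qed
qed

text \<open>The first bounds say that \<open>K\<close> lies in the box with half-axes
  \<open>a\<close>. The last one is a converse up to 2^n: if \<open>v\<close> is bounded by
  \<open>H\<close> on \<open>K\<close>, it has size at most 2^n H at the tips of the axes. This
  places the polar body in a box with half-axes proportional to 1 / a.\<close>

lemma adapted_box:
  fixes K :: "(real^'n) set"
  assumes K: "compact K" "ball 0 \<epsilon> \<subseteq> K" "\<epsilon> > 0"
  obtains e :: "'n \<Rightarrow> real^'n" and a where "\<And>i. 0 < a i" "\<And>i j. e i \<bullet> e j = (if i = j then 1 else 0)"
    "\<And>i y. y \<in> K \<Longrightarrow> \<bar>y \<bullet> e i\<bar> \<le> a i"
    "\<And>i v H. (\<And>x. x \<in> K \<Longrightarrow> \<bar>x \<bullet> v\<bar> \<le> H) \<Longrightarrow> a i * \<bar>v \<bullet> e i\<bar> \<le> 2 ^ CARD('n) * H"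
proof -
  let ?n = "CARD('n)"
  obtain e :: "nat \<Rightarrow> real^'n" and a where E: "\<forall>i<?n. 0 < a i"
      "\<forall>i<?n. \<forall>j<?n. e i \<bullet> e j = (if i = j then 1 else 0)" "\<forall>k<?n. \<forall>y\<in>K. \<bar>y \<bullet> e k\<bar> \<le> a k"
      "\<forall>k<?n. \<exists>x\<in>K. \<exists>c. x = a k *\<^sub>R e k + (\<Sum>j<k. c j *\<^sub>R e j) \<and> (\<forall>j<k. \<bar>c j\<bar> \<le> a j)"
    using greedy_axes[OF K order_refl] by blast
  note e = E(1)[rule_format] E(2)[rule_format] E(3)[rule_format] E(4)[rule_format]
  obtain \<iota> where \<iota>: "bij_betw \<iota> (UNIV :: 'n set) {..<?n}"
    using ex_bij_betw_finite_nat[of "UNIV :: 'n set"] by (auto simp: atLeast0LessThan)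
  have \<iota>lt: "\<iota> i < ?n" for i using bij_betwE[OF \<iota>] by auto
  have \<iota>inj: "\<iota> i = \<iota> j \<longleftrightarrow> i = j" for i j using bij_betw_imp_inj_on[OF \<iota>] by (auto simp: inj_on_def)
  \<comment> \<open>Each greedy point is a triangular combination of axes. Solving for the last
    term, the constants obey 1 + (1 + 2 + ... + 2^(k-1)) = 2^k.\<close>
  have bound: "a k * \<bar>v \<bullet> e k\<bar> \<le> 2 ^ k * H" if "k < ?n" and H: "\<And>x. x \<in> K \<Longrightarrow> \<bar>x \<bullet> v\<bar> \<le> H" for k v H
    using \<open>k < ?n\<close>
  proof (induction k rule: less_induct)
    case (less k)
    obtain x c where x: "x \<in> K" "x = a k *\<^sub>R e k + (\<Sum>j<k. c j *\<^sub>R e j)" "\<And>j. j < k \<Longrightarrow> \<bar>c j\<bar> \<le> a j"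
      using e(4)[OF less.prems] by blast
    have "a k * (v \<bullet> e k) = x \<bullet> v - (\<Sum>j<k. c j * (v \<bullet> e j))"
      by (subst x(2)) (simp add: inner_add_left inner_sum_left inner_commute[of v])
    moreover have "\<bar>\<Sum>j<k. c j * (v \<bullet> e j)\<bar> \<le> (\<Sum>j<k. 2 ^ j * H)"
    proof (rule order_trans[OF sum_abs], rule sum_mono)
      fix j assume j: "j \<in> {..<k}"
      have "\<bar>c j * (v \<bullet> e j)\<bar> \<le> a j * \<bar>v \<bullet> e j\<bar>" using x(3) j by (simp add: abs_mult mult_right_mono)
      also have "\<dots> \<le> 2 ^ j * H" using less.IH[of j] less.prems j by simp
      finally show "\<bar>c j * (v \<bullet> e j)\<bar> \<le> 2 ^ j * H" .
    qed
    moreover have "(\<Sum>j<k. 2 ^ j * H) = (2 ^ k - 1) * H"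
    proof -
      have "(\<Sum>j<k. 2 ^ j) = 2 ^ k - (1::real)" by (induction k) auto
      then show ?thesis by (simp flip: sum_distrib_right)
    qed
    ultimately have "\<bar>a k * (v \<bullet> e k)\<bar> \<le> H + (2 ^ k - 1) * H" using H[OF x(1)] by linarith
    then show ?case using e(1)[OF less.prems] by (simp add: abs_mult algebra_simps)
  qed
  show ?thesis
  proof (rule that[of "\<lambda>i. a (\<iota> i)" "\<lambda>i. e (\<iota> i)"])
    show "a (\<iota> i) * \<bar>v \<bullet> e (\<iota> i)\<bar> \<le> 2 ^ ?n * H" if H: "\<And>x. x \<in> K \<Longrightarrow> \<bar>x \<bullet> v\<bar> \<le> H" for i v H
    proof -
      have "0 \<in> K" using K(2,3) by auto
      then have "0 \<le> H" using H[of 0] by simp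
      have "a (\<iota> i) * \<bar>v \<bullet> e (\<iota> i)\<bar> \<le> 2 ^ \<iota> i * H" by (intro bound \<iota>lt H)
      also have "\<dots> \<le> 2 ^ ?n * H" using \<iota>lt[of i] \<open>0 \<le> H\<close> by (intro mult_right_mono power_increasing) auto
      finally show ?thesis .
    qed
  qed (use e \<iota>lt \<iota>inj in auto)
qed

lemma orthonormal_family:
  fixes e :: "'n \<Rightarrow> real^'n"
  assumes e: "\<And>i j. e i \<bullet> e j = (if i = j then 1 else 0)"
  shows "orthogonal_transformation (\<lambda>y :: real^'n. \<Sum>i\<in>UNIV. y $ i *\<^sub>R e i)"
    and "(\<Sum>i\<in>UNIV. y $ i *\<^sub>R e i) \<bullet> e j = y $ j"
    and "(\<Sum>i\<in>UNIV. (x \<bullet> e i) *\<^sub>R e i) = x"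
proof -
  let ?f = "\<lambda>y :: real^'n. \<Sum>i\<in>UNIV. y $ i *\<^sub>R e i"
  show fe: "?f y \<bullet> e j = y $ j" for y j by (simp add: inner_sum_left e if_distrib cong: if_cong)
  have lin: "linear ?f"
    by (rule linearI) (simp_all add: scaleR_left_distrib sum.distrib scaleR_sum_right)
  have "?f x \<bullet> ?f y = x \<bullet> y" for x y
  proof -
    have "?f x \<bullet> ?f y = (\<Sum>i\<in>UNIV. y $ i * (?f x \<bullet> e i))" by (simp only: inner_sum_right inner_scaleR_right)
    then show ?thesis by (simp only: fe) (simp add: inner_vec_def mult.commute)
  qed
  then show o: "orthogonal_transformation ?f" using lin by (simp add: orthogonal_transformation_def)
  obtain y where y: "x = ?f y" using orthogonal_transformation_surj[OF o] unfolding surj_def by blast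
  show "(\<Sum>i\<in>UNIV. (x \<bullet> e i) *\<^sub>R e i) = x" by (simp only: y fe)
qed

text \<open>The cone over such directions, cut off by the unit ball, lies in the rotated box with
  half-axes \<open>min 1 (c i)\<close>.\<close>

lemma cone_measure_box_le:
  fixes e :: "'n \<Rightarrow> real^'n"
  assumes e: "\<And>i j. e i \<bullet> e j = (if i = j then 1 else 0)" and c: "\<And>i. 0 \<le> c i"
  shows "emeasure cone_measure {u. \<forall>i. \<bar>u \<bullet> e i\<bar> \<le> c i} \<le> ennreal (\<Prod>i\<in>UNIV. 2 * min 1 (c i))"
proof -
  let ?E = "{u. \<forall>i. \<bar>u \<bullet> e i\<bar> \<le> c i}" let ?f = "\<lambda>y :: real^'n. \<Sum>i\<in>UNIV. y $ i *\<^sub>R e i"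
  define m :: "real^'n" where "m = (\<chi> i. min 1 (c i))"
  note f = orthonormal_family[OF e]
  have "closed ?E" by (intro closed_Collect_all closed_Collect_le continuous_intros)
  then have "emeasure cone_measure ?E = emeasure lborel {x \<in> cball 0 1. sgn x \<in> ?E}"
    by (intro emeasure_cone_measure borel_closed)
  also have "\<dots> \<le> emeasure lborel (?f ` cbox (- m) m)"
  proof (rule emeasure_mono)
    show "{x \<in> cball 0 1. sgn x \<in> ?E} \<subseteq> ?f ` cbox (- m) m"
    proof
      fix x assume x: "x \<in> {x \<in> cball 0 1. sgn x \<in> ?E}"
      have n1: "norm (e i) = 1" for i using e[of i i] by (simp add: norm_eq_sqrt_inner)
      have "\<bar>x \<bullet> e i\<bar> \<le> min 1 (c i)" for i
      proof -
        have "x = norm x *\<^sub>R sgn x" by (cases "x = 0") (simp_all add: sgn_div_norm)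
        then have "\<bar>x \<bullet> e i\<bar> = norm x * \<bar>sgn x \<bullet> e i\<bar>" by (metis abs_mult abs_norm_cancel inner_scaleR_left)
        also have "\<dots> \<le> 1 * c i" using x by (intro mult_mono) auto
        finally have "\<bar>x \<bullet> e i\<bar> \<le> c i" by simp
        moreover have "\<bar>x \<bullet> e i\<bar> \<le> 1" using Cauchy_Schwarz_ineq2[of x "e i"] x n1 by simp
        ultimately show ?thesis by simp
      qed
      then have 1: "(\<chi> i. x \<bullet> e i) \<in> cbox (- m) m" by (auto simp: mem_box_cart m_def abs_le_iff minus_le_iff)
      have 2: "x = ?f (\<chi> i. x \<bullet> e i)" using f(3) by simp
      show "x \<in> ?f ` cbox (- m) m" by (rule image_eqI[of x ?f "\<chi> i. x \<bullet> e i" "cbox (- m) m", OF 2 1])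
    qed
    have "compact (?f ` cbox (- m) m)"
      by (intro compact_continuous_image linear_continuous_on compact_cbox)
         (simp add: linear_linear orthogonal_transformation_linear[OF f(1)])
    then show "?f ` cbox (- m) m \<in> sets lborel" by (simp add: borel_compact)
  qed
  also have "\<dots> = emeasure lborel (cbox (- m) m)"
  proof (rule emeasure_lborel_orthogonal_image[OF f(1)])
    have "compact (?f ` cbox (- m) m)"
      by (intro compact_continuous_image linear_continuous_on compact_cbox)
         (simp add: linear_linear orthogonal_transformation_linear[OF f(1)])
    then show "?f ` cbox (- m) m \<in> sets borel" by (simp add: borel_compact)
  qed simp
  also have "\<dots> = ennreal (\<Prod>i\<in>UNIV. m $ i - (- m) $ i)"
  proof (rule emeasure_lborel_cbox_cart)
    fix i show "(- m) $ i \<le> m $ i" using c[of i] by (auto simp: m_def min_def)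
  qed
  also have "(\<Prod>i\<in>UNIV. m $ i - (- m) $ i) = (\<Prod>i\<in>UNIV. 2 * min 1 (c i))" by (simp add: m_def)
  finally show ?thesis .
qed

section \<open>Integral estimates\<close>

lemma dyadic_level:
  fixes x L :: real
  assumes "0 < x" "x \<le> L"
  obtains j :: nat where "L * (1/2) ^ Suc j < x" "x \<le> L * (1/2) ^ j"
proof -
  have "(\<lambda>j. L * (1/2) ^ Suc j) \<longlonglongrightarrow> L * 0"
    by (intro tendsto_mult tendsto_const LIMSEQ_Suc LIMSEQ_power_zero) simp
  then have "\<forall>\<^sub>F j in sequentially. L * (1/2) ^ Suc j < x"
    using assms by (intro order_tendstoD(2)) auto
  then have ex: "\<exists>j. L * (1/2) ^ Suc j < x" by (auto simp: eventually_sequentially)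
  define j where "j = (LEAST j. L * (1/2) ^ Suc j < x)"
  have 1: "L * (1/2) ^ Suc j < x" unfolding j_def using ex by (rule LeastI_ex)
  have "x \<le> L * (1/2) ^ j"
  proof (cases j)
    case 0 then show ?thesis using assms by simp
  next
    case (Suc k)
    then have "\<not> L * (1/2) ^ Suc k < x" unfolding j_def by (intro not_less_Least) (simp add: j_def)
    then show ?thesis using Suc by simp
  qed
  with 1 show ?thesis using that by blast
qed

text \<open>A weak bound of order \<open>T\<close> controls the integral of any higher power
  \<open>q\<close> of a function bounded by \<open>L\<close>: summing over dyadic levels below
  \<open>L\<close> gives a geometric series of ratio 2^(T-q).\<close>

lemma weak_type_integral:
  fixes g :: "'a \<Rightarrow> real"
  assumes g[measurable]: "g \<in> borel_measurable M" and gL: "\<And>x. x \<in> space M \<Longrightarrow> 0 < g x \<and> g x \<le> L"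
    and weak: "\<And>t. 0 < t \<Longrightarrow> emeasure M {x \<in> space M. t < g x} \<le> ennreal (A * t powr (- T))"
    and "0 \<le> A" "0 < L" "T < q" "0 \<le> q"
  shows "(\<integral>\<^sup>+x. ennreal (g x powr q) \<partial>M) \<le> ennreal (A * 2 powr T * L powr (q - T) / (1 - 2 powr (T - q)))"
proof -
  have lvl: "ennreal (g x powr q) \<le> (\<Sum>j. ennreal ((L * (1/2) ^ j) powr q) * indicator {x \<in> space M. L * (1/2) ^ Suc j < g x} x)"
    if x: "x \<in> space M" for x
  proof -
    obtain j :: nat where j: "L * (1/2) ^ Suc j < g x" "g x \<le> L * (1/2) ^ j" using dyadic_level gL[OF x] by metis
    have "ennreal (g x powr q) \<le> ennreal ((L * (1/2) ^ j) powr q)"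
      using gL[OF x] j \<open>0 \<le> q\<close> by (intro ennreal_leI powr_mono2) auto
    also have "\<dots> = ennreal ((L * (1/2) ^ j) powr q) * indicator {x \<in> space M. L * (1/2) ^ Suc j < g x} x"
      using j(1) x by simp
    also have "\<dots> \<le> (\<Sum>j. ennreal ((L * (1/2) ^ j) powr q) * indicator {x \<in> space M. L * (1/2) ^ Suc j < g x} x)"
    proof -
      have "F j \<le> suminf F" for F :: "nat \<Rightarrow> ennreal" using sum_le_suminf[of F "{j}"] by simp
      then show ?thesis .
    qed
    finally show ?thesis .
  qed
  let ?r = "2 powr (T - q)"
  have r: "0 < ?r" "?r < 1" using \<open>T < q\<close> by (auto simp: powr_less_one)
  \<comment> \<open>The level interval (L 2^(-j-1), L 2^(-j)] contributes its upper end to the power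
    q times the weak bound at its lower end; the offset of one level produces the factor
    2^T.\<close>
  have level_term: "(L * (1/2) ^ j) powr q * (A * (L * (1/2) ^ Suc j) powr (- T)) = A * 2 powr T * L powr (q - T) * ?r ^ j" for j
  proof -
    have pL: "0 < L * (1/2) ^ k" for k :: nat using \<open>0 < L\<close> by simp
    have l: "ln (L * (1/2) ^ k) = ln L - real k * ln 2" for k :: nat
      using \<open>0 < L\<close> by (simp add: ln_mult ln_realpow ln_div)
    have a: "(L * (1/2) ^ k) powr x = exp (x * (ln L - real k * ln 2))" for k x
      using pL[of k] \<open>0 < L\<close> by (simp only: powr_def l) simp
    have b: "?r ^ j = exp (real j * ((T - q) * ln 2))" by (simp add: powr_def exp_of_nat_mult)
    have "(L * (1/2) ^ j) powr q * (A * (L * (1/2) ^ Suc j) powr (- T)) =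
        A * exp (q * (ln L - real j * ln 2) + (- T) * (ln L - real (Suc j) * ln 2))"
      by (simp only: a exp_add) (simp only: mult_ac)
    also have "q * (ln L - real j * ln 2) + (- T) * (ln L - real (Suc j) * ln 2) =
        T * ln 2 + (q - T) * ln L + real j * ((T - q) * ln 2)"
      by (simp add: algebra_simps)
    also have "A * exp (T * ln 2 + (q - T) * ln L + real j * ((T - q) * ln 2)) = A * 2 powr T * L powr (q - T) * ?r ^ j"
      using \<open>0 < L\<close> by (simp only: b) (simp add: exp_add powr_def)
    finally show ?thesis .
  qed
  have "(\<integral>\<^sup>+x. ennreal (g x powr q) \<partial>M) \<le>
      (\<integral>\<^sup>+x. (\<Sum>j. ennreal ((L * (1/2) ^ j) powr q) * indicator {x \<in> space M. L * (1/2) ^ Suc j < g x} x) \<partial>M)"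
    using lvl by (intro nn_integral_mono) auto
  also have "\<dots> = (\<Sum>j. \<integral>\<^sup>+x. ennreal ((L * (1/2) ^ j) powr q) * indicator {x \<in> space M. L * (1/2) ^ Suc j < g x} x \<partial>M)"
    by (intro nn_integral_suminf) measurable
  also have "\<dots> = (\<Sum>j. ennreal ((L * (1/2) ^ j) powr q) * emeasure M {x \<in> space M. L * (1/2) ^ Suc j < g x})"
    by (subst nn_integral_cmult_indicator) auto
  also have "\<dots> \<le> (\<Sum>j. ennreal ((L * (1/2) ^ j) powr q) * ennreal (A * (L * (1/2) ^ Suc j) powr (- T)))"
    using \<open>0 < L\<close> by (intro suminf_le mult_left_mono weak) auto
  also have "\<dots> = (\<Sum>j. ennreal (A * 2 powr T * L powr (q - T) * ?r ^ j))"
  proof -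
    have "ennreal ((L * (1/2) ^ j) powr q) * ennreal (A * (L * (1/2) ^ Suc j) powr (- T)) =
        ennreal (A * 2 powr T * L powr (q - T) * ?r ^ j)" for j
      unfolding level_term[symmetric] using \<open>0 \<le> A\<close> by (intro ennreal_mult[symmetric]) auto
    then show ?thesis by (simp only:)
  qed
  also have "\<dots> = ennreal (A * 2 powr T * L powr (q - T) * (1 / (1 - ?r)))"
    using r \<open>0 \<le> A\<close> by (intro suminf_ennreal_eq sums_mult geometric_sums) auto
  finally show ?thesis by simp
qed

text \<open>Interpolates between the bounds 1 and x; the exponent is the freedom exploited in
  \<open>box_integral_estimate\<close>.\<close>

lemma min_one_le_powr: "0 < x \<Longrightarrow> 0 \<le> a \<Longrightarrow> a \<le> 1 \<Longrightarrow> min 1 x \<le> x powr a" for x a :: real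
  using powr_mono'[of a 1 x] by (cases "1 \<le> x") (auto simp: ge_one_powr_ge_zero)

text \<open>The points g(u) u lie in the box with axes \<open>e\<close> and half-axes
  \<open>b\<close>. It is used for the radial function of a Wulff shape and for the reciprocal 1 / k
  of an admissible function, which plays the part of the polar body.\<close>

definition box_bounded :: "('n \<Rightarrow> real^'n) \<Rightarrow> ('n \<Rightarrow> real) \<Rightarrow> (real^'n \<Rightarrow> real) \<Rightarrow> bool" where
  "box_bounded e b g \<longleftrightarrow> (\<forall>i j. e i \<bullet> e j = (if i = j then 1 else 0)) \<and> (\<forall>i. 0 < b i) \<and>
    continuous_on unit_sphere g \<and> (\<forall>u\<in>unit_sphere. 0 < g u) \<and> (\<forall>u\<in>unit_sphere. \<forall>i. g u * \<bar>u \<bullet> e i\<bar> \<le> b i)"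

text \<open>The L^r norm of a positive function for the unnormalised measure.\<close>

definition sphere_mean :: "real \<Rightarrow> (real^'n \<Rightarrow> real) \<Rightarrow> real" where
  "sphere_mean r g = (\<integral>u. g u powr r \<partial>sphere_measure) powr (1 / r)"

text \<open>Where g exceeds t, all coordinates satisfy |u . e i| <= b i / t, so
  \<open>cone_measure_box_le\<close> yields a weak bound. The exponents \<open>\<tau>\<close>
  distribute its order \<open>T\<close> over the axes other than the longest one, and different
  distributions serve the body and the polar body.\<close>

lemma box_integral_estimate:
  assumes n: "CARD('n) \<ge> 2" and q: "0 \<le> T" "T < q"
  shows "\<exists>C>0. \<forall>(e :: 'n \<Rightarrow> real^'n) b g m \<tau>. box_bounded e b g \<longrightarrow> (\<forall>i. b i \<le> b m) \<longrightarrow>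
    (\<forall>i. 0 \<le> \<tau> i \<and> \<tau> i \<le> 1) \<longrightarrow> (\<Sum>i\<in>UNIV - {m}. \<tau> i) = T \<longrightarrow>
    (\<integral>u. g u powr q \<partial>sphere_measure) \<le> C * (b m powr (q - T) * (\<Prod>i\<in>UNIV - {m}. b i powr \<tau> i))"
proof -
  let ?n = "CARD('n)"
  obtain c where c: "c > 0"
    "\<And>E. E \<in> sets borel_sphere \<Longrightarrow> emeasure sphere_measure (E :: (real^'n) set) \<le> ennreal c * emeasure cone_measure E"
    by (rule sphere_measure_le_cone_measure[OF n]) blast
  define C where "C = c * 2 ^ ?n * 2 powr T * real ?n powr (q - T) / (1 - 2 powr (T - q))"
  have r: "2 powr (T - q) < 1" using q by (auto simp: powr_less_one)
  then have "C > 0" unfolding C_def using c(1) n by (intro divide_pos_pos mult_pos_pos) auto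
  moreover have "(\<integral>u. g u powr q \<partial>sphere_measure) \<le> C * (b m powr (q - T) * (\<Prod>i\<in>UNIV - {m}. b i powr \<tau> i))"
    if bb: "box_bounded e b g" and m: "\<forall>i. b i \<le> b m"
      and \<tau>: "\<forall>i. 0 \<le> \<tau> i \<and> \<tau> i \<le> 1" "(\<Sum>i\<in>UNIV - {m}. \<tau> i) = T"
    for e :: "'n \<Rightarrow> real^'n" and b g m \<tau>
  proof -
    have e: "\<forall>i j. e i \<bullet> e j = (if i = j then 1 else 0)" and b: "\<forall>i. 0 < b i" and g: "continuous_on unit_sphere g"
      "\<forall>u\<in>unit_sphere. 0 < g u" "\<forall>u\<in>unit_sphere. \<forall>i. g u * \<bar>u \<bullet> e i\<bar> \<le> b i"
      using bb unfolding box_bounded_def by blast+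
    define B where "B = (\<Prod>i\<in>UNIV - {m}. b i powr \<tau> i)"
    have bp: "0 < b i" for i using b by simp
    have bn: "b i \<noteq> 0" for i using bp[of i] by simp
    have B: "0 < B" unfolding B_def by (intro prod_pos) (simp add: bn)
    let ?L = "real ?n * b m"
    have L: "0 < ?L" using b by simp
    \<comment> \<open>Every unit vector has l1 norm at least 1 in the frame, so the longest
      half-axis bounds \<open>g\<close> up to the factor n.\<close>
    have gL: "0 < g u \<and> g u \<le> ?L" if "u \<in> space sphere_measure" for u
    proof -
      have u: "u \<in> unit_sphere" using that by simp
      have n1: "norm (e i) = 1" for i using e by (simp add: norm_eq_sqrt_inner)
      have "1 = norm (\<Sum>i\<in>UNIV. (u \<bullet> e i) *\<^sub>R e i)" using orthonormal_family(3)[of e u] e u by simp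
      also have "\<dots> \<le> (\<Sum>i\<in>UNIV. \<bar>u \<bullet> e i\<bar>)" by (rule order_trans[OF norm_sum]) (simp add: n1)
      finally have "g u * 1 \<le> g u * (\<Sum>i\<in>UNIV. \<bar>u \<bullet> e i\<bar>)" using g(2) u by (intro mult_left_mono) (auto intro: less_imp_le)
      also have "\<dots> = (\<Sum>i\<in>UNIV. g u * \<bar>u \<bullet> e i\<bar>)" by (rule sum_distrib_left)
      also have "\<dots> \<le> (\<Sum>i\<in>(UNIV::'n set). b m)" using g(3) m u by (intro sum_mono) (meson order_trans)
      finally show ?thesis using g(2) u by simp
    qed
    have gm: "g \<in> borel_measurable sphere_measure" using g(1) by (rule continuous_imp_borel_sphere) simp
    have weak: "emeasure sphere_measure {u \<in> space sphere_measure. t < g u} \<le> ennreal (c * 2 ^ ?n * B * t powr (- T))"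
      if t: "0 < t" for t
    proof -
      let ?E = "{u \<in> space sphere_measure. t < g u}" let ?X = "{u. \<forall>i. \<bar>u \<bullet> e i\<bar> \<le> b i / t}"
      have "?E \<in> sets sphere_measure" using gm by measurable
      then have E: "?E \<in> sets borel_sphere" by (simp only: sets_sphere_measure)
      have cX: "closed ?X" by (intro closed_Collect_all closed_Collect_le continuous_intros)
      have "?E \<subseteq> ?X"
      proof clarify
        fix u i assume u: "u \<in> space sphere_measure" "t < g u"
        have "t * \<bar>u \<bullet> e i\<bar> \<le> g u * \<bar>u \<bullet> e i\<bar>" using u by (intro mult_right_mono) auto
        also have "\<dots> \<le> b i" using g(3) u by simp
        finally show "\<bar>u \<bullet> e i\<bar> \<le> b i / t" using t by (simp add: field_simps)
      qed
      then have "emeasure cone_measure ?E \<le> emeasure cone_measure ?X"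
        using cX by (intro emeasure_mono) (auto intro: borel_closed)
      also have "\<dots> \<le> ennreal (\<Prod>i\<in>UNIV. 2 * min 1 (b i / t))"
        using e b t by (intro cone_measure_box_le) (auto intro: less_imp_le)
      also have "\<dots> \<le> ennreal (2 ^ ?n * (B * t powr (- T)))"
      proof (rule ennreal_leI)
        have "(\<Prod>i\<in>UNIV. 2 * min 1 (b i / t)) = 2 ^ ?n * (\<Prod>i\<in>UNIV. min 1 (b i / t))"
          by (simp add: prod.distrib)
        also have "(\<Prod>i\<in>UNIV. min 1 (b i / t)) = min 1 (b m / t) * (\<Prod>i\<in>UNIV - {m}. min 1 (b i / t))"
          by (rule prod.remove) auto
        \<comment> \<open>The longest axis contributes only 1; each other axis contributes order
          \<open>\<tau> i\<close> in 1 / t, in total \<open>T\<close>.\<close>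
        also have "\<dots> \<le> 1 * (\<Prod>i\<in>UNIV - {m}. (b i / t) powr \<tau> i)"
          using b t \<tau> by (intro mult_mono prod_mono prod_nonneg conjI min_one_le_powr) (auto intro: less_imp_le)
        also have "1 * (\<Prod>i\<in>UNIV - {m}. (b i / t) powr \<tau> i) = (\<Prod>i\<in>UNIV - {m}. b i powr \<tau> i * t powr (- \<tau> i))"
          unfolding mult_1 using b t by (intro prod.cong) (auto simp: powr_divide powr_minus_divide less_imp_le)
        also have "\<dots> = B * t powr (- T)"
          using t by (simp add: B_def prod.distrib \<tau>(2)[symmetric] powr_sum flip: sum_negf)
        finally show "(\<Prod>i\<in>UNIV. 2 * min 1 (b i / t)) \<le> 2 ^ ?n * (B * t powr (- T))" by simp
      qed
      finally have "ennreal c * emeasure cone_measure ?E \<le> ennreal c * ennreal (2 ^ ?n * (B * t powr (- T)))"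
        by (intro mult_left_mono) auto
      also have "\<dots> = ennreal (c * 2 ^ ?n * B * t powr (- T))"
        using c(1) B by (simp add: mult.assoc flip: ennreal_mult)
      finally show ?thesis using c(2)[OF E] order_trans by blast
    qed
    have "(\<integral>\<^sup>+u. ennreal (g u powr q) \<partial>sphere_measure) \<le>
        ennreal (c * 2 ^ ?n * B * 2 powr T * ?L powr (q - T) / (1 - 2 powr (T - q)))"
      using c(1) B L q by (intro weak_type_integral[OF gm gL weak]) auto
    also have "c * 2 ^ ?n * B * 2 powr T * ?L powr (q - T) / (1 - 2 powr (T - q)) = C * (b m powr (q - T) * B)"
      using b by (simp add: C_def powr_mult less_imp_le)
    finally have le: "(\<integral>\<^sup>+u. ennreal (g u powr q) \<partial>sphere_measure) \<le> ennreal (C * (b m powr (q - T) * B))" .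
    have cg: "continuous_on unit_sphere (\<lambda>u. g u powr q)"
      using g(2) by (intro continuous_on_powr g(1) continuous_on_const) force
    have "(\<integral>\<^sup>+u. ennreal (g u powr q) \<partial>sphere_measure) = ennreal (\<integral>u. g u powr q \<partial>sphere_measure)"
      by (intro nn_integral_eq_integral continuous_integrable_sphere[OF cg sets_sphere_measure finite_sphere_measure[OF n]]) auto
    with le show ?thesis using \<open>C > 0\<close> B b by (simp add: ennreal_le_iff B_def[symmetric] less_imp_le)
  qed
  ultimately show ?thesis by (intro exI[of _ C]) blast
qed

lemma exists_extremal_indices:
  fixes b :: "'n::finite \<Rightarrow> real"
  assumes n: "CARD('n) \<ge> 2"
  obtains m l where "m \<noteq> l" "\<And>i. b i \<le> b m" "\<And>i. b l \<le> b i"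
proof -
  have "Max (range b) \<in> range b" by (intro Max_in) auto
  then obtain m where "Max (range b) = b m" by blast
  then have m: "b i \<le> b m" for i using Max_ge[of "range b" "b i"] by simp
  have ne: "UNIV - {m} \<noteq> {}"
  proof
    assume "UNIV - {m} = {}"
    then have "UNIV = {m}" by auto
    then have "CARD('n) = card {m}" by (rule arg_cong)
    then show False using n by simp
  qed
  \<comment> \<open>The minimum is taken off \<open>m\<close> so that the indices differ even when
    \<open>b\<close> is constant.\<close>
  then have "Min (b ` (UNIV - {m})) \<in> b ` (UNIV - {m})" by (intro Min_in) auto
  then obtain l where l: "l \<noteq> m" "Min (b ` (UNIV - {m})) = b l" by auto
  have "b l \<le> b i" for i
  proof (cases "i = m")
    case True then show ?thesis using m by simp
  next
    case False then show ?thesis unfolding l(2)[symmetric] by (intro Min_le) auto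
  qed
  then show ?thesis using that l(1) m by metis
qed

text \<open>
  With \<open>\<delta> = 0\<close> this is the critical, scale invariant case; for \<open>\<delta> > 0\<close> the product
  decays with the eccentricity of the box.
\<close>

lemma product_estimate:
  assumes n: "CARD('n) \<ge> 2" and R: "real CARD('n) - 1 < R" and Q: "1 < Q" "Q \<le> real CARD('n)"
    and \<delta>: "\<delta> = 1 / Q - 1 + (real CARD('n) - 1) / R" "0 \<le> \<delta>" and D: "0 < D"
  shows "\<exists>C>0. \<forall>(e :: 'n \<Rightarrow> real^'n) b g1 g2 i j. box_bounded e b g1 \<longrightarrow> box_bounded e (\<lambda>i. D / b i) g2 \<longrightarrow>
    sphere_mean R g1 * sphere_mean Q g2 \<le> C * (b i / b j) powr (\<delta> / (real CARD('n) - 1))"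
proof -
  let ?n = "real CARD('n)"
  have n1: "?n - 1 > 0" using n by simp
  \<comment> \<open>Chosen so that Q = 1 + (n-1) \<theta>. The first integral then carries each axis
    other than \<open>m\<close> with exponent 1, the second each of them with the common exponent
    -\<theta>, so both depend on these axes through the single sum \<open>S\<close>.\<close>
  define \<theta> where "\<theta> = (Q - 1) / (?n - 1)"
  have \<theta>: "0 < \<theta>" "\<theta> \<le> 1" "Q = 1 + (?n - 1) * \<theta>" using Q n1 by (auto simp: \<theta>_def)
  have R0: "R > 0" and Q0: "Q > 0" using R n1 Q by auto
  obtain C1 where C1: "C1 > 0" and est1: "\<forall>(e :: 'n \<Rightarrow> real^'n) b g m \<tau>. box_bounded e b g \<longrightarrow> (\<forall>i. b i \<le> b m) \<longrightarrow>
    (\<forall>i. 0 \<le> \<tau> i \<and> \<tau> i \<le> 1) \<longrightarrow> (\<Sum>i\<in>UNIV - {m}. \<tau> i) = ?n - 1 \<longrightarrow>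
    (\<integral>u. g u powr R \<partial>sphere_measure) \<le> C1 * (b m powr (R - (?n - 1)) * (\<Prod>i\<in>UNIV - {m}. b i powr \<tau> i))"
    using box_integral_estimate[where 'n = 'n, OF n, of "?n - 1" R] n1 R by auto
  have QT: "0 \<le> Q - \<theta>" "Q - \<theta> < Q" using \<theta> Q by auto
  obtain C2 where C2: "C2 > 0" and est2: "\<forall>(e :: 'n \<Rightarrow> real^'n) b g m \<tau>. box_bounded e b g \<longrightarrow> (\<forall>i. b i \<le> b m) \<longrightarrow>
    (\<forall>i. 0 \<le> \<tau> i \<and> \<tau> i \<le> 1) \<longrightarrow> (\<Sum>i\<in>UNIV - {m}. \<tau> i) = Q - \<theta> \<longrightarrow>
    (\<integral>u. g u powr Q \<partial>sphere_measure) \<le> C2 * (b m powr (Q - (Q - \<theta>)) * (\<Prod>i\<in>UNIV - {m}. b i powr \<tau> i))"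
    using box_integral_estimate[where 'n = 'n, OF n QT] by blast
  define C where "C = C1 powr (1 / R) * (C2 powr (1 / Q) * D)"
  have "C > 0" unfolding C_def using C1 C2 D by simp
  moreover have "sphere_mean R g1 * sphere_mean Q g2 \<le> C * (b i / b j) powr (\<delta> / (?n - 1))"
    if g1: "box_bounded e b g1" and g2: "box_bounded e (\<lambda>i. D / b i) g2"
    for e :: "'n \<Rightarrow> real^'n" and b g1 g2 i j
  proof -
    let ?J1 = "\<integral>u. g1 u powr R \<partial>sphere_measure" let ?J2 = "\<integral>u. g2 u powr Q \<partial>sphere_measure"
    obtain m l where ml: "m \<noteq> l" "\<And>i. b i \<le> b m" "\<And>i. b l \<le> b i" by (rule exists_extremal_indices[OF n, of b]) blast
    define S where "S = (\<Sum>i\<in>UNIV - {m}. ln (b i))"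
    have bp: "0 < b i" for i using g1 by (simp add: box_bounded_def)
    have bn: "b i \<noteq> 0" for i using bp[of i] by simp
    have "(\<Sum>i\<in>UNIV - {m}. 1) = ?n - 1" using n by (simp add: card_Diff_singleton of_nat_diff)
    then have "?J1 \<le> C1 * (b m powr (R - (?n - 1)) * (\<Prod>i\<in>UNIV - {m}. b i powr 1))"
      using est1[rule_format, of e b g1 m "\<lambda>_. 1"] g1 ml(2) by auto
    also have "(\<Prod>i\<in>UNIV - {m}. b i powr 1) = exp S"
    proof -
      have "(\<Prod>i\<in>UNIV - {m}. b i powr 1) = (\<Prod>i\<in>UNIV - {m}. exp (ln (b i)))" using bp by (intro prod.cong) (auto simp: less_imp_le)
      then show ?thesis by (simp add: S_def exp_sum)
    qed
    also have "b m powr (R - (?n - 1)) * exp S = exp ((R - (?n - 1)) * ln (b m) + S)"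
      using bp[of m] by (simp add: powr_def exp_add)
    finally have J1: "?J1 \<le> C1 * exp ((R - (?n - 1)) * ln (b m) + S)" .
    \<comment> \<open>In the polar box the longest axis is \<open>l\<close>. Weight 1 on
      \<open>m\<close> and \<theta> on the others except \<open>l\<close> add up to Q - \<theta>,
      which leaves the power \<theta> for the axis \<open>l\<close> and restores the symmetry among
      all axes other than \<open>m\<close>.\<close>
    define \<tau> where "\<tau> i = (if i = m then 1 else \<theta>)" for i
    have split: "(\<Sum>i\<in>UNIV - {l}. \<tau> i * h i) = h m + \<theta> * (\<Sum>i\<in>UNIV - {m}. h i) - \<theta> * h l" for h :: "'n \<Rightarrow> real"
    proof -
      have "(\<Sum>i\<in>UNIV - {l}. \<tau> i * h i) = (\<Sum>i\<in>UNIV. \<tau> i * h i) - \<tau> l * h l"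
        by (simp add: sum_diff1)
      also have "(\<Sum>i\<in>UNIV. \<tau> i * h i) = \<tau> m * h m + (\<Sum>i\<in>UNIV - {m}. \<tau> i * h i)"
        by (rule sum.remove) auto
      also have "(\<Sum>i\<in>UNIV - {m}. \<tau> i * h i) = (\<Sum>i\<in>UNIV - {m}. \<theta> * h i)"
        by (intro sum.cong) (auto simp: \<tau>_def)
      finally show ?thesis using ml(1) by (simp add: \<tau>_def sum_distrib_left)
    qed
    have "(\<Sum>i\<in>UNIV - {l}. \<tau> i) = Q - \<theta>"
      using split[of "\<lambda>_. 1"] \<theta>(3) n by (simp add: card_Diff_singleton of_nat_diff algebra_simps)
    then have "?J2 \<le> C2 * ((D / b l) powr (Q - (Q - \<theta>)) * (\<Prod>i\<in>UNIV - {l}. (D / b i) powr \<tau> i))"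
      using est2[rule_format, of e "\<lambda>i. D / b i" g2 l \<tau>] g2 bp ml(3) D \<theta> by (auto simp: \<tau>_def frac_le)
    also have "(\<Prod>i\<in>UNIV - {l}. (D / b i) powr \<tau> i) = exp (\<Sum>i\<in>UNIV - {l}. \<tau> i * ln (D / b i))"
    proof -
      have "(D / b i) powr \<tau> i = exp (\<tau> i * ln (D / b i))" for i using bp[of i] D by (simp add: powr_def)
      then show ?thesis by (simp add: exp_sum)
    qed
    also have "(\<Sum>i\<in>UNIV - {l}. \<tau> i * ln (D / b i)) = (Q - \<theta>) * ln D - (ln (b m) + \<theta> * S - \<theta> * ln (b l))"
    proof -
      have "(\<Sum>i\<in>UNIV - {l}. \<tau> i * ln (D / b i)) = (\<Sum>i\<in>UNIV - {l}. \<tau> i * ln D) - (\<Sum>i\<in>UNIV - {l}. \<tau> i * ln (b i))"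
        using D by (simp add: bn ln_div right_diff_distrib flip: sum_subtractf)
      also have "(\<Sum>i\<in>UNIV - {l}. \<tau> i * ln D) = (Q - \<theta>) * ln D"
        using \<open>(\<Sum>i\<in>UNIV - {l}. \<tau> i) = Q - \<theta>\<close> by (simp flip: sum_distrib_right)
      finally show ?thesis by (simp add: split S_def)
    qed
    also have "(D / b l) powr (Q - (Q - \<theta>)) * exp ((Q - \<theta>) * ln D - (ln (b m) + \<theta> * S - \<theta> * ln (b l))) =
        exp (Q * ln D - ln (b m) - \<theta> * S)"
      using bp[of l] D by (simp add: powr_def ln_div algebra_simps flip: exp_add)
    finally have J2: "?J2 \<le> C2 * exp (Q * ln D - ln (b m) - \<theta> * S)" .
    have J0: "0 \<le> ?J1" "0 \<le> ?J2" by (simp_all add: integral_nonneg_AE)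
    have pw: "(c * exp x) powr (1 / y) = c powr (1 / y) * exp (x / y)" if "0 < c" for c x y :: real
      using that by (simp add: powr_mult powr_def[of "exp _"])
    have "?J1 powr (1 / R) * ?J2 powr (1 / Q) \<le>
        (C1 * exp ((R - (?n - 1)) * ln (b m) + S)) powr (1 / R) * (C2 * exp (Q * ln D - ln (b m) - \<theta> * S)) powr (1 / Q)"
      using J0 J1 J2 R0 Q0 by (intro mult_mono powr_mono2) auto
    also have "\<dots> = C1 powr (1 / R) * C2 powr (1 / Q) *
        exp (((R - (?n - 1)) * ln (b m) + S) / R + (Q * ln D - ln (b m) - \<theta> * S) / Q)"
      unfolding pw[OF C1] pw[OF C2] by (simp add: exp_add)
    \<comment> \<open>By the choice of \<theta> the coefficients of \<open>S\<close> and of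
      \<open>ln (b m)\<close> are both governed by \<delta>; for \<delta> = 0 the half-axes cancel
      altogether.\<close>
    also have "((R - (?n - 1)) * ln (b m) + S) / R + (Q * ln D - ln (b m) - \<theta> * S) / Q =
        ln D + \<delta> / (?n - 1) * (S - (?n - 1) * ln (b m))"
    proof -
      have "\<theta> / Q = (1 - 1 / Q) / (?n - 1)" using Q0 n1 by (simp add: \<theta>_def field_simps)
      then have "1 / R - \<theta> / Q = \<delta> / (?n - 1)"
      proof -
        have "\<delta> / (?n - 1) = (1 / Q - 1) / (?n - 1) + ((?n - 1) / R) / (?n - 1)"
          unfolding \<delta>(1) by (rule add_divide_distrib)
        moreover have "((?n - 1) / R) / (?n - 1) = 1 / R" using n1 by simp
        moreover have "(1 / Q - 1) / (?n - 1) = - ((1 - 1 / Q) / (?n - 1))" by (simp add: diff_divide_distrib)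
        ultimately show ?thesis using \<open>\<theta> / Q = (1 - 1 / Q) / (?n - 1)\<close> by linarith
      qed
      then have S: "S / R - \<theta> * S / Q = \<delta> / (?n - 1) * S" by (metis left_diff_distrib mult.commute times_divide_eq_right times_divide_eq_left mult_1)
      have m: "(R - (?n - 1)) * ln (b m) / R - ln (b m) / Q = - \<delta> * ln (b m)"
        unfolding \<delta>(1) using R0 Q0 by (simp add: field_simps)
      have "((R - (?n - 1)) * ln (b m) + S) / R + (Q * ln D - ln (b m) - \<theta> * S) / Q =
          ((R - (?n - 1)) * ln (b m) / R - ln (b m) / Q) + (S / R - \<theta> * S / Q) + ln D"
        using Q0 by (simp add: add_divide_distrib diff_divide_distrib)
      also have "\<dots> = - \<delta> * ln (b m) + \<delta> / (?n - 1) * S + ln D" by (simp only: S m)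
      also have "\<dots> = ln D + \<delta> / (?n - 1) * (S - (?n - 1) * ln (b m))"
        using n1 by (simp add: right_diff_distrib)
      finally show ?thesis .
    qed
    also have "C1 powr (1 / R) * C2 powr (1 / Q) * exp (ln D + \<delta> / (?n - 1) * (S - (?n - 1) * ln (b m))) =
        C * exp (\<delta> / (?n - 1) * (S - (?n - 1) * ln (b m)))"
      using D by (simp add: C_def exp_add)
    also have "\<dots> \<le> C * exp (\<delta> / (?n - 1) * ln (b i / b j))"
    proof -
      \<comment> \<open>All summands are non-positive, so only the shortest axis is kept; its ratio
        to the longest is at most any \<open>b i / b j\<close>.\<close>
      have "S - (?n - 1) * ln (b m) = (\<Sum>i\<in>UNIV - {m}. ln (b i) - ln (b m))"
        using n by (simp add: S_def sum_subtractf card_Diff_singleton of_nat_diff)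
      also have "\<dots> = (ln (b l) - ln (b m)) + (\<Sum>i\<in>UNIV - {m} - {l}. ln (b i) - ln (b m))"
        using ml(1) by (intro sum.remove) auto
      also have "(\<Sum>i\<in>UNIV - {m} - {l}. ln (b i) - ln (b m)) \<le> 0"
        using ml(2) bp by (intro sum_nonpos) simp
      finally have "S - (?n - 1) * ln (b m) \<le> ln (b l) - ln (b m)" by simp
      also have "\<dots> \<le> ln (b i) - ln (b j)" using ml(2,3) bp by (intro diff_mono) simp_all
      finally have "S - (?n - 1) * ln (b m) \<le> ln (b i / b j)" using bp bn by (simp add: ln_div)
      then show ?thesis using \<open>C > 0\<close> \<delta>(2) n1 by (intro mult_left_mono iffD2[OF exp_le_cancel_iff]) (auto intro: divide_nonneg_pos)
    qed
    also have "exp (\<delta> / (?n - 1) * ln (b i / b j)) = (b i / b j) powr (\<delta> / (?n - 1))"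
      using bp[of i] bp[of j] by (simp add: powr_def)
    finally show ?thesis unfolding sphere_mean_def .
  qed
  ultimately show ?thesis by (intro exI[of _ C]) blast
qed

section \<open>The variational problem\<close>

context positive_on_sphere
begin

lemma gauge_nonneg: "0 \<le> wulff_gauge h x"
  using gauge_pos[of x] gauge_scaleR[of 0 x] by (cases "x = 0") auto

lemma gauge_antimono:
  assumes k: "\<And>v. v \<in> unit_sphere \<Longrightarrow> h v \<le> k v" and "positive_on_sphere k"
  shows "wulff_gauge k x \<le> wulff_gauge h x"
proof (rule positive_on_sphere.gauge_least[OF assms(2)])
  fix v :: "real^'n" assume v: "v \<in> unit_sphere"
  have "x \<bullet> v \<le> wulff_gauge h x * h v" using v by (rule gauge_upper')
  also have "\<dots> \<le> wulff_gauge h x * k v" using k[OF v] gauge_nonneg by (intro mult_left_mono)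
  finally show "x \<bullet> v \<le> wulff_gauge h x * k v" .
qed

lemma radial_mono:
  assumes k: "\<And>v. v \<in> unit_sphere \<Longrightarrow> h v \<le> k v" and "positive_on_sphere k" and "x \<noteq> 0"
  shows "radial_fun (wulff h) x \<le> radial_fun (wulff k) x"
  using gauge_antimono[OF k assms(2), of x] positive_on_sphere.gauge_pos[OF assms(2,3)] gauge_pos[OF assms(3)]
  by (simp add: radial_fun_wulff assms positive_on_sphere.radial_fun_wulff[OF assms(2)] frac_le)

lemma positive_scale: "0 < c \<Longrightarrow> positive_on_sphere (\<lambda>v. c * h v)"
  by unfold_locales (auto intro!: continuous_intros cont mult_pos_pos pos)

lemma gauge_scale: assumes c: "0 < c" shows "wulff_gauge (\<lambda>v. c * h v) x = wulff_gauge h x / c"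
proof (rule antisym)
  interpret s: positive_on_sphere "\<lambda>v. c * h v" using c by (rule positive_scale)
  show "wulff_gauge (\<lambda>v. c * h v) x \<le> wulff_gauge h x / c"
    by (rule s.gauge_least) (use c gauge_upper' in simp)
  have "wulff_gauge h x \<le> c * wulff_gauge (\<lambda>v. c * h v) x"
    by (rule gauge_least) (use s.gauge_upper' in \<open>simp add: mult_ac\<close>)
  then show "wulff_gauge h x / c \<le> wulff_gauge (\<lambda>v. c * h v) x" using c by (simp add: pos_divide_le_eq mult.commute)
qed

lemma radial_scale: assumes c: "0 < c" "x \<noteq> 0"
  shows "radial_fun (wulff (\<lambda>v. c * h v)) x = c * radial_fun (wulff h) x"
  using positive_on_sphere.radial_fun_wulff[OF positive_scale[OF c(1)] c(2)] c
  by (simp add: radial_fun_wulff gauge_scale)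

lemma continuous_radial_powr: "continuous_on unit_sphere (\<lambda>u. radial_fun (wulff h) u powr q)"
proof (intro continuous_on_powr radial_continuous continuous_on_const ballI)
  fix u :: "real^'n" assume "u \<in> unit_sphere"
  then have "u \<noteq> 0" by auto
  then show "radial_fun (wulff h) u \<noteq> 0" using radial_pos[of u] by simp
qed

lemma continuous_powr: "continuous_on unit_sphere (\<lambda>v. h v powr q)"
  by (intro continuous_on_powr cont continuous_on_const ballI nonzero)

end

lemma integral_ge_const_on_sphere:
  fixes f :: "real^'n \<Rightarrow> real"
  assumes M: "sets M = sets borel_sphere" "finite_measure M" and f: "continuous_on unit_sphere f"
    and c: "\<And>u. u \<in> unit_sphere \<Longrightarrow> c \<le> f u"
  shows "c * measure M unit_sphere \<le> (\<integral>u. f u \<partial>M)"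
proof -
  interpret finite_measure M by fact
  have sp: "space M = unit_sphere" using sets_eq_imp_space_eq[OF M(1)] by (simp add: space_borel_sphere)
  have "(\<integral>u. c \<partial>M) \<le> (\<integral>u. f u \<partial>M)"
    using c by (intro integral_mono continuous_integrable_sphere[OF f M]) (auto simp: sp)
  then show ?thesis by (simp add: sp mult.commute)
qed

text \<open>\<open>P\<close> stands for -p and \<open>w\<close> for the power n - q of the radial
  function of \<open>Q\<close>. That the sphere has positive measure is an assumption of the locale;
  the theorem derives it from the density of a non-zero \<open>\<mu>\<close>.\<close>

locale dual_minkowski =
  fixes G :: "(real^'n^'n) set" and w :: "real^'n \<Rightarrow> real" and M :: "(real^'n) measure" and q P :: real
  assumes n: "CARD('n) \<ge> 2" and q: "0 < q" and P: "0 < P"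
    and G: "subgroup G orthogonal_group" "closed G" and fix0: "(\<And>g. g \<in> G \<Longrightarrow> g *v x = x) \<Longrightarrow> x = 0"
    and w: "continuous_on unit_sphere w" and w_pos: "u \<in> unit_sphere \<Longrightarrow> 0 < w u"
    and w_inv: "g \<in> G \<Longrightarrow> u \<in> unit_sphere \<Longrightarrow> w (g *v u) = w u"
    and M: "sets M = sets borel_sphere" "finite_measure M" and M_pos: "emeasure M unit_sphere \<noteq> 0"
    and M_inv: "invariant_measure G M"
    and sphere_pos: "emeasure (sphere_measure :: (real^'n) measure) unit_sphere \<noteq> 0"
begin

lemmas grp = subgroup_orthogonal_group[OF G(1)]

text \<open>Support functions are not singled out, so that \<open>perturb\<close> with an invariant
  \<open>\<phi>\<close> never leaves the class.\<close>

definition admissible :: "(real^'n \<Rightarrow> real) \<Rightarrow> bool" where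
  "admissible h \<longleftrightarrow> positive_on_sphere h \<and> (\<forall>g\<in>G. \<forall>v\<in>unit_sphere. h (g *v v) = h v)"

text \<open>Without the factor 1 / n: it is n times the total mass of the dual curvature measure,
  which explains the n in the later normalisation.\<close>

definition dual_volume :: "(real^'n \<Rightarrow> real) \<Rightarrow> real" where
  "dual_volume h = (\<integral>u. radial_fun (wulff h) u powr q * w u \<partial>sphere_measure)"

definition polar_mean :: "(real^'n \<Rightarrow> real) \<Rightarrow> real" where
  "polar_mean h = (\<integral>v. h v powr (- P) \<partial>M)"

definition functional :: "(real^'n \<Rightarrow> real) \<Rightarrow> real" where
  "functional h = dual_volume h powr (1 / q) * polar_mean h powr (1 / P)"

lemma admissibleD: "admissible h \<Longrightarrow> positive_on_sphere h"
  by (simp add: admissible_def)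

lemma mult_sphere: "g \<in> G \<Longrightarrow> v \<in> unit_sphere \<Longrightarrow> g *v v \<in> unit_sphere"
  using orthogonal_matrix_mem_sphere[OF grp(2)] by blast

lemma inner_move: "g \<in> G \<Longrightarrow> (g *v x) \<bullet> v = x \<bullet> (transpose g *v v)"
  using inner_orthogonal_matrix_mult[OF grp(2), of g x "transpose g *v v"] orthogonal_matrix_transpose_mult(1)[OF grp(2), of g v]
  by simp

lemma invariant_transpose: "admissible h \<Longrightarrow> g \<in> G \<Longrightarrow> v \<in> unit_sphere \<Longrightarrow> h (transpose g *v v) = h v"
  unfolding admissible_def using grp(4) by blast

lemma wulff_invariant: assumes h: "admissible h" and g: "g \<in> G" and x: "x \<in> wulff h"
  shows "g *v x \<in> wulff h"
  unfolding wulff_def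
proof clarify
  fix v :: "real^'n" assume v: "v \<in> unit_sphere"
  have "(g *v x) \<bullet> v = x \<bullet> (transpose g *v v)" using g by (rule inner_move)
  also have "\<dots> \<le> h (transpose g *v v)" using x mult_sphere[OF grp(4)[OF g] v] unfolding wulff_def by blast
  also have "\<dots> = h v" by (rule invariant_transpose[OF h g v])
  finally show "(g *v x) \<bullet> v \<le> h v" .
qed

lemma invariant_set_wulff: assumes h: "admissible h" shows "invariant_set G (wulff h)"
  unfolding invariant_set_def
proof (intro ballI equalityI subsetI)
  fix g x assume g: "g \<in> G"
  show "x \<in> wulff h" if "x \<in> (*v) g ` wulff h" using that wulff_invariant[OF h g] by blast
  assume "x \<in> wulff h"
  then have "transpose g *v x \<in> wulff h" by (rule wulff_invariant[OF h grp(4)[OF g]])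
  moreover have "x = g *v (transpose g *v x)" using orthogonal_matrix_transpose_mult(1)[OF grp(2)[OF g]] by simp
  ultimately show "x \<in> (*v) g ` wulff h" by (rule rev_image_eqI)
qed

lemma gauge_invariant: assumes h: "admissible h" and g: "g \<in> G"
  shows "wulff_gauge h (g *v x) = wulff_gauge h x"
proof -
  interpret positive_on_sphere h using h by (rule admissibleD)
  have le: "wulff_gauge h (g *v x) \<le> wulff_gauge h x" if g: "g \<in> G" for g x
  proof (rule gauge_least)
    fix v :: "real^'n" assume v: "v \<in> unit_sphere"
    have "(g *v x) \<bullet> v = x \<bullet> (transpose g *v v)" using g by (rule inner_move)
    also have "\<dots> \<le> wulff_gauge h x * h (transpose g *v v)" by (intro gauge_upper' mult_sphere grp(4) g v)
    also have "\<dots> = wulff_gauge h x * h v" by (simp only: invariant_transpose[OF h g v])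
    finally show "(g *v x) \<bullet> v \<le> wulff_gauge h x * h v" .
  qed
  have "wulff_gauge h (transpose g *v (g *v x)) \<le> wulff_gauge h (g *v x)" by (rule le[OF grp(4)[OF g]])
  then have "wulff_gauge h x \<le> wulff_gauge h (g *v x)" by (simp only: orthogonal_matrix_transpose_mult(2)[OF grp(2)[OF g]])
  then show ?thesis using le[OF g, of x] by simp
qed

lemma admissible_support: assumes h: "admissible h" shows "admissible (support_fun (wulff h))"
proof -
  interpret positive_on_sphere h using h by (rule admissibleD)
  have le: "support_fun (wulff h) (g *v v) \<le> support_fun (wulff h) v" if g: "g \<in> G" for g v
  proof (rule support_fun_least)
    show "wulff h \<noteq> {}" using zero_in_wulff by blast
    fix x assume x: "x \<in> wulff h"
    have "x \<bullet> (g *v v) = (transpose g *v x) \<bullet> v" using inner_move[OF g, of v x] by (simp only: inner_commute)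
    also have "\<dots> \<le> support_fun (wulff h) v" by (intro support_upper wulff_invariant[OF h grp(4)[OF g]] x)
    finally show "x \<bullet> (g *v v) \<le> support_fun (wulff h) v" .
  qed
  have "support_fun (wulff h) (g *v v) = support_fun (wulff h) v" if g: "g \<in> G" for g v
  proof -
    have "support_fun (wulff h) (transpose g *v (g *v v)) \<le> support_fun (wulff h) (g *v v)" by (rule le[OF grp(4)[OF g]])
    then show ?thesis using le[OF g, of v] by (simp only: orthogonal_matrix_transpose_mult(2)[OF grp(2)[OF g]])
  qed
  then show ?thesis using positive_on_sphere_support by (simp add: admissible_def)
qed

lemma admissible_const: "0 < c \<Longrightarrow> admissible (\<lambda>_. c)"
  by (simp add: admissible_def positive_on_sphere_def)

lemma admissible_scale: "admissible h \<Longrightarrow> 0 < c \<Longrightarrow> admissible (\<lambda>v. c * h v)"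
  by (auto simp: admissible_def intro: positive_on_sphere.positive_scale)

section \<open>Positivity, monotonicity and scaling of the functional\<close>

lemma sphere_measure_pos: "0 < measure (sphere_measure :: (real^'n) measure) unit_sphere"
  using sphere_pos finite_measure.emeasure_eq_measure[OF finite_sphere_measure[OF n], of unit_sphere]
  by (simp add: zero_less_measure_iff)

lemma M_measure_pos: "0 < measure M unit_sphere"
  using M_pos finite_measure.emeasure_eq_measure[OF M(2), of unit_sphere] by (simp add: zero_less_measure_iff)

lemma w_bounds: obtains c C where "0 < c" "\<And>u. u \<in> unit_sphere \<Longrightarrow> c \<le> w u \<and> w u \<le> C" "0 < C"
proof -
  interpret positive_on_sphere w using w w_pos by unfold_locales
  obtain m C where "0 < m" "m \<le> C" "\<And>v. v \<in> unit_sphere \<Longrightarrow> m \<le> w v \<and> w v \<le> C" using bounds by metis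
  then show ?thesis using that[of m C] by simp
qed

lemma dual_volume_integrable: "positive_on_sphere h \<Longrightarrow> integrable sphere_measure (\<lambda>u. radial_fun (wulff h) u powr q' * w u)"
  by (intro continuous_integrable_sphere continuous_on_mult w positive_on_sphere.continuous_radial_powr
      sets_sphere_measure finite_sphere_measure n)

lemma polar_mean_integrable: "positive_on_sphere h \<Longrightarrow> integrable M (\<lambda>v. h v powr a)"
  by (intro continuous_integrable_sphere M positive_on_sphere.continuous_powr)

lemma dual_volume_pos: assumes "positive_on_sphere h" shows "0 < dual_volume h"
proof -
  interpret positive_on_sphere h by fact
  interpret F: positive_on_sphere "\<lambda>u. radial_fun (wulff h) u powr q * w u"
  proof
    show "continuous_on unit_sphere (\<lambda>u. radial_fun (wulff h) u powr q * w u)"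
      by (intro continuous_on_mult w continuous_radial_powr)
    fix u :: "real^'n" assume u: "u \<in> unit_sphere"
    then have "u \<noteq> 0" by auto
    then show "0 < radial_fun (wulff h) u powr q * w u" using radial_pos[of u] w_pos[OF u] by simp
  qed
  obtain m C where m: "0 < m" "m \<le> C" "\<And>u. u \<in> unit_sphere \<Longrightarrow> m \<le> radial_fun (wulff h) u powr q * w u \<and> radial_fun (wulff h) u powr q * w u \<le> C"
    using F.bounds by metis
  have "m * measure sphere_measure (unit_sphere :: (real^'n) set) \<le> dual_volume h"
    unfolding dual_volume_def using m(3)
    by (intro integral_ge_const_on_sphere[OF sets_sphere_measure finite_sphere_measure[OF n] F.cont]) simp
  then show ?thesis using m(1) sphere_measure_pos by (meson less_le_trans mult_pos_pos)
qed

lemma polar_mean_pos: assumes "positive_on_sphere h" shows "0 < polar_mean h"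
proof -
  interpret positive_on_sphere h by fact
  interpret F: positive_on_sphere "\<lambda>v. h v powr (- P)"
    by unfold_locales (use continuous_powr nonzero in auto)
  obtain m C where m: "0 < m" "m \<le> C" "\<And>u. u \<in> unit_sphere \<Longrightarrow> m \<le> h u powr (- P) \<and> h u powr (- P) \<le> C"
    using F.bounds by metis
  have "m * measure M unit_sphere \<le> polar_mean h"
    unfolding polar_mean_def using m(3) by (intro integral_ge_const_on_sphere[OF M F.cont]) simp
  then show ?thesis using m(1) M_measure_pos by (meson less_le_trans mult_pos_pos)
qed

lemma dual_volume_mono:
  assumes "positive_on_sphere h" "positive_on_sphere k" "\<And>v. v \<in> unit_sphere \<Longrightarrow> h v \<le> k v"
  shows "dual_volume h \<le> dual_volume k"
  unfolding dual_volume_def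
proof (rule integral_mono)
  fix u :: "real^'n" assume "u \<in> space sphere_measure"
  then have u: "u \<in> unit_sphere" "u \<noteq> 0" by auto
  have "radial_fun (wulff h) u powr q \<le> radial_fun (wulff k) u powr q"
    using positive_on_sphere.radial_mono[OF assms(1,3,2) u(2)] positive_on_sphere.radial_pos[OF assms(1) u(2)] q
    by (intro powr_mono2) auto
  then show "radial_fun (wulff h) u powr q * w u \<le> radial_fun (wulff k) u powr q * w u"
    using w_pos[OF u(1)] by (intro mult_right_mono) auto
qed (use dual_volume_integrable assms in auto)

lemma space_M: "space M = unit_sphere"
  using sets_eq_imp_space_eq[OF M(1)] by (simp add: space_borel_sphere)

lemma polar_mean_antimono:
  assumes "positive_on_sphere h" "positive_on_sphere k" "\<And>v. v \<in> unit_sphere \<Longrightarrow> h v \<le> k v"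
  shows "polar_mean k \<le> polar_mean h"
  unfolding polar_mean_def
proof (rule integral_mono)
  fix v assume "v \<in> space M"
  then have v: "v \<in> unit_sphere" by (simp add: space_M)
  show "k v powr (- P) \<le> h v powr (- P)"
    using assms(3)[OF v] positive_on_sphere.pos[OF assms(1) v] P by (intro powr_mono2') auto
qed (use polar_mean_integrable assms in auto)

lemma dual_volume_scale:
  assumes "positive_on_sphere h" "0 < c" shows "dual_volume (\<lambda>v. c * h v) = c powr q * dual_volume h"
proof -
  have "radial_fun (wulff (\<lambda>v. c * h v)) u powr q * w u = c powr q * (radial_fun (wulff h) u powr q * w u)"
    if "u \<in> space sphere_measure" for u
  proof -
    have "u \<noteq> 0" using that by auto
    then show ?thesis using positive_on_sphere.radial_pos[OF assms(1), of u] assms(2)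
      by (simp add: positive_on_sphere.radial_scale[OF assms] powr_mult)
  qed
  then have "dual_volume (\<lambda>v. c * h v) = (\<integral>u. c powr q * (radial_fun (wulff h) u powr q * w u) \<partial>sphere_measure)"
    unfolding dual_volume_def by (intro Bochner_Integration.integral_cong) auto
  then show ?thesis by (simp add: dual_volume_def)
qed

lemma polar_mean_scale:
  assumes "positive_on_sphere h" "0 < c" shows "polar_mean (\<lambda>v. c * h v) = c powr (- P) * polar_mean h"
proof -
  have "polar_mean (\<lambda>v. c * h v) = (\<integral>v. c powr (- P) * h v powr (- P) \<partial>M)"
    unfolding polar_mean_def using assms positive_on_sphere.pos[OF assms(1)]
    by (intro Bochner_Integration.integral_cong) (auto simp: powr_mult space_M less_imp_le)
  then show ?thesis by (simp add: polar_mean_def)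
qed

lemma functional_pos: "positive_on_sphere h \<Longrightarrow> 0 < functional h"
  using dual_volume_pos[of h] polar_mean_pos[of h] by (simp add: functional_def)

text \<open>One comparison with three uses: it gives scale invariance, the bound from above among
  normalised competitors, and continuity under uniform convergence.\<close>

lemma functional_le:
  assumes "positive_on_sphere h" "positive_on_sphere k" "0 < a" "0 < b"
    and "\<And>v. v \<in> unit_sphere \<Longrightarrow> a * h v \<le> k v" "\<And>v. v \<in> unit_sphere \<Longrightarrow> k v \<le> b * h v"
  shows "functional k \<le> b / a * functional h"
proof -
  note pos = positive_on_sphere.positive_scale[OF assms(1)]
  have "dual_volume k \<le> b powr q * dual_volume h"
    using dual_volume_mono[OF assms(2) pos[OF \<open>0 < b\<close>] assms(6)] by (simp add: dual_volume_scale assms)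
  then have "dual_volume k powr (1 / q) \<le> (b powr q * dual_volume h) powr (1 / q)"
    using dual_volume_pos[OF assms(2)] q by (intro powr_mono2) auto
  also have "\<dots> = b * dual_volume h powr (1 / q)"
    using assms(4) q dual_volume_pos[OF assms(1)] by (simp add: powr_mult powr_powr)
  finally have V: "dual_volume k powr (1 / q) \<le> b * dual_volume h powr (1 / q)" .
  have "polar_mean k \<le> a powr (- P) * polar_mean h"
    using polar_mean_antimono[OF pos[OF \<open>0 < a\<close>] assms(2,5)] by (simp add: polar_mean_scale assms)
  then have "polar_mean k powr (1 / P) \<le> (a powr (- P) * polar_mean h) powr (1 / P)"
    using polar_mean_pos[OF assms(2)] P by (intro powr_mono2) auto
  also have "\<dots> = (1 / a) * polar_mean h powr (1 / P)"
    using assms(3) P polar_mean_pos[OF assms(1)] by (simp add: powr_mult powr_powr)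
  finally have "polar_mean k powr (1 / P) \<le> (1 / a) * polar_mean h powr (1 / P)" .
  with V have "functional k \<le> (b * dual_volume h powr (1 / q)) * ((1 / a) * polar_mean h powr (1 / P))"
    unfolding functional_def using assms(4) by (intro mult_mono) auto
  then show ?thesis by (simp add: functional_def mult_ac)
qed

text \<open>The body and hence the dual volume stay the same, while a smaller function has a larger
  integral of its power -P.\<close>

lemma functional_support: assumes "positive_on_sphere h" shows "functional h \<le> functional (support_fun (wulff h))"
proof -
  interpret positive_on_sphere h by fact
  have "dual_volume (support_fun (wulff h)) = dual_volume h" by (simp add: dual_volume_def wulff_support)
  moreover have "polar_mean h \<le> polar_mean (support_fun (wulff h))"
    by (intro polar_mean_antimono positive_on_sphere_support assms support_le)
  then have "polar_mean h powr (1 / P) \<le> polar_mean (support_fun (wulff h)) powr (1 / P)"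
    using polar_mean_pos[OF assms] P by (intro powr_mono2) auto
  ultimately show ?thesis by (simp add: functional_def mult_left_mono)
qed

lemma functional_scale: assumes "positive_on_sphere h" "0 < c" shows "functional (\<lambda>v. c * h v) = functional h"
proof (rule antisym)
  note s = positive_on_sphere.positive_scale[OF assms]
  show "functional (\<lambda>v. c * h v) \<le> functional h"
    using functional_le[OF assms(1) s assms(2,2)] assms(2) by simp
  show "functional h \<le> functional (\<lambda>v. c * h v)"
    using functional_le[OF s assms(1), of "1 / c" "1 / c"] assms(2) by simp
qed

text \<open>
  The factor \<open>2\<^sup>n\<close> comes from the greedy choice of the axes, the factor \<open>n\<close> from \<open>-K \<subseteq> n K\<close>.
\<close>

definition adapted :: "(real^'n \<Rightarrow> real) \<Rightarrow> ('n \<Rightarrow> real^'n) \<Rightarrow> ('n \<Rightarrow> real) \<Rightarrow> bool" where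
  "adapted h e a \<longleftrightarrow> (\<forall>i j. e i \<bullet> e j = (if i = j then 1 else 0)) \<and> (\<forall>i. 0 < a i) \<and>
     (\<forall>i. \<forall>x\<in>wulff h. \<bar>x \<bullet> e i\<bar> \<le> a i) \<and>
     (\<forall>i. \<forall>v\<in>unit_sphere. a i * \<bar>v \<bullet> e i\<bar> \<le> 2 ^ CARD('n) * real CARD('n) * h v)"

lemma adapted_exists:
  assumes h: "admissible h"
  shows "\<exists>e a. adapted (support_fun (wulff h)) e a"
proof -
  let ?n = "real CARD('n)"
  interpret positive_on_sphere h using h by (rule admissibleD)
  obtain m C where m: "0 < m" "m \<le> C" "\<And>u. u \<in> unit_sphere \<Longrightarrow> m \<le> h u \<and> h u \<le> C" using bounds by metis
  have sub: "ball 0 m \<subseteq> wulff h" using m by (intro ball_subset_wulff) auto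
  obtain e :: "'n \<Rightarrow> real^'n" and a where e: "\<And>i. 0 < a i" "\<And>i j. e i \<bullet> e j = (if i = j then 1 else 0)"
    "\<And>i y. y \<in> wulff h \<Longrightarrow> \<bar>y \<bullet> e i\<bar> \<le> a i"
    "\<And>i v H. (\<And>x. x \<in> wulff h \<Longrightarrow> \<bar>x \<bullet> v\<bar> \<le> H) \<Longrightarrow> a i * \<bar>v \<bullet> e i\<bar> \<le> 2 ^ CARD('n) * H"
    by (rule adapted_box[OF compact_wulff sub m(1)]) blast
  \<comment> \<open>One sign is the definition of the support function; for the other, -x / n lies
    in the hull of the orbit of \<open>x\<close>, which the invariant convex body contains.\<close>
  have "\<bar>x \<bullet> v\<bar> \<le> ?n * support_fun (wulff h) v" if x: "x \<in> wulff h" for x v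
  proof -
    have "(\<lambda>g. g *v x) ` G \<subseteq> wulff h" using wulff_invariant[OF h _ x] by blast
    then have "convex hull ((\<lambda>g. g *v x) ` G) \<subseteq> wulff h" using convex_wulff by (rule hull_minimal)
    moreover have "- (1 / ?n) *\<^sub>R x \<in> convex hull ((\<lambda>g. g *v x) ` G)"
      using fix0 by (intro neg_in_convex_hull_orbit[OF G]) blast
    ultimately have "(- (1 / ?n) *\<^sub>R x) \<bullet> v \<le> support_fun (wulff h) v" using support_upper by blast
    then have 1: "- (x \<bullet> v) \<le> ?n * support_fun (wulff h) v" using n by (simp add: field_simps)
    have 2: "x \<bullet> v \<le> support_fun (wulff h) v" using x by (rule support_upper)
    have "0 \<le> support_fun (wulff h) v" using support_upper[OF zero_in_wulff, of v] by simp
    then have "support_fun (wulff h) v \<le> ?n * support_fun (wulff h) v" using n by (intro mult_le_cancel_right1[THEN iffD2]) auto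
    then show ?thesis using 1 2 by linarith
  qed
  then have "a i * \<bar>v \<bullet> e i\<bar> \<le> 2 ^ CARD('n) * (?n * support_fun (wulff h) v)" for i v by (intro e(4))
  then have "adapted (support_fun (wulff h)) e a"
    unfolding adapted_def wulff_support using e by (auto simp: mult.assoc)
  then show ?thesis by blast
qed

lemma l1_norm_ge:
  fixes e :: "'n \<Rightarrow> real^'n"
  assumes e: "\<forall>i j. e i \<bullet> e j = (if i = j then 1 else 0)"
  shows "norm x \<le> (\<Sum>i\<in>UNIV. \<bar>x \<bullet> e i\<bar>)"
proof -
  have n1: "norm (e i) = 1" for i using e by (simp add: norm_eq_sqrt_inner)
  have "norm x = norm (\<Sum>i\<in>UNIV. (x \<bullet> e i) *\<^sub>R e i)" using orthonormal_family(3)[of e x] e by simp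
  also have "\<dots> \<le> (\<Sum>i\<in>UNIV. \<bar>x \<bullet> e i\<bar>)" by (rule order_trans[OF norm_sum]) (simp add: n1)
  finally show ?thesis .
qed

text \<open>A function above the level \<open>\<eta>\<close> cannot have an eccentric box. After
  passing to the support function and dividing by the longest half-axis, all half-axes lie between
  \<open>\<kappa>\<close> and 1, which gives the two-sided bounds and the Lipschitz constant needed
  for compactness.\<close>

lemma normalised_competitor:
  assumes \<kappa>: "0 < \<kappa>" and decay: "\<And>k e a i j. admissible k \<Longrightarrow> adapted k e a \<Longrightarrow>
      a i < \<kappa> * a j \<Longrightarrow> functional k < \<eta>"
    and h: "admissible h" "\<eta> \<le> functional h"
  shows "\<exists>k. admissible k \<and> functional h \<le> functional k \<and>
    (\<forall>v\<in>unit_sphere. \<kappa> / (2 ^ CARD('n) * real CARD('n) ^ 2) \<le> k v \<and> k v \<le> real CARD('n)) \<and>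
    (\<forall>v v'. \<bar>k v - k v'\<bar> \<le> real CARD('n) * norm (v - v'))"
proof -
  let ?n = "real CARD('n)" let ?k = "support_fun (wulff h)"
  interpret positive_on_sphere h using h(1) by (rule admissibleD)
  obtain e a where ea: "adapted ?k e a" using adapted_exists[OF h(1)] by blast
  then have e: "\<forall>i j. e i \<bullet> e j = (if i = j then 1 else 0)" and a: "\<And>i. 0 < a i"
    and box: "\<And>i x. x \<in> wulff h \<Longrightarrow> \<bar>x \<bullet> e i\<bar> \<le> a i"
    and low: "\<And>i v. v \<in> unit_sphere \<Longrightarrow> a i * \<bar>v \<bullet> e i\<bar> \<le> 2 ^ CARD('n) * ?n * ?k v"
    unfolding adapted_def wulff_support by auto
  obtain m l where ml: "m \<noteq> l" "\<And>i. a i \<le> a m" "\<And>i. a l \<le> a i" by (rule exists_extremal_indices[OF n, of a]) blast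
  have F: "functional h \<le> functional ?k" by (rule functional_support) unfold_locales
  have "\<not> a l < \<kappa> * a m"
  proof
    assume "a l < \<kappa> * a m"
    then have "functional ?k < \<eta>"
      using ea by (intro decay[of ?k e a]) (auto simp: admissible_support[OF h(1)])
    then show False using F h(2) by simp
  qed
  then have \<kappa>a: "\<kappa> * a m \<le> a i" for i using ml(3)[of i] by linarith
  have nx: "norm x \<le> ?n * a m" if "x \<in> wulff h" for x
  proof -
    have "norm x \<le> (\<Sum>i\<in>(UNIV :: 'n set). \<bar>x \<bullet> e i\<bar>)" by (rule l1_norm_ge[OF e])
    also have "\<dots> \<le> (\<Sum>i\<in>(UNIV :: 'n set). a m)" using box[OF that] ml(2) by (intro sum_mono) (meson order_trans)
    finally show ?thesis by simp
  qed
  define k where "k v = 1 / a m * ?k v" for v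
  have am: "0 < 1 / a m" using a by simp
  have k: "admissible k" unfolding k_def by (intro admissible_scale admissible_support h am)
  have Fk: "functional k = functional ?k" unfolding k_def by (intro functional_scale positive_on_sphere_support am)
  have low': "\<kappa> / (2 ^ CARD('n) * ?n ^ 2) \<le> k v" if v: "v \<in> unit_sphere" for v
  proof -
    \<comment> \<open>The l1 norm of a unit vector is at least 1, so one of its n coordinates is at
      least 1 / n; along that axis the body is long enough.\<close>
    have "\<exists>i. 1 / ?n \<le> \<bar>v \<bullet> e i\<bar>"
    proof (rule ccontr)
      assume "\<not> ?thesis"
      then have "(\<Sum>i\<in>(UNIV :: 'n set). \<bar>v \<bullet> e i\<bar>) < (\<Sum>i\<in>(UNIV :: 'n set). 1 / ?n)"
        by (intro sum_strict_mono) (auto simp: not_le)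
      then show False using l1_norm_ge[OF e, of v] v by simp
    qed
    then obtain i where i: "1 / ?n \<le> \<bar>v \<bullet> e i\<bar>" by blast
    have "\<kappa> * a m * (1 / ?n) \<le> a i * \<bar>v \<bullet> e i\<bar>" using \<kappa>a[of i] i a[of i] by (intro mult_mono) auto
    also have "\<dots> \<le> 2 ^ CARD('n) * ?n * ?k v" using v by (rule low)
    also have "?k v = a m * k v" using a[of m] by (simp add: k_def)
    finally have "a m * (\<kappa> * (1 / ?n)) \<le> a m * (2 ^ CARD('n) * ?n * k v)" by (simp add: mult_ac)
    then have "\<kappa> * (1 / ?n) \<le> 2 ^ CARD('n) * ?n * k v" using a[of m] by (simp only: mult_le_cancel_left_pos)
    then show ?thesis using n by (simp add: field_simps power2_eq_square)
  qed
  have up: "k v \<le> ?n" if v: "v \<in> unit_sphere" for v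
  proof -
    have "?k v \<le> ?n * a m"
    proof (rule support_fun_least)
      show "wulff h \<noteq> {}" using zero_in_wulff by blast
      fix x assume "x \<in> wulff h"
      then show "x \<bullet> v \<le> ?n * a m" using norm_cauchy_schwarz[of x v] nx[of x] v by simp
    qed
    then show ?thesis using a[of m] by (simp add: k_def pos_divide_le_eq)
  qed
  have lip: "\<bar>k v - k v'\<bar> \<le> ?n * norm (v - v')" for v v'
  proof -
    have "\<bar>?k v - ?k v'\<bar> \<le> ?n * a m * norm (v - v')"
      using zero_in_wulff nx by (intro support_fun_lipschitz) auto
    then have "1 / a m * \<bar>?k v - ?k v'\<bar> \<le> 1 / a m * (?n * a m * norm (v - v'))" using am by (intro mult_left_mono) auto
    moreover have "1 / a m * \<bar>?k v - ?k v'\<bar> = \<bar>k v - k v'\<bar>"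
    proof -
      have "k v - k v' = 1 / a m * (?k v - ?k v')" by (simp add: k_def right_diff_distrib)
      then show ?thesis using a[of m] by (simp only: abs_mult) simp
    qed
    moreover have "1 / a m * (?n * a m * norm (v - v')) = ?n * norm (v - v')" using a[of m] by simp
    ultimately show ?thesis by simp
  qed
  show ?thesis using k F Fk low' up lip by (intro exI[of _ k]) auto
qed

text \<open>The unit ball sets the level \<open>F0\<close> to be beaten. Competitors above it may be
  replaced by normalised ones, which form an equicontinuous family, and the Arzela-Ascoli theorem
  gives a uniform limit.\<close>

lemma maximiser_exists:
  assumes decay: "\<And>\<eta>. 0 < \<eta> \<Longrightarrow> \<exists>\<kappa>>0. \<forall>k e a i j. admissible k \<longrightarrow> adapted k e a \<longrightarrow>
      a i < \<kappa> * a j \<longrightarrow> functional k < \<eta>"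
  shows "\<exists>h. admissible h \<and> (\<forall>k. admissible k \<longrightarrow> functional k \<le> functional h)"
proof -
  let ?n = "real CARD('n)"
  define F0 where "F0 = functional (\<lambda>_. 1)"
  have adm1: "admissible (\<lambda>_. 1)" by (rule admissible_const) simp
  have F0: "0 < F0" unfolding F0_def using functional_pos[OF admissibleD[OF adm1]] .
  obtain \<kappa> where \<kappa>: "0 < \<kappa>" "\<And>k e a i j. admissible k \<Longrightarrow> adapted k e a \<Longrightarrow>
      a i < \<kappa> * a j \<Longrightarrow> functional k < F0"
    using decay[OF F0] by blast
  define r where "r = \<kappa> / (2 ^ CARD('n) * ?n ^ 2)"
  have r: "0 < r" using \<kappa>(1) n by (simp add: r_def)
  define H where "H = {k. admissible k \<and> (\<forall>v\<in>unit_sphere. r \<le> k v \<and> k v \<le> ?n) \<and> (\<forall>v v'. \<bar>k v - k v'\<bar> \<le> ?n * norm (v - v'))}"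
  have comp: "\<exists>k\<in>H. functional h \<le> functional k" if "admissible h" "F0 \<le> functional h" for h
  proof -
    have "\<exists>k. admissible k \<and> functional h \<le> functional k \<and>
        (\<forall>v\<in>unit_sphere. \<kappa> / (2 ^ CARD('n) * real CARD('n) ^ 2) \<le> k v \<and> k v \<le> real CARD('n)) \<and>
        (\<forall>v v'. \<bar>k v - k v'\<bar> \<le> real CARD('n) * norm (v - v'))"
      by (rule normalised_competitor[OF \<kappa>(1) _ that]) (fact \<kappa>(2))
    then show ?thesis unfolding H_def r_def by blast
  qed
  obtain k0 where k0: "k0 \<in> H" "F0 \<le> functional k0" using comp[OF adm1] by (auto simp: F0_def)
  have bdd: "functional k \<le> ?n / r * F0" if "k \<in> H" for k
    unfolding F0_def using that r n by (intro functional_le admissibleD[OF adm1]) (auto simp: H_def admissible_def)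
  then have bA: "bdd_above (functional ` H)" by (intro bdd_aboveI2)
  define s where "s = (SUP k\<in>H. functional k)"
  have sup: "functional k \<le> s" if "k \<in> H" for k unfolding s_def using that bA by (rule cSUP_upper)
  have "\<exists>k\<in>H. s - 1 / real (Suc j) < functional k" for j
    unfolding s_def using k0(1) bA by (intro less_cSUP_iff[THEN iffD1]) auto
  then obtain X where X: "\<And>j. X j \<in> H" "\<And>j. s - 1 / real (Suc j) < functional (X j)" by metis
  have XH: "admissible (X j)" "v \<in> unit_sphere \<Longrightarrow> r \<le> X j v \<and> X j v \<le> ?n" "\<bar>X j v - X j v'\<bar> \<le> ?n * norm (v - v')" for j v v'
    using X(1)[of j] unfolding H_def by auto
  obtain h k where h: "continuous_on unit_sphere h" and k: "strict_mono (k :: nat \<Rightarrow> nat)"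
    and lim: "\<And>e. 0 < e \<Longrightarrow> \<exists>N. \<forall>j x. j \<ge> N \<and> x \<in> unit_sphere \<longrightarrow> norm (X (k j) x - h x) < e"
  proof (rule Arzela_Ascoli[of "unit_sphere :: (real^'n) set" X ?n])
    show "compact (unit_sphere :: (real^'n) set)" by (rule compact_sphere)
    show "norm (X j x) \<le> ?n" if "x \<in> unit_sphere" for j x using XH(2)[OF that, of j] r by simp
    show "\<exists>d>0. \<forall>j y. y \<in> unit_sphere \<and> norm (x - y) < d \<longrightarrow> norm (X j x - X j y) < e" if "0 < e" for x e
    proof (intro exI[of _ "e / ?n"] conjI allI impI)
      show "0 < e / ?n" using that n by simp
      fix j y assume y: "y \<in> unit_sphere \<and> norm (x - y) < e / ?n"
      have "norm (X j x - X j y) \<le> ?n * norm (x - y)" using XH(3) by simp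
      also have "\<dots> < e" using y n by (simp add: field_simps)
      finally show "norm (X j x - X j y) < e" .
    qed
  qed blast
  have ptw: "(\<lambda>j. X (k j) x) \<longlonglongrightarrow> h x" if "x \<in> unit_sphere" for x
  proof (rule LIMSEQ_I)
    fix e :: real assume "0 < e"
    then show "\<exists>N. \<forall>j\<ge>N. norm (X (k j) x - h x) < e" using lim[of e] that by blast
  qed
  have hr: "r \<le> h v" if "v \<in> unit_sphere" for v
    using ptw[OF that] XH(2)[OF that] by (intro LIMSEQ_le_const) auto
  have pos: "positive_on_sphere h" using h hr r by unfold_locales force+
  have hinv: "h (g *v v) = h v" if "g \<in> G" "v \<in> unit_sphere" for g v
  proof -
    have "X (k j) (g *v v) = X (k j) v" for j using XH(1)[of "k j"] that by (simp add: admissible_def)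
    then have "(\<lambda>j. X (k j) v) \<longlonglongrightarrow> h (g *v v)" using ptw[OF mult_sphere[OF that]] by simp
    then show ?thesis using ptw[OF that(2)] by (rule LIMSEQ_unique)
  qed
  have adm: "admissible h" using pos hinv by (simp add: admissible_def)
  \<comment> \<open>Uniform closeness together with the lower bound \<open>r\<close> squeezes the
    maximising sequence between (1 - \<epsilon>) h and (1 + \<epsilon>) h.\<close>
  have "s \<le> (1 + \<epsilon>) / (1 - \<epsilon>) * functional h" if \<epsilon>: "0 < \<epsilon>" "\<epsilon> < 1" for \<epsilon>
  proof -
    obtain N where N: "\<And>j x. j \<ge> N \<Longrightarrow> x \<in> unit_sphere \<Longrightarrow> norm (X (k j) x - h x) < \<epsilon> * r"
      using lim[of "\<epsilon> * r"] \<epsilon> r by auto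
    have le: "functional (X (k j)) \<le> (1 + \<epsilon>) / (1 - \<epsilon>) * functional h" if "j \<ge> N" for j
    proof (rule functional_le[OF pos admissibleD[OF XH(1)]])
      fix v :: "real^'n" assume v: "v \<in> unit_sphere"
      have "\<bar>X (k j) v - h v\<bar> < \<epsilon> * r" using N[OF that v] by simp
      moreover have "\<epsilon> * r \<le> \<epsilon> * h v" using hr[OF v] \<epsilon> by (intro mult_left_mono) auto
      ultimately show "(1 - \<epsilon>) * h v \<le> X (k j) v" "X (k j) v \<le> (1 + \<epsilon>) * h v" by (simp_all add: algebra_simps)
    qed (use \<epsilon> in auto)
    have "s - 1 / real (Suc j) \<le> (1 + \<epsilon>) / (1 - \<epsilon>) * functional h" if "j \<ge> N" for j
    proof -
      have "1 / real (Suc (k j)) \<le> 1 / real (Suc j)" using seq_suble[OF k, of j] by (intro divide_left_mono) auto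
      then show ?thesis using le[OF that] X(2)[of "k j"] by linarith
    qed
    moreover have "(\<lambda>j. s - 1 / real (Suc j)) \<longlonglongrightarrow> s - 0"
      by (intro tendsto_diff tendsto_const LIMSEQ_Suc lim_1_over_n)
    ultimately show ?thesis by (intro LIMSEQ_le_const2[of "\<lambda>j. s - 1 / real (Suc j)"]) auto
  qed
  then have "\<forall>\<^sub>F \<epsilon> in at_right 0. s \<le> (1 + \<epsilon>) / (1 - \<epsilon>) * functional h"
    by (auto simp: eventually_at_right_field intro!: exI[of _ 1])
  moreover have "((\<lambda>\<epsilon>. (1 + \<epsilon>) / (1 - \<epsilon>) * functional h) \<longlongrightarrow> (1 + 0) / (1 - 0) * functional h) (at_right 0)"
    by (intro tendsto_intros) simp
  ultimately have sh: "s \<le> functional h" by (intro tendsto_lowerbound[of _ _ "at_right 0"]) auto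
  show ?thesis
  proof (intro exI[of _ h] conjI adm allI impI)
    fix k assume k: "admissible k"
    show "functional k \<le> functional h"
    proof (cases "F0 \<le> functional k")
      case True
      then obtain k' where "k' \<in> H" "functional k \<le> functional k'" using comp[OF k] by blast
      then show ?thesis using sup[of k'] sh by linarith
    next
      case False
      then show ?thesis using sup[OF k0(1)] k0(2) sh by linarith
    qed
  qed
qed

end

section \<open>Elementary inequalities for the decay estimate\<close>

lemma powr_le_one_plus_powr: "0 < z \<Longrightarrow> 0 \<le> a \<Longrightarrow> a \<le> b \<Longrightarrow> z powr a \<le> 1 + z powr b" for z a b :: real
proof (cases "1 \<le> z")
  case True
  assume "a \<le> b"
  then have "z powr a \<le> z powr b" using True by (intro powr_mono)
  then show ?thesis by simp
next
  case False
  assume "0 < z" "0 \<le> a"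
  then have "z powr a \<le> 1" using False by (intro powr_le1) auto
  then show ?thesis by (meson add_increasing2 powr_ge_zero)
qed

lemma powr_pos: "0 < x \<Longrightarrow> 0 < x powr a" for x a :: real
  by simp

lemma inverse_powr: "0 < x \<Longrightarrow> (1 / x) powr a = x powr (- a)" for x :: real
  by (simp add: powr_divide powr_minus_divide)

text \<open>A crude form of Jensen's inequality, from z^a <= 1 + z^b with z = g /
  \<open>sphere_mean b g\<close>; the extra 1 accounts for the total measure in the
  constant.\<close>

lemma lower_mean_le:
  fixes g :: "real^'n \<Rightarrow> real"
  assumes n: "CARD('n) \<ge> 2" and g: "positive_on_sphere g" and ab: "0 < a" "a \<le> b"
    and J: "0 < (\<integral>u. g u powr b \<partial>sphere_measure)"
  shows "(\<integral>u. g u powr a \<partial>sphere_measure) \<le>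
    sphere_mean b g powr a * (measure sphere_measure (unit_sphere :: (real^'n) set) + 1)"
proof -
  let ?J = "sphere_mean b g"
  interpret positive_on_sphere g by fact
  interpret finite_measure "sphere_measure :: (real^'n) measure" by (rule finite_sphere_measure[OF n])
  have J0: "0 < ?J" using J by (simp add: sphere_mean_def)
  have Jb: "?J powr b = (\<integral>u. g u powr b \<partial>sphere_measure)" using J ab by (simp add: sphere_mean_def powr_powr)
  have int: "integrable sphere_measure (\<lambda>u. g u powr x)" for x
    by (intro continuous_integrable_sphere continuous_powr sets_sphere_measure finite_sphere_measure n)
  have "(\<integral>u. g u powr a \<partial>sphere_measure) \<le> (\<integral>u. ?J powr a * (1 + g u powr b / ?J powr b) \<partial>sphere_measure)"
  proof (rule integral_mono)
    show "integrable sphere_measure (\<lambda>u. g u powr a)" by (rule int)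
    show "integrable sphere_measure (\<lambda>u. ?J powr a * (1 + g u powr b / ?J powr b))" using int by simp
    fix u :: "real^'n" assume "u \<in> space sphere_measure"
    then have gu: "0 < g u" using pos by simp
    have "(g u / ?J) powr a \<le> 1 + (g u / ?J) powr b" using gu J0 ab by (intro powr_le_one_plus_powr) auto
    then have "?J powr a * (g u / ?J) powr a \<le> ?J powr a * (1 + (g u / ?J) powr b)" by (intro mult_left_mono) auto
    moreover have "?J powr a * (g u / ?J) powr a = g u powr a" using gu J0 by (simp add: powr_divide)
    moreover have "(g u / ?J) powr b = g u powr b / ?J powr b" using gu J0 by (simp add: powr_divide)
    ultimately show "g u powr a \<le> ?J powr a * (1 + g u powr b / ?J powr b)" by simp
  qed
  also have "\<dots> = ?J powr a * (\<integral>u. 1 + g u powr b / ?J powr b \<partial>(sphere_measure :: (real^'n) measure))" by simp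
  also have "(\<integral>u. 1 + g u powr b / ?J powr b \<partial>(sphere_measure :: (real^'n) measure)) =
      measure sphere_measure (unit_sphere :: (real^'n) set) + (\<integral>u. g u powr b \<partial>sphere_measure) / ?J powr b"
    using int by (subst Bochner_Integration.integral_add) auto
  also have "(\<integral>u. g u powr b \<partial>sphere_measure) / ?J powr b = 1" using J by (simp add: Jb)
  finally show ?thesis .
qed

text \<open>The last identity is the critical relation for q >= n; it makes \<delta> vanish in
  \<open>product_estimate\<close>.\<close>

lemma critical_exponent_bounds:
  fixes n q r :: real
  assumes "2 \<le> n" "n \<le> q"
  shows "1 < q / (q - n + 1)" "q / (q - n + 1) \<le> n" "1 / (q / (q - n + 1)) = 1 - (n - 1) / q"
proof -
  have d: "0 < q - n + 1" using assms by simp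
  show "1 < q / (q - n + 1)" using d assms by (simp add: pos_less_divide_eq)
  have "0 \<le> (n - 1) * (q - n)" using assms by simp
  then show "q / (q - n + 1) \<le> n" using d by (simp add: pos_divide_le_eq algebra_simps)
  show "1 / (q / (q - n + 1)) = 1 - (n - 1) / q" using assms by (simp add: field_simps)
qed

context dual_minkowski
begin

lemma sphere_integral_powr_pos:
  fixes g :: "real^'n \<Rightarrow> real"
  assumes "positive_on_sphere g" shows "0 < (\<integral>v. g v powr t \<partial>sphere_measure)"
proof -
  interpret g: positive_on_sphere g by fact
  interpret F: positive_on_sphere "\<lambda>v. g v powr t"
    by unfold_locales (use g.continuous_powr g.nonzero in auto)
  obtain m C where m: "0 < m" "m \<le> C" "\<And>u. u \<in> unit_sphere \<Longrightarrow> m \<le> g u powr t \<and> g u powr t \<le> C"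
    using F.bounds by metis
  have "m * measure sphere_measure (unit_sphere :: (real^'n) set) \<le> (\<integral>v. g v powr t \<partial>sphere_measure)"
    using m(3) by (intro integral_ge_const_on_sphere[OF sets_sphere_measure finite_sphere_measure[OF n] F.cont]) simp
  then show ?thesis using m(1) sphere_measure_pos by (meson less_le_trans mult_pos_pos)
qed

text \<open>\<open>product_estimate\<close> for the body and its polar partner 1 / k. For q1 >= n it
  is applied with R = q1 and Q = r, otherwise with R = r and Q = q1 and the two boxes exchanged. In
  either case the decay exponent is a non-negative multiple of 1/r - 1/qs, and the lower bound on
  \<open>r\<close> is what admits it as Q or as R.\<close>

lemma pair_estimate:
  assumes q1: "1 < q1" and r: "(if real CARD('n) \<le> q1 then 1 else real CARD('n) - 1) < r"
    and qs: "qs = (if real CARD('n) \<le> q1 then q1 / (q1 - real CARD('n) + 1) else (real CARD('n) - 1) * q1 / (q1 - 1))"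
    and rq: "r \<le> qs"
  shows "\<exists>C>0. \<exists>\<delta>\<ge>0. (r < qs \<longrightarrow> 0 < \<delta>) \<and> (\<forall>k e a. admissible k \<longrightarrow> adapted k e a \<longrightarrow>
    (\<forall>i j. sphere_mean q1 (radial_fun (wulff k)) * sphere_mean r (\<lambda>v. 1 / k v)
      \<le> C * (a i / a j) powr \<delta>))"
proof -
  let ?n = "real CARD('n)" let ?D = "2 ^ CARD('n) * ?n"
  have n2: "2 \<le> ?n" using n by simp
  have D: "0 < ?D" using n by simp
  have r0: "0 < r" using r n2 by (auto split: if_splits)
  have rad: "box_bounded e a (radial_fun (wulff k))" and inv: "box_bounded e (\<lambda>i. ?D / a i) (\<lambda>v. 1 / k v)"
    and apos: "\<And>i. 0 < a i" if k: "admissible k" and ea: "adapted k e a" for k e a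
  proof -
    interpret positive_on_sphere k using k by (rule admissibleD)
    have orth: "\<forall>i j. e i \<bullet> e j = (if i = j then 1 else 0)" and a: "\<And>i. 0 < a i" using ea by (auto simp: adapted_def)
    show "0 < a i" for i by (rule a)
    have rp: "0 < radial_fun (wulff k) u" and rm: "radial_fun (wulff k) u *\<^sub>R u \<in> wulff k" if "u \<in> unit_sphere" for u
    proof -
      have "u \<noteq> 0" using that by auto
      then show "0 < radial_fun (wulff k) u" "radial_fun (wulff k) u *\<^sub>R u \<in> wulff k" by (auto intro: radial_pos radial_mem)
    qed
    have "radial_fun (wulff k) u * \<bar>u \<bullet> e i\<bar> \<le> a i" if u: "u \<in> unit_sphere" for u i
    proof -
      have "\<bar>(radial_fun (wulff k) u *\<^sub>R u) \<bullet> e i\<bar> \<le> a i" using ea rm[OF u] unfolding adapted_def by blast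
      then show ?thesis using rp[OF u] by (simp add: abs_mult)
    qed
    then show "box_bounded e a (radial_fun (wulff k))"
      unfolding box_bounded_def using orth a rp radial_continuous by blast
    have "1 / k u * \<bar>u \<bullet> e i\<bar> \<le> ?D / a i" if u: "u \<in> unit_sphere" for u i
    proof -
      have "a i * \<bar>u \<bullet> e i\<bar> \<le> ?D * k u" using ea u unfolding adapted_def by blast
      then show ?thesis using a[of i] pos[OF u] by (simp add: field_simps)
    qed
    moreover have "0 < ?D / a i" for i using D a[of i] by (rule divide_pos_pos)
    moreover have "continuous_on unit_sphere (\<lambda>v. 1 / k v)" by (intro continuous_intros cont ballI nonzero)
    moreover have "0 < 1 / k u" if "u \<in> unit_sphere" for u using pos[OF that] by simp
    ultimately show "box_bounded e (\<lambda>i. ?D / a i) (\<lambda>v. 1 / k v)"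
      unfolding box_bounded_def using orth by blast
  qed
  show ?thesis
  proof (cases "?n \<le> q1")
    case True
    note qs' = qs[unfolded if_P[OF True]] and cb = critical_exponent_bounds[OF n2 True]
    have r1: "1 < r" "r \<le> ?n" using r rq True cb(2) qs' by auto
    define \<delta> where "\<delta> = 1 / r - 1 + (?n - 1) / q1"
    have \<delta>: "\<delta> = 1 / r - 1 / qs" using cb(3) by (simp add: \<delta>_def qs')
    have d0: "0 \<le> \<delta>" "r < qs \<longrightarrow> 0 < \<delta>" using \<delta> rq r0 by (auto simp: frac_le frac_less2)
    obtain C where C: "C > 0" and est: "\<forall>(e :: 'n \<Rightarrow> real^'n) b g1 g2 i j. box_bounded e b g1 \<longrightarrow> box_bounded e (\<lambda>i. ?D / b i) g2 \<longrightarrow>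
      sphere_mean q1 g1 * sphere_mean r g2 \<le> C * (b i / b j) powr (\<delta> / (?n - 1))"
      using product_estimate[where 'n = 'n, OF n _ r1 \<delta>_def d0(1) D] True by auto
    show ?thesis
    proof (rule exI[of _ C], intro conjI C, rule exI[of _ "\<delta> / (?n - 1)"], intro conjI allI impI)
      show "0 \<le> \<delta> / (?n - 1)" using d0 n2 by simp
      show "0 < \<delta> / (?n - 1)" if "r < qs" using d0 n2 that by simp
      fix k e a i j assume "admissible k" "adapted k e a"
      then show "sphere_mean q1 (radial_fun (wulff k)) * sphere_mean r (\<lambda>v. 1 / k v) \<le> C * (a i / a j) powr (\<delta> / (?n - 1))"
        by (intro est[rule_format] rad inv)
    qed
  next
    case False
    note qs' = qs[unfolded if_not_P[OF False]]
    have r1: "?n - 1 < r" using r False by simp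
    have q1n: "q1 \<le> ?n" using False by simp
    define \<delta> where "\<delta> = 1 / q1 - 1 + (?n - 1) / r"
    have "(?n - 1) / qs = 1 - 1 / q1" using q1 n2 by (simp add: qs' field_simps)
    then have \<delta>: "\<delta> = (?n - 1) / r - (?n - 1) / qs" by (simp add: \<delta>_def)
    have d0: "0 \<le> \<delta>" "r < qs \<longrightarrow> 0 < \<delta>" using \<delta> rq r0 n2 by (auto intro!: divide_left_mono divide_strict_left_mono)
    obtain C where C: "C > 0" and est: "\<forall>(e :: 'n \<Rightarrow> real^'n) b g1 g2 i j. box_bounded e b g1 \<longrightarrow> box_bounded e (\<lambda>i. ?D / b i) g2 \<longrightarrow>
      sphere_mean r g1 * sphere_mean q1 g2 \<le> C * (b i / b j) powr (\<delta> / (?n - 1))"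
      using product_estimate[where 'n = 'n, OF n r1 q1 q1n \<delta>_def d0(1) D] by blast
    show ?thesis
    proof (rule exI[of _ C], intro conjI C, rule exI[of _ "\<delta> / (?n - 1)"], intro conjI allI impI)
      show "0 \<le> \<delta> / (?n - 1)" using d0 n2 by simp
      show "0 < \<delta> / (?n - 1)" if "r < qs" using d0 n2 that by simp
      fix k e a i j assume ka: "admissible k" "adapted k e a"
      note ap = apos[OF ka]
      \<comment> \<open>With the boxes exchanged the half-axes are D / a, so taking reciprocals
        twice returns \<open>a\<close>, and the indices \<open>i\<close> and \<open>j\<close> trade
        places in the quotient.\<close>
      have "?D / (?D / a i) = a i" for i using D by simp
      then have "box_bounded e (\<lambda>i. ?D / (?D / a i)) (radial_fun (wulff k))" using rad[OF ka] by (simp only:)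
      with inv[OF ka] have "sphere_mean r (\<lambda>v. 1 / k v) * sphere_mean q1 (radial_fun (wulff k))
        \<le> C * ((?D / a j) / (?D / a i)) powr (\<delta> / (?n - 1))" by (rule est[rule_format])
      moreover have "(?D / a j) / (?D / a i) = a i / a j" using D ap[of i] ap[of j] by (simp add: field_simps)
      ultimately show "sphere_mean q1 (radial_fun (wulff k)) * sphere_mean r (\<lambda>v. 1 / k v) \<le> C * (a i / a j) powr (\<delta> / (?n - 1))"
        by (simp only: mult.commute)
    qed
  qed
qed

text \<open>
  The density is split at a high level: the bounded part gains from the subcritical exponent,
  and the remainder is small in \<open>L\<^sup>s\<close> and is paired with the critical exponent by Young's inequality.
\<close>

lemma polar_mean_split:
  assumes f: "f \<in> borel_measurable sphere_measure" "AE u in sphere_measure. 0 \<le> f u"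
    and Mf: "M = density sphere_measure (\<lambda>u. ennreal (f u))"
    and s: "1 < s" "1 / s + P / t = 1" "0 < t" and fs: "integrable sphere_measure (\<lambda>u. \<bar>f u\<bar> powr s)"
    and k: "positive_on_sphere k" and T: "0 \<le> T" and \<tau>: "0 < \<tau>" and X: "X = sphere_mean t (\<lambda>v. 1 / k v)"
  shows "polar_mean k \<le> T * (\<integral>v. (1 / k v) powr P \<partial>sphere_measure) +
    X powr P * (\<tau> powr s * (\<integral>u. \<bar>f u\<bar> powr s * indicator {u. T < f u} u \<partial>sphere_measure) + \<tau> powr (- (t / P)))"
proof -
  interpret positive_on_sphere k by fact
  define g where "g v = 1 / k v" for v
  have g: "positive_on_sphere g" unfolding g_def by unfold_locales (auto intro!: continuous_intros cont nonzero pos)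
  have gp: "0 < g v" if "v \<in> unit_sphere" for v using positive_on_sphere.pos[OF g that] .
  have int: "integrable sphere_measure (\<lambda>u. g u powr x)" for x
    by (intro continuous_integrable_sphere positive_on_sphere.continuous_powr[OF g] sets_sphere_measure finite_sphere_measure n)
  have Jpos: "0 < (\<integral>v. g v powr t \<partial>sphere_measure)" using g by (rule sphere_integral_powr_pos)
  have Xg: "X = (\<integral>v. g v powr t \<partial>sphere_measure) powr (1 / t)" by (simp add: X g_def sphere_mean_def)
  have X0: "0 < X" using Jpos by (simp add: Xg)
  have Xt: "X powr t = (\<integral>v. g v powr t \<partial>sphere_measure)" using Jpos s by (simp add: Xg powr_powr)
  have s': "1 < t / P"
  proof -
    have "0 < 1 / s" using s(1) by simp
    then have "P / t < 1" using s(2) by linarith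
    then show ?thesis using P s(3) by (simp add: field_simps)
  qed
  have ind: "integrable sphere_measure (\<lambda>u. \<bar>f u\<bar> powr s * indicator {u. T < f u} u)"
  proof -
    have "{u \<in> space sphere_measure. T < f u} \<in> sets sphere_measure" using f(1) by measurable
    then have "integrable sphere_measure (\<lambda>u. \<bar>f u\<bar> powr s * indicator {u \<in> space sphere_measure. T < f u} u)"
      using fs by (rule integrable_real_mult_indicator)
    then show ?thesis by (rule Bochner_Integration.integrable_cong[THEN iffD1, rotated -1]) (auto simp: indicator_def)
  qed
  have cgP: "g \<in> borel_measurable sphere_measure" by (rule continuous_imp_borel_sphere[OF positive_on_sphere.cont[OF g]]) simp
  have "polar_mean k = (\<integral>v. g v powr P \<partial>M)"
    unfolding polar_mean_def g_def by (intro Bochner_Integration.integral_cong) (auto simp: space_M inverse_powr pos)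
  also have "\<dots> = (\<integral>v. f v * g v powr P \<partial>sphere_measure)"
    unfolding Mf using f cgP by (subst integral_density) auto
  also have "\<dots> \<le> (\<integral>v. T * g v powr P + X powr P * (\<tau> powr s * (\<bar>f v\<bar> powr s * indicator {u. T < f u} v) +
      \<tau> powr (- (t / P)) * (g v powr t / X powr t)) \<partial>sphere_measure)"
  proof (rule integral_mono_AE)
    show "integrable sphere_measure (\<lambda>v. f v * g v powr P)"
    proof -
      have "integrable M (\<lambda>v. g v powr P)"
        by (intro continuous_integrable_sphere positive_on_sphere.continuous_powr[OF g] M)
      then show ?thesis unfolding Mf using f cgP by (subst (asm) integrable_density) auto
    qed
    show "integrable sphere_measure (\<lambda>v. T * g v powr P + X powr P * (\<tau> powr s * (\<bar>f v\<bar> powr s * indicator {u. T < f u} v) +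
      \<tau> powr (- (t / P)) * (g v powr t / X powr t)))"
      using int ind by (intro Bochner_Integration.integrable_add integrable_mult_right) auto
    show "AE v in sphere_measure. f v * g v powr P \<le> T * g v powr P + X powr P * (\<tau> powr s * (\<bar>f v\<bar> powr s * indicator {u. T < f u} v) +
      \<tau> powr (- (t / P)) * (g v powr t / X powr t))"
      using f(2) AE_space
    proof eventually_elim
      case (elim v)
      then have gv: "0 < g v" using gp by simp
      have nn: "0 \<le> X powr P * (\<tau> powr s * (\<bar>f v\<bar> powr s * indicator {u. T < f u} v) + \<tau> powr (- (t / P)) * (g v powr t / X powr t))"
        by (intro mult_nonneg_nonneg add_nonneg_nonneg divide_nonneg_nonneg) auto
      show ?case
      proof (cases "T < f v")
        case False
        then have "f v * g v powr P \<le> T * g v powr P" by (intro mult_right_mono) auto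
        then show ?thesis using nn by linarith
      next
        case True
        \<comment> \<open>Young's inequality for the conjugate exponents s and t / P, with a weight
          \<tau> that can be tuned later. The divisions by s and t / P in its right side are
          dropped, both being larger than 1.\<close>
        let ?y = "(g v / X) powr P / \<tau>"
        have y0: "0 \<le> ?y" using \<tau> by simp
        have "(\<tau> * f v) * ?y \<le> (\<tau> * f v) powr s / s + ?y powr (t / P) / (t / P)"
          using s s' elim y0 \<tau> by (intro Youngs_inequality) auto
        also have "\<dots> \<le> (\<tau> * f v) powr s + ?y powr (t / P)"
        proof -
          have le: "z / c \<le> z" if "0 \<le> z" "1 < c" for z c :: real
            using mult_left_mono[of 1 c z] that by (simp add: pos_divide_le_eq)
          show ?thesis using s(1) s' by (intro add_mono le) auto
        qed
        also have "(\<tau> * f v) powr s = \<tau> powr s * (\<bar>f v\<bar> powr s * indicator {u. T < f u} v)"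
          using elim \<tau> True by (simp add: powr_mult)
        also have "?y powr (t / P) = \<tau> powr (- (t / P)) * (g v powr t / X powr t)"
        proof -
          have "?y powr (t / P) = ((g v / X) powr P) powr (t / P) / \<tau> powr (t / P)"
            by (rule powr_divide)
          also have "((g v / X) powr P) powr (t / P) = g v powr t / X powr t"
            using P gv X0 by (simp add: powr_powr powr_divide)
          finally show ?thesis by (simp add: powr_minus_divide)
        qed
        also have "(\<tau> * f v) * ?y = f v * (g v powr P / X powr P)" using \<tau> gv X0 by (simp add: powr_divide)
        finally have "X powr P * (f v * (g v powr P / X powr P)) \<le> X powr P * (\<tau> powr s * (\<bar>f v\<bar> powr s * indicator {u. T < f u} v) +
            \<tau> powr (- (t / P)) * (g v powr t / X powr t))" by (intro mult_left_mono) auto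
        moreover have "X powr P * (f v * (g v powr P / X powr P)) = f v * g v powr P" using X0 by simp
        moreover have "0 \<le> T * g v powr P" using T by simp
        ultimately show ?thesis by linarith
      qed
    qed
  qed
  also have "\<dots> = T * (\<integral>v. g v powr P \<partial>sphere_measure) +
      X powr P * (\<tau> powr s * (\<integral>u. \<bar>f u\<bar> powr s * indicator {u. T < f u} u \<partial>sphere_measure) +
      \<tau> powr (- (t / P)) * ((\<integral>v. g v powr t \<partial>sphere_measure) / X powr t))"
    using int ind by simp
  also have "(\<integral>v. g v powr t \<partial>sphere_measure) / X powr t = 1" using X0 by (simp flip: Xt)
  finally show ?thesis by (simp add: g_def)
qed

text \<open>With A the L^q1 norm of the radial function, the dual volume factor is at most a
  constant times A, so it is enough to make A^P times \<open>polar_mean\<close> small. Of the parts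
  from \<open>polar_mean_split\<close>, the bounded one involves A Y with the subcritical norm Y,
  which decays, and the tail involves A X with the critical norm X, which is only bounded. Constants
  are fixed in the order \<tau>, N, \<kappa>.\<close>

lemma functional_decay:
  assumes f: "f \<in> borel_measurable sphere_measure" "AE u in sphere_measure. 0 \<le> f u"
    and Mf: "M = density sphere_measure (\<lambda>u. ennreal (f u))"
    and q1: "q \<le> q1" "1 < q1"
    and qs: "qs = (if real CARD('n) \<le> q1 then q1 / (q1 - real CARD('n) + 1) else (real CARD('n) - 1) * q1 / (q1 - 1))"
    and Pqs: "P < qs" and s: "1 < s" "1 / s + P / qs = 1" and fs: "integrable sphere_measure (\<lambda>u. \<bar>f u\<bar> powr s)"
    and \<eta>: "0 < \<eta>"
  shows "\<exists>\<kappa>>0. \<forall>k e a i j. admissible k \<longrightarrow> adapted k e a \<longrightarrow> a i < \<kappa> * a j \<longrightarrow> functional k < \<eta>"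
proof -
  let ?n = "real CARD('n)" let ?S = "measure sphere_measure (unit_sphere :: (real^'n) set)"
  have n2: "2 \<le> ?n" using n by simp
  define r0 where "r0 = (if ?n \<le> q1 then 1 else ?n - 1)"
  have r0: "r0 < qs" "1 \<le> r0"
  proof -
    show "r0 < qs"
    proof (cases "?n \<le> q1")
      case True then show ?thesis using critical_exponent_bounds(1)[OF n2 True] by (simp add: r0_def qs)
    next
      case False
      have "?n - 1 < (?n - 1) * q1 / (q1 - 1)" using q1(2) n2 by (simp add: pos_less_divide_eq)
      then show ?thesis using False by (simp add: r0_def qs)
    qed
    show "1 \<le> r0" using n2 by (simp add: r0_def)
  qed
  then obtain r where r: "r0 < r" "P < r" "r < qs" using dense[of "max r0 P" qs] Pqs by auto
  have qs0: "0 < qs" using P Pqs by simp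
  have rp: "0 < r" using r P by simp
  obtain C0 \<delta>0 where C0: "0 < C0" and est0: "\<And>k e a i j. admissible k \<Longrightarrow> adapted k e a \<Longrightarrow>
      sphere_mean q1 (radial_fun (wulff k)) * sphere_mean qs (\<lambda>v. 1 / k v)
      \<le> C0 * (a i / a j) powr \<delta>0"
    using pair_estimate[OF q1(2) _ qs order_refl] r0(1) unfolding r0_def by blast
  obtain C1 \<delta>1 where C1: "0 < C1" "0 < \<delta>1" and est1: "\<And>k e a i j. admissible k \<Longrightarrow> adapted k e a \<Longrightarrow>
      sphere_mean q1 (radial_fun (wulff k)) * sphere_mean r (\<lambda>v. 1 / k v)
      \<le> C1 * (a i / a j) powr \<delta>1"
    using pair_estimate[OF q1(2) _ qs less_imp_le[OF r(3)]] r(1,3) unfolding r0_def by blast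
  obtain cw Cw where Cw: "0 < cw" "\<And>u. u \<in> unit_sphere \<Longrightarrow> cw \<le> w u \<and> w u \<le> Cw" "0 < Cw" using w_bounds by metis
  have S0: "0 < ?S" by (rule sphere_measure_pos)
  define K1 where "K1 = (Cw * (?S + 1)) powr (1 / q)"
  have K1: "0 < K1" using Cw S0 by (simp add: K1_def)
  \<comment> \<open>The target for A^P times \<open>polar_mean\<close>, since K1 \<epsilon>^(1/P) =
    \<eta>. It is met by two errors below \<epsilon>/3 and one equal to \<epsilon>/4.\<close>
  define \<epsilon> where "\<epsilon> = (\<eta> / K1) powr P"
  have \<epsilon>: "0 < \<epsilon>" using \<eta> K1 by (simp add: \<epsilon>_def)
  \<comment> \<open>Solves C0^P \<tau>^(-qs/P) = \<epsilon>/4, the share of the last term of Young's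
    inequality.\<close>
  define \<tau> where "\<tau> = (\<epsilon> / (4 * C0 powr P)) powr (- (P / qs))"
  have e4: "0 < \<epsilon> / (4 * C0 powr P)" using \<epsilon> C0 by simp
  have \<tau>: "0 < \<tau>" unfolding \<tau>_def using e4 by (rule powr_pos)
  have \<tau>t: "\<tau> powr (- (qs / P)) = \<epsilon> / (4 * C0 powr P)" unfolding \<tau>_def using e4 \<epsilon> P qs0 by (simp add: powr_powr)
  \<comment> \<open>The tail of the L^s integral tends to 0 by dominated convergence. The level N is
    chosen after \<tau>, whose possibly large power multiplies the tail.\<close>
  define ET where "ET T = (\<integral>u. \<bar>f u\<bar> powr s * indicator {u. T < f u} u \<partial>sphere_measure)" for T
  have "(\<lambda>N. ET (real N)) \<longlonglongrightarrow> (\<integral>u. 0 \<partial>(sphere_measure :: (real^'n) measure))"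
    unfolding ET_def
  proof (rule integral_dominated_convergence[where w = "\<lambda>u. \<bar>f u\<bar> powr s"])
    fix N
    have "(\<lambda>u. \<bar>f u\<bar> powr s * indicator {u \<in> space sphere_measure. real N < f u} u) \<in> borel_measurable sphere_measure"
      using f(1) by measurable
    then show "(\<lambda>u. \<bar>f u\<bar> powr s * indicator {u. real N < f u} u) \<in> borel_measurable sphere_measure"
      by (rule measurable_cong[THEN iffD1, rotated]) (auto simp: indicator_def)
    show "AE u in sphere_measure. norm (\<bar>f u\<bar> powr s * indicator {u. real N < f u} u) \<le> \<bar>f u\<bar> powr s"
      by (auto simp: indicator_def)
  next
    show "AE u in sphere_measure. (\<lambda>N. \<bar>f u\<bar> powr s * indicator {u. real N < f u} u) \<longlonglongrightarrow> 0"
    proof (rule AE_I2)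
      fix u
      obtain N0 where "f u \<le> real N0" using real_arch_simple by blast
      then have "\<forall>\<^sub>F N in sequentially. \<bar>f u\<bar> powr s * indicator {u. real N < f u} u = 0"
        unfolding eventually_sequentially by (intro exI[of _ N0]) (auto simp: indicator_def)
      then show "(\<lambda>N. \<bar>f u\<bar> powr s * indicator {u. real N < f u} u) \<longlonglongrightarrow> 0" by (rule tendsto_eventually)
    qed
  qed (use fs in auto)
  then have "(\<lambda>N. C0 powr P * (\<tau> powr s * ET (real N))) \<longlonglongrightarrow> C0 powr P * (\<tau> powr s * 0)"
    by (intro tendsto_mult tendsto_const) simp
  then have "\<forall>\<^sub>F N in sequentially. C0 powr P * (\<tau> powr s * ET (real N)) < \<epsilon> / 3"
    using \<epsilon> by (intro order_tendstoD(2)) auto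
  then obtain N where N: "C0 powr P * (\<tau> powr s * ET (real N)) < \<epsilon> / 3" by (auto simp: eventually_sequentially)
  define B where "B = real N * (?S + 1)"
  have B: "0 \<le> B" using S0 by (simp add: B_def)
  \<comment> \<open>The size of A Y that makes the bounded part less than \<epsilon>/3; B + 1
    instead of B avoids dividing by zero.\<close>
  define y where "y = (\<epsilon> / (4 * (B + 1))) powr (1 / P)"
  have yp: "0 < \<epsilon> / (4 * (B + 1))" using \<epsilon> B by simp
  have y: "0 < y" unfolding y_def using yp by (rule powr_pos)
  have yP: "y powr P = \<epsilon> / (4 * (B + 1))" unfolding y_def using yp \<epsilon> B P by (simp add: powr_powr)
  have By: "B * y powr P < \<epsilon> / 3"
  proof -
    have "B * y powr P = \<epsilon> / 4 * (B / (B + 1))" by (simp add: yP)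
    also have "\<dots> \<le> \<epsilon> / 4 * 1" using B \<epsilon> by (intro mult_left_mono) auto
    finally show ?thesis using \<epsilon> by simp
  qed
  \<comment> \<open>Solves C1 \<kappa>^\<delta>1 = y, so that boxes of larger eccentricity have A Y
    at most \<open>y\<close>.\<close>
  define \<kappa> where "\<kappa> = (y / C1) powr (1 / \<delta>1)"
  have yC: "0 < y / C1" using y C1 by simp
  have \<kappa>: "0 < \<kappa>" unfolding \<kappa>_def using yC by (rule powr_pos)
  have \<kappa>\<delta>: "\<kappa> powr \<delta>1 = y / C1" unfolding \<kappa>_def using yC y C1 by (simp add: powr_powr)
  have "functional k < \<eta>" if k: "admissible k" and ea: "adapted k e a" and ij: "a i < \<kappa> * a j" for k e a i j
  proof -
    interpret positive_on_sphere k using k by (rule admissibleD)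
    have ap: "0 < a i" for i using ea by (simp add: adapted_def)
    define A where "A = sphere_mean q1 (radial_fun (wulff k))"
    define X where "X = sphere_mean qs (\<lambda>v. 1 / k v)"
    define Y where "Y = sphere_mean r (\<lambda>v. 1 / k v)"
    have radp: "positive_on_sphere (radial_fun (wulff k))"
    proof
      show "continuous_on unit_sphere (radial_fun (wulff k))" by (rule radial_continuous)
      fix u :: "real^'n" assume "u \<in> unit_sphere"
      then have "u \<noteq> 0" by auto
      then show "0 < radial_fun (wulff k) u" by (rule radial_pos)
    qed
    have invp: "positive_on_sphere (\<lambda>v. 1 / k v)" by unfold_locales (auto intro!: continuous_intros cont nonzero pos)
    have Ap: "0 < A" and Xp: "0 < X" and Yp: "0 < Y"
      unfolding A_def X_def Y_def sphere_mean_def by (intro powr_pos sphere_integral_powr_pos radp invp)+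
    \<comment> \<open>Equal indices make the quotient of half-axes 1, leaving the bare constant of
      the critical pairing.\<close>
    have AX: "A * X \<le> C0" using est0[OF k ea, of i i] ap[of i] by (simp add: A_def X_def)
    have "(a i / a j) powr \<delta>1 \<le> \<kappa> powr \<delta>1"
      using ij ap[of i] ap[of j] C1(2) by (intro powr_mono2) (auto simp: pos_divide_le_eq)
    then have "C1 * (a i / a j) powr \<delta>1 \<le> y" using C1 by (simp add: \<kappa>\<delta> pos_le_divide_eq mult.commute)
    then have AY: "A * Y \<le> y" using est1[OF k ea, of i j] unfolding A_def Y_def by linarith
    have "dual_volume k \<le> (\<integral>u. Cw * radial_fun (wulff k) u powr q \<partial>sphere_measure)"
      unfolding dual_volume_def
    proof (rule integral_mono)
      show "integrable sphere_measure (\<lambda>u. radial_fun (wulff k) u powr q * w u)" by (rule dual_volume_integrable) unfold_locales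
      show "integrable sphere_measure (\<lambda>u. Cw * radial_fun (wulff k) u powr q)"
        by (intro integrable_mult_right continuous_integrable_sphere continuous_radial_powr sets_sphere_measure finite_sphere_measure n)
      fix u :: "real^'n" assume "u \<in> space sphere_measure"
      then have "w u \<le> Cw" using Cw(2) by simp
      then have "radial_fun (wulff k) u powr q * w u \<le> radial_fun (wulff k) u powr q * Cw" by (intro mult_left_mono) auto
      then show "radial_fun (wulff k) u powr q * w u \<le> Cw * radial_fun (wulff k) u powr q" by (simp add: mult.commute)
    qed
    also have "\<dots> = Cw * (\<integral>u. radial_fun (wulff k) u powr q \<partial>sphere_measure)" by simp
    also have "\<dots> \<le> Cw * (A powr q * (?S + 1))"
      using lower_mean_le[OF n radp q q1(1) sphere_integral_powr_pos[OF radp]] Cw(3) unfolding A_def by (intro mult_left_mono) auto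
    finally have "dual_volume k \<le> (Cw * (?S + 1)) * A powr q" by (simp add: mult_ac)
    then have "dual_volume k powr (1 / q) \<le> ((Cw * (?S + 1)) * A powr q) powr (1 / q)"
      using dual_volume_pos[of k] q by (intro powr_mono2) (auto simp: less_imp_le positive_on_sphere_axioms)
    also have "\<dots> = K1 * A" using Cw(3) S0 Ap q by (simp add: K1_def powr_mult powr_powr)
    finally have V: "dual_volume k powr (1 / q) \<le> K1 * A" .
    have YP: "(\<integral>v. (1 / k v) powr P \<partial>sphere_measure) \<le> Y powr P * (?S + 1)"
      using lower_mean_le[OF n invp P less_imp_le[OF r(2)] sphere_integral_powr_pos[OF invp]] by (simp add: Y_def)
    have "polar_mean k \<le> real N * (\<integral>v. (1 / k v) powr P \<partial>sphere_measure) +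
        X powr P * (\<tau> powr s * ET (real N) + \<tau> powr (- (qs / P)))"
      unfolding ET_def by (rule polar_mean_split[OF f Mf s qs0 fs _ _ \<tau> X_def]) (unfold_locales, simp)
    also have "\<dots> \<le> real N * (Y powr P * (?S + 1)) + X powr P * (\<tau> powr s * ET (real N) + \<tau> powr (- (qs / P)))"
      using YP by (intro add_right_mono mult_left_mono) auto
    also have "\<dots> = B * Y powr P + X powr P * (\<tau> powr s * ET (real N) + \<epsilon> / (4 * C0 powr P))"
      by (simp only: \<tau>t B_def mult_ac)
    finally have "A powr P * polar_mean k \<le> A powr P * (B * Y powr P + X powr P * (\<tau> powr s * ET (real N) + \<epsilon> / (4 * C0 powr P)))"
      by (intro mult_left_mono) auto
    also have "\<dots> = B * (A * Y) powr P + (A * X) powr P * (\<tau> powr s * ET (real N) + \<epsilon> / (4 * C0 powr P))"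
      using Ap Xp Yp by (simp add: powr_mult algebra_simps)
    also have "\<dots> \<le> B * y powr P + C0 powr P * (\<tau> powr s * ET (real N) + \<epsilon> / (4 * C0 powr P))"
    proof (intro add_mono mult_left_mono mult_right_mono powr_mono2)
      have "0 \<le> ET (real N)" unfolding ET_def by (intro integral_nonneg_AE) (auto simp: indicator_def)
      then show "0 \<le> \<tau> powr s * ET (real N) + \<epsilon> / (4 * C0 powr P)" using e4 by simp
    qed (use AX AY B P Ap Xp Yp in auto)
    also have "C0 powr P * (\<tau> powr s * ET (real N) + \<epsilon> / (4 * C0 powr P)) = C0 powr P * (\<tau> powr s * ET (real N)) + \<epsilon> / 4"
      using C0 by (simp add: distrib_left)
    finally have AI: "A powr P * polar_mean k < \<epsilon>" using N By \<epsilon> by linarith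
    have pm: "0 < polar_mean k" by (rule polar_mean_pos) unfold_locales
    have "functional k \<le> K1 * A * polar_mean k powr (1 / P)"
      unfolding functional_def using V by (intro mult_right_mono) auto
    also have "\<dots> = K1 * (A powr P * polar_mean k) powr (1 / P)" using Ap pm P by (simp add: powr_mult powr_powr)
    also have "\<dots> < K1 * \<epsilon> powr (1 / P)" using AI K1 P Ap pm by (intro mult_strict_left_mono powr_less_mono2) auto
    also have "\<dots> = \<eta>" using K1 \<eta> P by (simp add: \<epsilon>_def powr_powr)
    finally show ?thesis .
  qed
  then show ?thesis using \<kappa> by blast
qed

end

section \<open>Invariant measures are determined by invariant functions\<close>

text \<open>Monomials are indexed by words in the coordinates rather than by multi-indices, so
  powers of the inner product expand without multinomial coefficients.\<close>

definition monomial_fun :: "'n list \<Rightarrow> real^'n \<Rightarrow> real" where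
  "monomial_fun c x = (\<Prod>i\<leftarrow>c. x $ i)"

lemma monomial_fun_simps [simp]: "monomial_fun [] x = 1" "monomial_fun (i # c) x = x $ i * monomial_fun c x"
  by (simp_all add: monomial_fun_def)

lemma continuous_monomial_fun: "continuous_on S (monomial_fun c)"
proof (induction c)
  case Nil
  have "monomial_fun [] = (\<lambda>x :: real^'a. 1)" by (simp add: fun_eq_iff)
  then show ?case by simp
next
  case (Cons i c)
  have "monomial_fun (i # c) = (\<lambda>x. x $ i * monomial_fun c x)" by (simp add: fun_eq_iff)
  then show ?case using Cons by (simp add: continuous_intros)
qed

lemma inner_power_eq_sum_monomial_fun:
  fixes x y :: "real^'n"
  shows "(x \<bullet> y) ^ m = (\<Sum>c | length c = m. monomial_fun c x * monomial_fun c y)"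
proof (induction m)
  case 0
  have "{c :: 'n list. length c = 0} = {[]}" by auto
  then show ?case by simp
next
  case (Suc m)
  let ?L = "{c :: 'n list. length c = m}"
  have "(\<Sum>c | length c = Suc m. monomial_fun c x * monomial_fun c y) =
      (\<Sum>(i, c)\<in>UNIV \<times> ?L. monomial_fun (i # c) x * monomial_fun (i # c) y)"
    by (rule sum.reindex_bij_witness[of _ "\<lambda>(i, c). i # c" "\<lambda>c. (hd c, tl c)"]) (auto simp: length_Suc_conv)
  also have "\<dots> = (\<Sum>i\<in>UNIV. \<Sum>c\<in>?L. (x $ i * y $ i) * (monomial_fun c x * monomial_fun c y))"
    by (subst sum.cartesian_product[symmetric]) (simp add: mult_ac)
  also have "\<dots> = (\<Sum>i\<in>UNIV. x $ i * y $ i) * (\<Sum>c\<in>?L. monomial_fun c x * monomial_fun c y)"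
    by (rule sum_product[symmetric])
  also have "\<dots> = (x \<bullet> y) * (x \<bullet> y) ^ m"
    unfolding Suc.IH[symmetric] by (simp add: inner_vec_def)
  finally show ?case by simp
qed

text \<open>
  Integrating the kernel \<open>(x \<bullet> y)\<^sup>m\<close> against the difference of the two measures in \<open>y\<close> yields an
  invariant function of \<open>x\<close>. Integrating once more gives a sum of squares of moments, so all moments
  of the difference vanish. This replaces averaging over the group.
\<close>

lemma invariant_measures_moments_eq:
  fixes N1 N2 :: "(real^'n) measure"
  assumes N1: "sets N1 = sets borel_sphere" "finite_measure N1" and N2: "sets N2 = sets borel_sphere" "finite_measure N2"
    and G: "\<And>g. g \<in> G \<Longrightarrow> orthogonal_matrix g" "\<And>g. g \<in> G \<Longrightarrow> transpose g \<in> G"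
    and inv1: "\<And>g (\<psi> :: real^'n \<Rightarrow> real). g \<in> G \<Longrightarrow> continuous_on unit_sphere \<psi> \<Longrightarrow> (\<integral>y. \<psi> (g *v y) \<partial>N1) = (\<integral>y. \<psi> y \<partial>N1)"
    and inv2: "\<And>g (\<psi> :: real^'n \<Rightarrow> real). g \<in> G \<Longrightarrow> continuous_on unit_sphere \<psi> \<Longrightarrow> (\<integral>y. \<psi> (g *v y) \<partial>N2) = (\<integral>y. \<psi> y \<partial>N2)"
    and eq: "\<And>\<phi> :: real^'n \<Rightarrow> real. continuous_on unit_sphere \<phi> \<Longrightarrow> (\<And>g v. g \<in> G \<Longrightarrow> v \<in> unit_sphere \<Longrightarrow> \<phi> (g *v v) = \<phi> v) \<Longrightarrow>
      (\<integral>y. \<phi> y \<partial>N1) = (\<integral>y. \<phi> y \<partial>N2)"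
  shows "(\<integral>y. monomial_fun c y \<partial>N1) = (\<integral>y. monomial_fun c y \<partial>N2)"
proof -
  define d where "d c = (\<integral>y. monomial_fun c y \<partial>N1) - (\<integral>y. monomial_fun c y \<partial>N2)" for c :: "'n list"
  let ?L = "{c' :: 'n list. length c' = length c}"
  have fin: "finite ?L" using finite_lists_length_eq[of "UNIV :: 'n set" "length c"] by simp
  define \<phi> where "\<phi> x = (\<Sum>c\<in>?L. monomial_fun c x * d c)" for x :: "real^'n"
  have int: "integrable N1 (monomial_fun c)" "integrable N2 (monomial_fun c)" for c
    by (intro continuous_integrable_sphere continuous_monomial_fun N1 N2)+
  have \<phi>: "\<phi> x = (\<integral>y. (x \<bullet> y) ^ length c \<partial>N1) - (\<integral>y. (x \<bullet> y) ^ length c \<partial>N2)" for x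
    unfolding inner_power_eq_sum_monomial_fun \<phi>_def d_def using int
    by (simp add: right_diff_distrib sum_subtractf)
  have c\<phi>: "continuous_on unit_sphere \<phi>" unfolding \<phi>_def by (intro continuous_intros continuous_monomial_fun)
  have "\<phi> (g *v v) = \<phi> v" if g: "g \<in> G" for g v
  proof -
    have mv: "(g *v v) \<bullet> y = v \<bullet> (transpose g *v y)" for y
      using inner_orthogonal_matrix_mult[OF G(1)[OF g], of v "transpose g *v y"]
        orthogonal_matrix_transpose_mult(1)[OF G(1)[OF g], of y] by simp
    have ct: "continuous_on unit_sphere (\<lambda>y. (v \<bullet> y) ^ length c)" by (intro continuous_intros)
    show ?thesis unfolding \<phi> mv inv1[OF G(2)[OF g] ct] inv2[OF G(2)[OF g] ct] ..
  qed
  then have "(\<integral>y. \<phi> y \<partial>N1) = (\<integral>y. \<phi> y \<partial>N2)" by (intro eq c\<phi>)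
  moreover have "(\<integral>y. \<phi> y \<partial>N1) = (\<Sum>c\<in>?L. (\<integral>y. monomial_fun c y \<partial>N1) * d c)"
    "(\<integral>y. \<phi> y \<partial>N2) = (\<Sum>c\<in>?L. (\<integral>y. monomial_fun c y \<partial>N2) * d c)"
    unfolding \<phi>_def using int by simp_all
  ultimately have "(\<Sum>c\<in>?L. d c * d c) = 0" by (simp add: d_def left_diff_distrib sum_subtractf)
  then have "\<forall>c\<in>?L. d c * d c = 0" using fin by (subst (asm) sum_nonneg_eq_0_iff) auto
  then have "d c = 0" by simp
  then show ?thesis by (simp add: d_def)
qed

text \<open>Equality of integrals is not preserved by products, so the induction runs on a stronger
  claim: multiplication by the polynomial maps the set \<open>E\<close> into itself, where
  \<open>E\<close> tests against every further monomial.\<close>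

lemma moments_eq_imp_polynomial_integral_eq:
  fixes N1 N2 :: "(real^'n) measure"
  assumes N1: "sets N1 = sets borel_sphere" "finite_measure N1" and N2: "sets N2 = sets borel_sphere" "finite_measure N2"
    and mom: "\<And>c. (\<integral>y. monomial_fun c y \<partial>N1) = (\<integral>y. monomial_fun c y \<partial>N2)" and p: "real_polynomial_function p"
  shows "(\<integral>y. p y \<partial>N1) = (\<integral>y. p y \<partial>N2)"
proof -
  define E where "E = {\<phi> :: real^'n \<Rightarrow> real. continuous_on unit_sphere \<phi> \<and>
    (\<forall>c. (\<integral>y. \<phi> y * monomial_fun c y \<partial>N1) = (\<integral>y. \<phi> y * monomial_fun c y \<partial>N2))}"
  have int: "integrable N1 (\<lambda>y. \<phi> y * monomial_fun c y)" "integrable N2 (\<lambda>y. \<phi> y * monomial_fun c y)"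
    if "continuous_on unit_sphere \<phi>" for \<phi> c
    using that by (intro continuous_integrable_sphere continuous_on_mult continuous_monomial_fun N1 N2; simp)+
  have Eadd: "(\<lambda>y. \<phi> y + \<psi> y) \<in> E" if "\<phi> \<in> E" "\<psi> \<in> E" for \<phi> \<psi>
    using that int by (auto simp: E_def distrib_right intro!: continuous_intros)
  have Ecm: "(\<lambda>y. a * \<phi> y) \<in> E" if "\<phi> \<in> E" for a \<phi>
    using that by (auto simp: E_def mult.assoc intro!: continuous_intros)
  have Ex: "(\<lambda>y. y $ i * \<phi> y) \<in> E" if "\<phi> \<in> E" for i \<phi>
  proof -
    have "(\<integral>y. y $ i * \<phi> y * monomial_fun c y \<partial>N) = (\<integral>y. \<phi> y * monomial_fun (i # c) y \<partial>N)" for c and N :: "(real^'n) measure"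
      by (simp add: mult_ac)
    then show ?thesis using that by (auto simp: E_def intro!: continuous_intros simp del: monomial_fun_simps)
  qed
  have Esum: "(\<lambda>y. \<Sum>i\<in>A. F i y) \<in> E" if "finite A" "\<And>i. i \<in> A \<Longrightarrow> F i \<in> E" for A :: "'n set" and F
    using that
  proof (induction A rule: finite_induct)
    case empty
    show ?case by (simp add: E_def)
  next
    case (insert x A)
    then show ?case using Eadd[of "F x" "\<lambda>y. \<Sum>i\<in>A. F i y"] by simp
  qed
  have stable: "\<forall>\<phi>\<in>E. (\<lambda>y. p y * \<phi> y) \<in> E"
    using p
  proof (induction p)
    case (linear f)
    show ?case
    proof
      fix \<phi> assume \<phi>: "\<phi> \<in> E"
      have fy: "f y = (\<Sum>i\<in>UNIV. y $ i * f (axis i 1))" for y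
      proof -
        interpret bounded_linear f by fact
        have "f y = f (\<Sum>i\<in>UNIV. y $ i *\<^sub>R axis i 1)" using basis_expansion[of y] by (simp add: scalar_mult_eq_scaleR)
        then show ?thesis by (simp add: sum scaleR)
      qed
      have "(\<lambda>y. f y * \<phi> y) = (\<lambda>y. \<Sum>i\<in>UNIV. f (axis i 1) * (y $ i * \<phi> y))"
        by (rule ext, subst fy) (simp add: sum_distrib_left sum_distrib_right mult_ac)
      then show "(\<lambda>y. f y * \<phi> y) \<in> E" using Esum[of UNIV "\<lambda>i y. f (axis i 1) * (y $ i * \<phi> y)"] Ecm Ex[OF \<phi>] by simp
    qed
  next
    case (const c)
    then show ?case using Ecm by simp
  next
    case (add f g)
    then show ?case using Eadd by (simp add: distrib_right)
  next
    case (mult f g)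
    then show ?case by (simp add: mult.assoc)
  qed
  have "(\<lambda>_. 1) \<in> E" using mom by (simp add: E_def)
  from bspec[OF stable this] have "(\<integral>y. p y * 1 * monomial_fun [] y \<partial>N1) = (\<integral>y. p y * 1 * monomial_fun [] y \<partial>N2)"
    unfolding E_def by blast
  then show ?thesis by simp
qed

text \<open>Stone-Weierstrass extends equality to continuous functions, distance functions carry it
  to closed sets, and these are an intersection-stable generator of the Borel sets.\<close>

lemma polynomial_integral_eq_imp_measure_eq:
  fixes N1 N2 :: "(real^'n) measure"
  assumes N1: "sets N1 = sets borel_sphere" "finite_measure N1" and N2: "sets N2 = sets borel_sphere" "finite_measure N2"
    and poly: "\<And>p. real_polynomial_function p \<Longrightarrow> (\<integral>y. p y \<partial>N1) = (\<integral>y. p y \<partial>N2)"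
  shows "N1 = N2"
proof -
  have sp: "space N = unit_sphere" if "sets N = sets borel_sphere" for N :: "(real^'n) measure"
    using sets_eq_imp_space_eq[OF that] by (simp add: space_borel_sphere)
  have near: "\<bar>(\<integral>y. \<phi> y \<partial>N) - (\<integral>y. p y \<partial>N)\<bar> \<le> e * measure N unit_sphere"
    if N: "sets N = sets borel_sphere" "finite_measure N" and \<phi>: "continuous_on unit_sphere \<phi>" and p: "continuous_on unit_sphere p"
      and e: "\<And>x. x \<in> unit_sphere \<Longrightarrow> \<bar>\<phi> x - p x\<bar> < e" for N :: "(real^'n) measure" and \<phi> p :: "real^'n \<Rightarrow> real" and e
  proof -
    interpret finite_measure N by fact
    note int = continuous_integrable_sphere[OF _ N]
    have "\<bar>(\<integral>y. \<phi> y \<partial>N) - (\<integral>y. p y \<partial>N)\<bar> = \<bar>\<integral>y. \<phi> y - p y \<partial>N\<bar>" by (simp add: int \<phi> p)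
    also have "\<dots> \<le> (\<integral>y. \<bar>\<phi> y - p y\<bar> \<partial>N)" by (rule integral_abs_bound)
    also have "\<dots> \<le> (\<integral>y. e \<partial>N)"
      using e by (intro integral_mono int continuous_intros \<phi> p) (auto simp: sp[OF N(1)] less_imp_le)
    finally show ?thesis by (simp add: sp[OF N(1)] mult.commute)
  qed
  have cont_eq: "(\<integral>y. \<phi> y \<partial>N1) = (\<integral>y. \<phi> y \<partial>N2)" if \<phi>: "continuous_on unit_sphere \<phi>" for \<phi> :: "real^'n \<Rightarrow> real"
  proof -
    let ?m = "measure N1 unit_sphere + measure N2 unit_sphere"
    have "\<bar>(\<integral>y. \<phi> y \<partial>N1) - (\<integral>y. \<phi> y \<partial>N2)\<bar> \<le> e" if "0 < e" for e
    proof -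
      have m: "0 \<le> ?m" by simp
      then have m1: "0 < ?m + 1" by linarith
      then have e': "0 < e / (?m + 1)" using \<open>0 < e\<close> by (rule divide_pos_pos[rotated])
      obtain p where p: "real_polynomial_function p" "\<And>x. x \<in> unit_sphere \<Longrightarrow> \<bar>\<phi> x - p x\<bar> < e / (?m + 1)"
        using Stone_Weierstrass_real_polynomial_function[OF compact_sphere \<phi> e'] by blast
      have pc: "continuous_on unit_sphere p"
        using p(1) by (simp add: real_polynomial_function_eq continuous_on_polymonial_function)
      have "\<bar>(\<integral>y. \<phi> y \<partial>N1) - (\<integral>y. \<phi> y \<partial>N2)\<bar> \<le> e / (?m + 1) * measure N1 unit_sphere + e / (?m + 1) * measure N2 unit_sphere"
        using near[OF N1 \<phi> pc p(2)] near[OF N2 \<phi> pc p(2)] poly[OF p(1)] by linarith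
      also have "\<dots> = e * (?m / (?m + 1))" by (simp add: add_divide_distrib distrib_left)
      also have "\<dots> \<le> e * 1"
      proof (rule mult_left_mono)
        show "?m / (?m + 1) \<le> 1" using m1 by (simp only: pos_divide_le_eq) simp
      qed (use \<open>0 < e\<close> in simp)
      finally show ?thesis by simp
    qed
    note small = this
    have "\<bar>(\<integral>y. \<phi> y \<partial>N1) - (\<integral>y. \<phi> y \<partial>N2)\<bar> \<le> 0"
    proof (rule field_le_epsilon)
      show "\<bar>(\<integral>y. \<phi> y \<partial>N1) - (\<integral>y. \<phi> y \<partial>N2)\<bar> \<le> 0 + e" if "0 < e" for e using small[OF that] by simp
    qed
    then show ?thesis by simp
  qed
  \<comment> \<open>The integrands decrease to the indicator of \<open>F\<close>. The empty set is
    excluded because \<open>infdist\<close> to it is 0, which would give limit 1.\<close>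
  have closed_lim: "(\<lambda>k. \<integral>y. max 0 (1 - real k * infdist y F) \<partial>N) \<longlonglongrightarrow> measure N F"
    if N: "sets N = sets borel_sphere" "finite_measure N" and F: "closed F" "F \<subseteq> unit_sphere" "F \<noteq> {}"
    for N :: "(real^'n) measure" and F
  proof -
    interpret finite_measure N by fact
    have Fs: "F \<in> sets N" using F by (auto simp: N(1) sets_borel_sphere intro: borel_closed)
    have "(\<lambda>k. \<integral>y. max 0 (1 - real k * infdist y F) \<partial>N) \<longlonglongrightarrow> (\<integral>y. indicator F y \<partial>N)"
    proof (rule integral_dominated_convergence[where w = "\<lambda>_. 1"])
      show "(\<lambda>y. max 0 (1 - real k * infdist y F)) \<in> borel_measurable N" for k
        by (intro continuous_imp_borel_sphere N continuous_intros)
      show "AE y in N. norm (max 0 (1 - real k * infdist y F)) \<le> 1" for k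
        by (intro AE_I2) (auto simp: infdist_nonneg)
      show "AE y in N. (\<lambda>k. max 0 (1 - real k * infdist y F)) \<longlonglongrightarrow> indicator F y"
      proof (rule AE_I2)
        fix y
        show "(\<lambda>k. max 0 (1 - real k * infdist y F)) \<longlonglongrightarrow> indicator F y"
        proof (cases "y \<in> F")
          case True
          then show ?thesis by simp
        next
          case False
          then have d: "0 < infdist y F"
            using in_closed_iff_infdist_zero[OF F(1,3), of y] infdist_nonneg[of y F] by linarith
          obtain K where "1 < real K * infdist y F" using ex_less_of_nat_mult[OF d] by blast
          then have "\<forall>\<^sub>F k in sequentially. max 0 (1 - real k * infdist y F) = indicator F y"
            unfolding eventually_sequentially
          proof (intro exI[of _ K] allI impI)
            fix k assume "K \<le> k"
            then have "real K * infdist y F \<le> real k * infdist y F" using d by (intro mult_right_mono) auto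
            then show "max 0 (1 - real k * infdist y F) = indicator F y" using \<open>1 < real K * infdist y F\<close> False by simp
          qed
          then show ?thesis by (rule tendsto_eventually)
        qed
      qed
    qed (use Fs in auto)
    then show ?thesis using Fs by simp
  qed
  have closed_eq: "emeasure N1 F = emeasure N2 F" if F: "closed F" "F \<subseteq> unit_sphere" for F
  proof (cases "F = {}")
    case False
    have "(\<lambda>k. \<integral>y. max 0 (1 - real k * infdist y F) \<partial>N1) \<longlonglongrightarrow> measure N2 F"
      using closed_lim[OF N2 F False] cont_eq[of "\<lambda>y. max 0 (1 - real k * infdist y F)" for k]
      by (simp add: continuous_intros)
    then have "measure N1 F = measure N2 F" using closed_lim[OF N1 F False] LIMSEQ_unique by blast
    then show ?thesis by (simp add: finite_measure.emeasure_eq_measure N1 N2)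
  qed simp
  show ?thesis
  proof (rule measure_eqI_generator_eq[of "{F :: (real^'n) set. closed F \<and> F \<subseteq> unit_sphere}" unit_sphere N1 N2 "\<lambda>_. unit_sphere"])
    show "Int_stable {F :: (real^'n) set. closed F \<and> F \<subseteq> unit_sphere}" by (auto simp: Int_stable_def)
    show "sets N1 = sigma_sets unit_sphere {F. closed F \<and> F \<subseteq> unit_sphere}"
      "sets N2 = sigma_sets unit_sphere {F. closed F \<and> F \<subseteq> unit_sphere}"
      by (simp_all only: N1(1) N2(1) sets_borel_sphere_eq_sigma_closed)
    show "emeasure N1 unit_sphere \<noteq> \<infinity>" using finite_measure.emeasure_finite[OF N1(2)] by simp
  qed (use closed_eq in auto)
qed

section \<open>Existence of a solution\<close>

lemma scale_measure_eq_density: "scale_measure r M = density M (\<lambda>_. r)"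
  by (rule measure_eqI) (auto simp: emeasure_scale_measure emeasure_density nn_integral_cmult_indicator)

lemma finite_measure_density:
  assumes "integrable M g" "AE x in M. 0 \<le> g x"
  shows "finite_measure (density M (\<lambda>x. ennreal (g x)))"
proof
  have "emeasure (density M (\<lambda>x. ennreal (g x))) (space (density M (\<lambda>x. ennreal (g x)))) = (\<integral>\<^sup>+x. ennreal (g x) \<partial>M)"
    using assms(1) by (subst emeasure_density) (auto intro!: nn_integral_cong)
  also have "\<dots> = ennreal (\<integral>x. g x \<partial>M)" by (rule nn_integral_eq_integral[OF assms])
  finally show "emeasure (density M (\<lambda>x. ennreal (g x))) (space (density M (\<lambda>x. ennreal (g x)))) \<noteq> \<infinity>" by simp
qed

lemma (in positive_on_sphere) support_fun_scale:
  assumes c: "0 < c" shows "support_fun (wulff (\<lambda>v. c * h v)) v = c * support_fun (wulff h) v"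
proof (rule antisym)
  interpret s: positive_on_sphere "\<lambda>v. c * h v" using c by (rule positive_scale)
  show "support_fun (wulff (\<lambda>v. c * h v)) v \<le> c * support_fun (wulff h) v"
  proof (rule support_fun_least)
    show "wulff (\<lambda>v. c * h v) \<noteq> {}" using s.zero_in_wulff by blast
    fix x assume "x \<in> wulff (\<lambda>v. c * h v)"
    then have "(1 / c) *\<^sub>R x \<in> wulff h" using c by (auto simp: wulff_def pos_divide_le_eq mult.commute)
    then have "((1 / c) *\<^sub>R x) \<bullet> v \<le> support_fun (wulff h) v" by (rule support_upper)
    then show "x \<bullet> v \<le> c * support_fun (wulff h) v" using c by (simp add: pos_divide_le_eq mult.commute)
  qed
  have "support_fun (wulff h) v \<le> support_fun (wulff (\<lambda>v. c * h v)) v / c"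
  proof (rule support_fun_least)
    show "wulff h \<noteq> {}" using zero_in_wulff by blast
    fix x assume "x \<in> wulff h"
    then have "c *\<^sub>R x \<in> wulff (\<lambda>v. c * h v)" using c by (auto simp: wulff_def)
    then have "(c *\<^sub>R x) \<bullet> v \<le> support_fun (wulff (\<lambda>v. c * h v)) v" by (rule s.support_upper)
    then show "x \<bullet> v \<le> support_fun (wulff (\<lambda>v. c * h v)) v / c" using c by (simp add: pos_le_divide_eq mult.commute)
  qed
  then show "c * support_fun (wulff h) v \<le> support_fun (wulff (\<lambda>v. c * h v)) v" using c by (simp add: pos_le_divide_eq mult.commute)
qed

context dual_minkowski
begin

text \<open>An invariant \<open>\<phi>\<close> keeps \<open>perturb\<close> admissible for all
  \<open>t\<close>, so the logarithm of the functional has a maximum at t = 0. The factors q and -P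
  from the two derivatives cancel against the exponents 1 / q and 1 / P.\<close>

lemma euler_lagrange:
  assumes h: "admissible h" "support_on_sphere h" and max: "\<And>k. admissible k \<Longrightarrow> functional k \<le> functional h"
    and \<phi>: "continuous_on unit_sphere \<phi>" "\<And>g v. g \<in> G \<Longrightarrow> v \<in> unit_sphere \<Longrightarrow> \<phi> (g *v v) = \<phi> v"
  shows "(\<integral>u. \<phi> (support_on_sphere.normal h u) * (radial_fun (wulff h) u powr q * w u) \<partial>sphere_measure) / dual_volume h =
    (\<integral>v. \<phi> v * h v powr (- P) \<partial>M) / polar_mean h"
proof -
  interpret support_on_sphere h by fact
  let ?V = "\<lambda>t. dual_volume (perturb \<phi> t)" let ?I = "\<lambda>t. polar_mean (perturb \<phi> t)"
  let ?X = "\<integral>u. \<phi> (normal u) * (radial_fun (wulff h) u powr q * w u) \<partial>sphere_measure"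
  let ?Y = "\<integral>v. \<phi> v * h v powr (- P) \<partial>M"
  have pp: "positive_on_sphere (perturb \<phi> t)" for t using \<phi>(1) by (rule positive_perturb)
  have adm: "admissible (perturb \<phi> t)" for t
    using pp[of t] h(1) \<phi>(2) by (simp add: admissible_def perturb_def)
  have pos: "0 < ?V t" "0 < ?I t" for t using dual_volume_pos[OF pp] polar_mean_pos[OF pp] by auto
  have "(\<integral>u. q * \<phi> (normal u) * (radial_fun (wulff h) u powr q * w u) \<partial>sphere_measure) = q * ?X"
    by (simp add: mult.assoc)
  then have dV: "(?V has_real_derivative q * ?X) (at 0)"
    using dual_volume_derivative[OF n \<phi>(1) w q] by (simp add: dual_volume_def)
  have "(\<integral>v. - P * \<phi> v * h v powr (- P) \<partial>M) = - P * ?Y" by (simp add: mult.assoc)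
  then have dI: "(?I has_real_derivative - P * ?Y) (at 0)"
    using support_integral_derivative[OF M \<phi>(1) P] by (simp add: polar_mean_def)
  have "((\<lambda>t. 1 / q * ln (?V t) + 1 / P * ln (?I t)) has_real_derivative
      1 / q * (1 / ?V 0 * (q * ?X)) + 1 / P * (1 / ?I 0 * (- P * ?Y))) (at 0)"
    using pos pos[of 0] by (intro DERIV_add DERIV_cmult DERIV_chain2[OF DERIV_ln_divide] dV dI) auto
  moreover have "1 / q * ln (?V t) + 1 / P * ln (?I t) \<le> 1 / q * ln (?V 0) + 1 / P * ln (?I 0)" for t
  proof -
    have ln_f: "ln (functional k) = 1 / q * ln (dual_volume k) + 1 / P * ln (polar_mean k)" if "positive_on_sphere k" for k
      using dual_volume_pos[OF that] polar_mean_pos[OF that] by (simp add: functional_def ln_mult ln_powr)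
    have "functional (perturb \<phi> t) \<le> functional (perturb \<phi> 0)" using max[OF adm[of t]] by simp
    then have "ln (functional (perturb \<phi> t)) \<le> ln (functional (perturb \<phi> 0))"
      using functional_pos[OF pp[of t]] functional_pos[OF pp[of 0]] by (subst ln_le_cancel_iff) auto
    then show ?thesis by (simp only: ln_f[OF pp])
  qed
  ultimately have "1 / q * (1 / ?V 0 * (q * ?X)) + 1 / P * (1 / ?I 0 * (- P * ?Y)) = 0"
    by (intro DERIV_local_max[of _ _ 0 1]) auto
  then have "?X / ?V 0 - ?Y / ?I 0 = 0" using q P by simp
  then show ?thesis by simp
qed

lemma distr_M_orthogonal: assumes g: "g \<in> G" shows "distr M borel_sphere ((*v) g) = M"
proof (rule measure_eqI)
  have ot: "orthogonal_transformation ((*v) g)" using grp(2)[OF g] by (simp add: orthogonal_transformation_matrix)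
  have gm: "(*v) g \<in> measurable M borel_sphere"
    using orthogonal_transformation_measurable_sphere[OF ot] M(1) by (simp cong: measurable_cong_sets)
  fix E assume "E \<in> sets (distr M borel_sphere ((*v) g))"
  then have E: "E \<in> sets borel_sphere" by simp
  \<comment> \<open>\<open>invariant_measure\<close> speaks of images and \<open>distr\<close> of
    preimages; the transpose converts one into the other.\<close>
  have pre: "(*v) g -` E \<inter> space M = (*v) (transpose g) ` E"
  proof (intro equalityI subsetI)
    fix x assume "x \<in> (*v) g -` E \<inter> space M"
    then have "g *v x \<in> E" by simp
    moreover have "x = transpose g *v (g *v x)" by (simp only: orthogonal_matrix_transpose_mult(2)[OF grp(2)[OF g]])
    ultimately show "x \<in> (*v) (transpose g) ` E" by (rule rev_image_eqI)
  next
    fix x assume "x \<in> (*v) (transpose g) ` E"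
    then obtain y where y: "y \<in> E" "x = transpose g *v y" by blast
    have "g *v x = y" unfolding y(2) by (rule orthogonal_matrix_transpose_mult(1)[OF grp(2)[OF g]])
    moreover have "x \<in> unit_sphere" unfolding y(2) using y(1) E by (intro mult_sphere grp(4) g) (auto simp: sets_borel_sphere)
    ultimately show "x \<in> (*v) g -` E \<inter> space M" using y(1) by (simp add: space_M)
  qed
  have "emeasure (distr M borel_sphere ((*v) g)) E = emeasure M ((*v) (transpose g) ` E)"
    by (subst emeasure_distr[OF gm E]) (simp only: pre)
  also have "\<dots> = emeasure M E" using M_inv grp(4)[OF g] E M(1) unfolding invariant_measure_def by blast
  finally show "emeasure (distr M borel_sphere ((*v) g)) E = emeasure M E" .
qed (simp add: M(1))

text \<open>The maximiser is replaced by a support function and then dilated. After that the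
  Euler-Lagrange identity says that \<open>N1\<close>, the dual curvature measure, and
  \<open>N2\<close>, the measure with density h^(-P) over \<open>M\<close>, agree on invariant
  functions; invariance of both upgrades this to equality.\<close>

lemma solution_of_maximiser:
  assumes max: "\<exists>h. admissible h \<and> (\<forall>k. admissible k \<longrightarrow> functional k \<le> functional h)"
    and Q: "radial_fun Q \<in> borel_measurable borel_sphere" "\<And>u. w u = radial_fun Q u powr (real CARD('n) - q)"
  shows "\<exists>K\<in>convex_bodies_o. invariant_set G K \<and> Lp_dual_curvature_measure (- P) q K Q = M"
proof -
  let ?n = "real CARD('n)"
  have n0: "0 < ?n" using n by simp
  obtain h0 where h0: "admissible h0" "\<And>k. admissible k \<Longrightarrow> functional k \<le> functional h0" using max by blast
  define h1 where "h1 = support_fun (wulff h0)"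
  have h1: "admissible h1" unfolding h1_def using h0(1) by (rule admissible_support)
  note p1 = admissibleD[OF h1]
  have max1: "functional k \<le> functional h1" if "admissible k" for k
    using h0(2)[OF that] functional_support[OF admissibleD[OF h0(1)]] unfolding h1_def by linarith
  have supp1: "support_fun (wulff h1) = h1"
    unfolding h1_def positive_on_sphere.wulff_support[OF admissibleD[OF h0(1)]] ..
  \<comment> \<open>Dilation by c multiplies the dual volume by c^q and \<open>polar_mean\<close> by
    c^(-P). This value makes their ratio n, which removes the factor between the two
    measures.\<close>
  define c where "c = (?n * polar_mean h1 / dual_volume h1) powr (1 / (q + P))"
  have ratio: "0 < ?n * polar_mean h1 / dual_volume h1" using n0 polar_mean_pos[OF p1] dual_volume_pos[OF p1] by simp
  have c: "0 < c" unfolding c_def using ratio by (rule powr_pos)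
  define h where "h v = c * h1 v" for v
  have h: "admissible h" unfolding h_def using h1 c by (rule admissible_scale)
  note ph = admissibleD[OF h]
  have maxh: "functional k \<le> functional h" if "admissible k" for k
    using max1[OF that] functional_scale[OF p1 c] unfolding h_def by simp
  have supp: "support_fun (wulff h) v = h v" for v
    unfolding h_def positive_on_sphere.support_fun_scale[OF p1 c] supp1 ..
  have V: "dual_volume h = ?n * polar_mean h"
  proof -
    have "c powr (q + P) = ?n * polar_mean h1 / dual_volume h1"
    proof -
      have "1 / (q + P) * (q + P) = 1" using q P by simp
      then show ?thesis unfolding c_def powr_powr by (simp only: powr_one[OF less_imp_le[OF ratio]])
    qed
    then have "c powr q * c powr P * dual_volume h1 = ?n * polar_mean h1"
      using dual_volume_pos[OF p1] by (simp add: powr_add)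
    moreover have "c powr (- P) * c powr P = 1" using c by (simp add: powr_minus)
    ultimately have "c powr q * dual_volume h1 = ?n * (c powr (- P) * polar_mean h1)"
      by (metis (no_types, lifting) mult.assoc mult.commute mult.right_neutral)
    then show ?thesis unfolding h_def by (simp add: dual_volume_scale[OF p1 c] polar_mean_scale[OF p1 c])
  qed
  have ss: "support_on_sphere h"
    using ph supp by (simp add: support_on_sphere_def support_on_sphere_axioms_def)
  interpret S: support_on_sphere h by fact
  define F where "F u = radial_fun (wulff h) u powr q * w u" for u
  have F0: "0 \<le> F u" for u unfolding F_def Q(2) by simp
  have cF: "continuous_on unit_sphere F" unfolding F_def by (intro continuous_on_mult w S.continuous_radial_powr)
  have Fm: "F \<in> borel_measurable sphere_measure" using cF by (rule continuous_imp_borel_sphere) simp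
  have nm: "S.normal \<in> measurable sphere_measure borel_sphere"
    using S.normal_measurable[OF n] by (simp cong: measurable_cong_sets)
  have nm': "S.normal \<in> measurable (density sphere_measure (\<lambda>u. ennreal (F u))) borel_sphere"
    using nm by (simp cong: measurable_cong_sets)
  let ?D = "distr (density sphere_measure (\<lambda>u. ennreal (F u))) borel_sphere S.normal"
  define N1 where "N1 = density ?D (\<lambda>_. ennreal (1 / ?n))"
  define N2 where "N2 = density M (\<lambda>v. ennreal (h v powr (- P)))"
  have dcm: "dual_curvature_measure q (wulff h) Q = N1"
    unfolding S.dual_curvature_measure_wulff[OF n Q(1)] N1_def F_def Q(2) scale_measure_eq_density ..
  have hm: "(\<lambda>v. h v powr (- P)) \<in> borel_measurable M" by (intro continuous_imp_borel_sphere S.continuous_powr M)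
  have sets: "sets N1 = sets borel_sphere" "sets N2 = sets borel_sphere" by (simp_all add: N1_def N2_def M(1))
  interpret D: finite_measure ?D
    by (rule finite_measure.finite_measure_distr[OF finite_measure_density nm'])
       (use F0 cF in \<open>auto intro!: continuous_integrable_sphere finite_sphere_measure n\<close>)
  have fin: "finite_measure N1" "finite_measure N2"
    unfolding N1_def N2_def using n0
    by (auto intro!: finite_measure_density continuous_integrable_sphere S.continuous_powr M)
  have int1: "(\<integral>y. \<psi> y \<partial>N1) = (\<integral>u. F u * \<psi> (S.normal u) \<partial>sphere_measure) / ?n"
    if \<psi>: "continuous_on unit_sphere \<psi>" for \<psi> :: "real^'n \<Rightarrow> real"
  proof -
    have \<psi>m: "\<psi> \<in> borel_measurable borel_sphere" using \<psi> by (rule borel_measurable_continuous_on_restrict)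
    have "(\<integral>y. \<psi> y \<partial>N1) = (\<integral>y. (1 / ?n) *\<^sub>R \<psi> y \<partial>?D)"
      unfolding N1_def using \<psi>m n0 by (intro integral_density) auto
    also have "\<dots> = 1 / ?n * (\<integral>y. \<psi> y \<partial>?D)" by simp
    also have "(\<integral>y. \<psi> y \<partial>?D) = (\<integral>u. \<psi> (S.normal u) \<partial>density sphere_measure (\<lambda>u. ennreal (F u)))"
      by (rule integral_distr[OF nm' \<psi>m])
    also have "\<dots> = (\<integral>u. F u *\<^sub>R \<psi> (S.normal u) \<partial>sphere_measure)"
      using F0 Fm measurable_compose[OF nm \<psi>m] by (intro integral_density) auto
    finally show ?thesis by simp
  qed
  have int2: "(\<integral>y. \<psi> y \<partial>N2) = (\<integral>v. h v powr (- P) * \<psi> v \<partial>M)"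
    if \<psi>: "continuous_on unit_sphere \<psi>" for \<psi> :: "real^'n \<Rightarrow> real"
    unfolding N2_def using hm continuous_imp_borel_sphere[OF \<psi> M(1)] by (subst integral_density) auto
  have ot: "orthogonal_transformation ((*v) g)" if "g \<in> G" for g
    using grp(2)[OF that] by (simp add: orthogonal_transformation_matrix)
  have cg: "continuous_on unit_sphere (\<lambda>y. \<psi> (g *v y))" if "g \<in> G" "continuous_on unit_sphere \<psi>" for g and \<psi> :: "real^'n \<Rightarrow> real"
  proof (rule continuous_on_compose2[OF that(2)])
    show "continuous_on unit_sphere ((*v) g)"
      by (intro linear_continuous_on) (simp add: linear_linear)
    show "(*v) g ` unit_sphere \<subseteq> unit_sphere" using mult_sphere[OF that(1)] by blast
  qed
  \<comment> \<open>Orthogonal symmetries of the body carry normals to normals. When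
    \<open>u\<close> and its image under \<open>g\<close> are both regular, uniqueness identifies
    the image of the normal at \<open>u\<close> with the normal at the image point; rotation
    invariance of \<open>sphere_measure\<close> does the rest.\<close>
  have inv1: "(\<integral>y. \<psi> (g *v y) \<partial>N1) = (\<integral>y. \<psi> y \<partial>N1)"
    if g: "g \<in> G" and \<psi>: "continuous_on unit_sphere \<psi>" for g and \<psi> :: "real^'n \<Rightarrow> real"
  proof -
    have \<psi>m: "\<psi> \<in> borel_measurable borel_sphere" using \<psi> by (rule borel_measurable_continuous_on_restrict)
    have gm: "(*v) g \<in> measurable sphere_measure borel_sphere"
      using orthogonal_transformation_measurable_sphere[OF ot[OF g]] by (simp cong: measurable_cong_sets)
    have gm': "(*v) g \<in> measurable sphere_measure sphere_measure"
      using gm by (simp cong: measurable_cong_sets)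
    have ds: "distr sphere_measure borel_sphere ((*v) g) = sphere_measure"
      using n ot[OF g] by (rule distr_sphere_measure_orthogonal)
    have ns: "AE u in sphere_measure. u \<notin> S.singular_directions" using S.singular_directions_null[OF n] by (rule AE_not_in)
    then have "AE u in distr sphere_measure borel_sphere ((*v) g). u \<notin> S.singular_directions" by (simp only: ds)
    then have gns: "AE u in sphere_measure. g *v u \<notin> S.singular_directions" by (rule AE_distrD[OF gm])
    have H: "(\<lambda>u. F u * \<psi> (S.normal u)) \<in> borel_measurable sphere_measure"
      using Fm measurable_compose[OF nm \<psi>m] by measurable
    have H': "(\<lambda>u. F u * \<psi> (S.normal u)) \<in> borel_measurable borel_sphere"
      using H by (simp cong: measurable_cong_sets)
    have "(\<integral>u. F u * \<psi> (g *v S.normal u) \<partial>sphere_measure) = (\<integral>u. F (g *v u) * \<psi> (S.normal (g *v u)) \<partial>sphere_measure)"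
    proof (rule integral_cong_AE)
      show "(\<lambda>u. F u * \<psi> (g *v S.normal u)) \<in> borel_measurable sphere_measure"
        using Fm measurable_compose[OF nm borel_measurable_continuous_on_restrict[OF cg[OF g \<psi>]]] by measurable
      show "(\<lambda>u. F (g *v u) * \<psi> (S.normal (g *v u))) \<in> borel_measurable sphere_measure"
        by (rule measurable_compose[OF gm' H])
      show "AE u in sphere_measure. F u * \<psi> (g *v S.normal u) = F (g *v u) * \<psi> (S.normal (g *v u))"
        using ns gns AE_space
      proof eventually_elim
        case (elim u)
        then have u: "u \<in> unit_sphere" by simp
        then have "u \<noteq> 0" "g *v u \<noteq> 0" using mult_sphere[OF g u] by auto
        then have "radial_fun (wulff h) (g *v u) = radial_fun (wulff h) u"
          by (simp add: S.radial_fun_wulff gauge_invariant[OF h g])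
        then have Fg: "F (g *v u) = F u" using w_inv[OF g u] by (simp add: F_def)
        have "g *v S.normal u = S.normal (g *v u)"
        proof (rule S.normal_unique)
          show "g *v u \<in> unit_sphere" "g *v S.normal u \<in> unit_sphere" by (intro mult_sphere g u S.normal_in_sphere)+
          show "(g *v u) \<bullet> (g *v S.normal u) = wulff_gauge h (g *v u) * h (g *v S.normal u)"
            using S.normal_eq[OF elim(1)] h g S.normal_in_sphere[of u]
            by (simp only: inner_orthogonal_matrix_mult[OF grp(2)[OF g]] gauge_invariant[OF h g] admissible_def)
        qed (use elim in auto)
        then show ?case using Fg by simp
      qed
    qed
    also have "\<dots> = (\<integral>u. F u * \<psi> (S.normal u) \<partial>distr sphere_measure borel_sphere ((*v) g))"
      by (rule integral_distr[OF gm H', symmetric])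
    finally show ?thesis unfolding int1[OF \<psi>] int1[OF cg[OF g \<psi>]] by (simp only: ds)
  qed
  have inv2: "(\<integral>y. \<psi> (g *v y) \<partial>N2) = (\<integral>y. \<psi> y \<partial>N2)"
    if g: "g \<in> G" and \<psi>: "continuous_on unit_sphere \<psi>" for g and \<psi> :: "real^'n \<Rightarrow> real"
  proof -
    have gm: "(*v) g \<in> measurable M borel_sphere"
      using orthogonal_transformation_measurable_sphere[OF ot[OF g]] M(1) by (simp cong: measurable_cong_sets)
    have H': "(\<lambda>v. h v powr (- P) * \<psi> v) \<in> borel_measurable borel_sphere"
      by (intro borel_measurable_continuous_on_restrict continuous_on_mult S.continuous_powr \<psi>)
    have "(\<integral>v. h v powr (- P) * \<psi> (g *v v) \<partial>M) = (\<integral>v. h (g *v v) powr (- P) * \<psi> (g *v v) \<partial>M)"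
      using h g by (intro Bochner_Integration.integral_cong) (auto simp: admissible_def space_M)
    also have "\<dots> = (\<integral>v. h v powr (- P) * \<psi> v \<partial>distr M borel_sphere ((*v) g))"
      by (rule integral_distr[OF gm H', symmetric])
    finally show ?thesis unfolding int2[OF \<psi>] int2[OF cg[OF g \<psi>]] by (simp only: distr_M_orthogonal[OF g])
  qed
  have eq: "(\<integral>y. \<phi> y \<partial>N1) = (\<integral>y. \<phi> y \<partial>N2)"
    if \<phi>: "continuous_on unit_sphere \<phi>" "\<And>g v. g \<in> G \<Longrightarrow> v \<in> unit_sphere \<Longrightarrow> \<phi> (g *v v) = \<phi> v" for \<phi> :: "real^'n \<Rightarrow> real"
  proof -
    have "(\<integral>u. \<phi> (S.normal u) * F u \<partial>sphere_measure) / dual_volume h = (\<integral>v. \<phi> v * h v powr (- P) \<partial>M) / polar_mean h"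
      unfolding F_def by (rule euler_lagrange[OF h ss maxh \<phi>])
    then have "(\<integral>u. \<phi> (S.normal u) * F u \<partial>sphere_measure) / ?n = (\<integral>v. \<phi> v * h v powr (- P) \<partial>M)"
      using polar_mean_pos[OF ph] n0 unfolding V by (simp add: field_simps)
    then show ?thesis by (simp add: int1[OF \<phi>(1)] int2[OF \<phi>(1)] mult.commute)
  qed
  have "(\<integral>y. monomial_fun c y \<partial>N1) = (\<integral>y. monomial_fun c y \<partial>N2)" for c
    by (rule invariant_measures_moments_eq[OF sets(1) fin(1) sets(2) fin(2) grp(2) grp(4) inv1 inv2 eq])
  then have "(\<integral>y. p y \<partial>N1) = (\<integral>y. p y \<partial>N2)" if "real_polynomial_function p" for p
    using that by (rule moments_eq_imp_polynomial_integral_eq[OF sets(1) fin(1) sets(2) fin(2)])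
  then have N: "N1 = N2" by (rule polynomial_integral_eq_imp_measure_eq[OF sets(1) fin(1) sets(2) fin(2)])
  \<comment> \<open>With p = -P the factor h^(-p) is h^P, which cancels the density h^(-P) of
    \<open>N2\<close>.\<close>
  have "Lp_dual_curvature_measure (- P) q (wulff h) Q = density N2 (\<lambda>v. ennreal (h v powr P))"
    unfolding Lp_dual_curvature_measure_def dcm N supp by simp
  also have "\<dots> = density M (\<lambda>v. ennreal (h v powr (- P)) * ennreal (h v powr P))"
    unfolding N2_def using hm continuous_imp_borel_sphere[OF S.continuous_powr M(1)]
    by (subst density_density_eq) auto
  also have "\<dots> = density M (\<lambda>_. 1)"
  proof (rule density_cong)
    have "ennreal (h v powr (- P)) * ennreal (h v powr P) = 1" if "v \<in> space M" for v
    proof -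
      have "0 < h v" using that S.pos by (simp add: space_M)
      then have "h v powr (- P) * h v powr P = 1" by (simp add: powr_minus)
      then show ?thesis by (simp flip: ennreal_mult)
    qed
    then show "AE v in M. ennreal (h v powr (- P)) * ennreal (h v powr P) = 1" by (intro AE_I2)
  qed (use hm continuous_imp_borel_sphere[OF S.continuous_powr M(1)] in auto)
  also have "\<dots> = M" by (rule density_1)
  finally show ?thesis using S.wulff_convex_body invariant_set_wulff[OF h] by blast
qed

end

section \<open>Invariance of the weight and choice of exponents\<close>

lemma radial_fun_invariant:
  assumes Q: "invariant_set G Q" and g: "g \<in> G" "orthogonal_matrix g"
  shows "radial_fun Q (g *v u) = radial_fun Q u"
proof -
  have gQ: "(*v) g ` Q = Q" using Q g(1) unfolding invariant_set_def by blast
  have "t *\<^sub>R (g *v u) \<in> Q \<longleftrightarrow> t *\<^sub>R u \<in> Q" for t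
  proof
    assume "t *\<^sub>R (g *v u) \<in> Q"
    then obtain y where y: "y \<in> Q" "g *v y = t *\<^sub>R (g *v u)" using gQ by (metis imageE)
    then have "g *v y = g *v (t *\<^sub>R u)" by (simp only: matrix_vector_mult_scaleR)
    then have "y = t *\<^sub>R u" using orthogonal_matrix_transpose_mult(2)[OF g(2)] by metis
    then show "t *\<^sub>R u \<in> Q" using y(1) by simp
  next
    assume "t *\<^sub>R u \<in> Q"
    then have "g *v (t *\<^sub>R u) \<in> Q" using gQ by blast
    then show "t *\<^sub>R (g *v u) \<in> Q" by (simp only: matrix_vector_mult_scaleR)
  qed
  then show ?thesis by (simp add: radial_fun_def)
qed

text \<open>
  For \<open>q \<le> 1\<close> the exponent \<open>q\<close> is raised to some \<open>q1 > 1\<close> whose critical exponent is so large that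
  \<open>f\<close> lies in the associated Lebesgue space.
\<close>

lemma supercritical_exponents:
  fixes n P s :: real
  assumes n: "2 \<le> n" and P: "0 < P" and s: "1 < s"
  obtains q1 t where "1 < q1" "q1 < n" "t = (n - 1) * q1 / (q1 - 1)" "P < t" "P / t \<le> 1 - 1 / s"
proof -
  \<comment> \<open>The first summand alone has P / t equal to 1 - 1 / s; adding n makes t > n,
    hence q1 < n. The formula for \<open>q1\<close> inverts t = (n-1) q1 / (q1 - 1).\<close>
  define t where "t = P * s / (s - 1) + n"
  define q1 where "q1 = t / (t - n + 1)"
  have Ps: "P < P * s / (s - 1)" using P s by (simp add: pos_less_divide_eq algebra_simps)
  have tn: "n < t" using Ps P by (simp add: t_def)
  have d: "0 < t - n + 1" using tn by simp
  have q1: "1 < q1" "q1 < n"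
  proof -
    show "1 < q1" unfolding q1_def using d n by (simp add: pos_less_divide_eq)
    have "0 < (n - 1) * (t - n)" using n tn by (intro mult_pos_pos) auto
    then show "q1 < n" unfolding q1_def using d by (simp add: pos_divide_less_eq algebra_simps)
  qed
  have "q1 - 1 = (n - 1) / (t - n + 1)" unfolding q1_def using d by (simp add: field_simps)
  then have "(n - 1) * q1 / (q1 - 1) = t" unfolding q1_def using d n by simp
  moreover have "P < t" using Ps n by (simp add: t_def)
  moreover have "P / t \<le> 1 - 1 / s"
  proof -
    have "0 < P * s / (s - 1)" using Ps P by linarith
    then have "P / t \<le> P / (P * s / (s - 1))" using P n by (intro frac_le) (auto simp: t_def)
    also have "\<dots> = 1 - 1 / s" using P s by (simp add: field_simps)
    finally show ?thesis .
  qed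
  ultimately show ?thesis using that q1 by metis
qed

theorem theorem1p3:
  fixes G :: "(real ^ 'n ^ 'n) set"
    and Q :: "(real ^ 'n) set"
    and \<mu> :: "(real ^ 'n) measure"
    and f :: "real ^ 'n \<Rightarrow> real"
    and p q s :: real
  assumes "CARD('n) \<ge> 2"
    and "q > 0"
    and "- q_star CARD('n) q < ereal p" and "p < 0"
    and "subgroup G orthogonal_group" and "closed G"
    and "\<And>x. (\<forall>g\<in>G. g *v x = x) \<Longrightarrow> x = 0"
    and "star_body Q" and "invariant_set G Q"
    and "sets \<mu> = sets borel_sphere" and "finite_measure \<mu>"
    and "emeasure \<mu> unit_sphere \<noteq> 0"
    and "invariant_measure G \<mu>"
    and "f \<in> L_sphere s" and "AE u in sphere_measure. f u \<ge> 0"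
    and "\<mu> = density sphere_measure (\<lambda>u. ennreal (f u))"
    and "q \<le> 1 \<Longrightarrow> s > 1"
    and "q > 1 \<Longrightarrow> ereal s = 1 / (1 + ereal p / q_star CARD('n) q)"
  shows "\<exists>K \<in> convex_bodies_o. invariant_set G K \<and> Lp_dual_curvature_measure p q K Q = \<mu>"
proof -
  let ?n = "real CARD('n)"
  define P where "P = - p"
  define w where "w u = radial_fun Q u powr (?n - q)" for u
  have P: "0 < P" using assms(4) by (simp add: P_def)
  have n2: "2 \<le> ?n" using assms(1) by simp
  note grp = subgroup_orthogonal_group[OF assms(5)]
  have Qpos: "0 < radial_fun Q u" if "u \<in> unit_sphere" for u
  proof -
    have "u \<noteq> 0" using that by auto
    then show ?thesis using assms(8) by (simp add: star_body_def)
  qed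
  have Qc: "continuous_on unit_sphere (radial_fun Q)"
  proof (rule continuous_on_subset)
    show "continuous_on (- {0}) (radial_fun Q)" using assms(8) by (simp add: star_body_def)
    show "unit_sphere \<subseteq> - {0 :: real^'n}" by auto
  qed
  have f: "f \<in> borel_measurable sphere_measure" and fs: "integrable sphere_measure (\<lambda>u. \<bar>f u\<bar> powr s)"
    using assms(14) by (simp_all add: L_sphere_def)
  \<comment> \<open>Read off from \<open>\<mu>\<close>: a density over a sphere of measure zero
    would give \<open>\<mu>\<close> mass zero.\<close>
  have sphere_pos: "emeasure (sphere_measure :: (real^'n) measure) unit_sphere \<noteq> 0"
  proof
    assume "emeasure (sphere_measure :: (real^'n) measure) unit_sphere = 0"
    then have "unit_sphere \<in> null_sets (sphere_measure :: (real^'n) measure)"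
      using sets.top[of "sphere_measure :: (real^'n) measure"] by (intro null_setsI) simp_all
    then have "unit_sphere \<in> null_sets \<mu>"
      using absolutely_continuousI_density[of "\<lambda>u. ennreal (f u)" sphere_measure] f
      unfolding assms(16) absolutely_continuous_def by auto
    then show False using assms(12) by auto
  qed
  interpret dual_minkowski G w \<mu> q P
  proof (rule dual_minkowski.intro)
    show "x = 0" if "\<And>g. g \<in> G \<Longrightarrow> g *v x = x" for x using assms(7) that by blast
    show "continuous_on unit_sphere w"
      unfolding w_def using Qpos by (intro continuous_on_powr Qc continuous_on_const) force
    show "0 < w u" if "u \<in> unit_sphere" for u using Qpos[OF that] by (simp add: w_def)
    show "w (g *v u) = w u" if "g \<in> G" for g u
      using radial_fun_invariant[OF assms(9) that grp(2)[OF that]] by (simp add: w_def)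
  qed (rule assms(1,2,5,6,10,11,12,13) P sphere_pos)+
  \<comment> \<open>For q > 1 take \<open>q1 = q\<close> and \<open>s' = s\<close>, so that
    \<open>t\<close> is the finite value of \<open>q_star\<close>. For q <= 1 that value is
    infinite, and a substitute exponent q1 > 1 takes over.\<close>
  obtain q1 t s' where q1: "q \<le> q1" "1 < q1"
    and t: "t = (if ?n \<le> q1 then q1 / (q1 - ?n + 1) else (?n - 1) * q1 / (q1 - 1))"
    and Pt: "P < t" and s': "1 < s'" "1 / s' + P / t = 1" and fs': "integrable sphere_measure (\<lambda>u. \<bar>f u\<bar> powr s')"
  proof (cases "1 < q")
    case True
    define t where "t = (if ?n \<le> q then q / (q - ?n + 1) else (?n - 1) * q / (q - 1))"
    have qst: "q_star CARD('n) q = ereal t" using True by (simp add: q_star_def t_def)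
    have Pt: "P < t" using assms(3) by (simp add: qst P_def)
    then have d: "0 < 1 + p / t" and t0: "0 < t" using P by (auto simp: P_def field_simps)
    have "ereal s = ereal (1 / (1 + p / t))" using assms(18)[OF True] t0 d by (simp add: qst one_ereal_def)
    then have s: "s = 1 / (1 + p / t)" by simp
    have "p / t < 0" using assms(4) t0 by (simp add: divide_neg_pos)
    then have "1 < s" using d by (simp add: s pos_less_divide_eq)
    moreover have "1 / s + P / t = 1" by (simp add: s P_def)
    ultimately show ?thesis using that[of q t s] True t_def Pt fs by simp
  next
    case False
    then have s: "1 < s" using assms(17) by simp
    obtain q1 t where qt: "1 < q1" "q1 < ?n" "t = (?n - 1) * q1 / (q1 - 1)" "P < t" "P / t \<le> 1 - 1 / s"
      by (rule supercritical_exponents[OF n2 P s]) blast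
    \<comment> \<open>The exponent conjugate to t / P. It does not exceed \<open>s\<close>, so on
      the finite spherical measure integrability passes from \<open>s\<close> to
      \<open>s'\<close>.\<close>
    define s' where "s' = 1 / (1 - P / t)"
    have t0: "0 < t" using P qt(4) by simp
    have Pt: "0 < P / t" "P / t < 1" using P t0 qt(4) by auto
    have s': "1 < s'" "1 / s' + P / t = 1" using Pt by (auto simp: s'_def pos_less_divide_eq)
    have "1 / s \<le> 1 - P / t" using qt(5) by simp
    then have "1 / (1 - P / t) \<le> 1 / (1 / s)" using s by (intro divide_left_mono mult_pos_pos) (use Pt in auto)
    then have "s' \<le> s" by (simp add: s'_def)
    interpret fm: finite_measure "sphere_measure :: (real^'n) measure" by (rule finite_sphere_measure[OF assms(1)])
    have "integrable sphere_measure (\<lambda>u. \<bar>f u\<bar> powr s')"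
    proof (rule Bochner_Integration.integrable_bound)
      show "integrable sphere_measure (\<lambda>u. 1 + \<bar>f u\<bar> powr s)" using fs by simp
      show "(\<lambda>u. \<bar>f u\<bar> powr s') \<in> borel_measurable sphere_measure" using f by measurable
      have "\<bar>f u\<bar> powr s' \<le> 1 + \<bar>f u\<bar> powr s" for u
        using powr_le_one_plus_powr[of "\<bar>f u\<bar>" s' s] s'(1) \<open>s' \<le> s\<close> by (cases "f u = 0") auto
      then show "AE u in sphere_measure. norm (\<bar>f u\<bar> powr s') \<le> norm (1 + \<bar>f u\<bar> powr s)" by (intro AE_I2) simp
    qed
    then show ?thesis using that[of q1 t s'] qt s' False by simp
  qed
  have "\<exists>\<kappa>>0. \<forall>k e a i j. admissible k \<longrightarrow> adapted k e a \<longrightarrow> a i < \<kappa> * a j \<longrightarrow> functional k < \<eta>" if "0 < \<eta>" for \<eta>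
    by (rule functional_decay[OF f assms(15,16) q1 t Pt s' fs' that])
  then have "\<exists>h. admissible h \<and> (\<forall>k. admissible k \<longrightarrow> functional k \<le> functional h)"
    by (rule maximiser_exists)
  then have "\<exists>K\<in>convex_bodies_o. invariant_set G K \<and> Lp_dual_curvature_measure (- P) q K Q = \<mu>"
    by (rule solution_of_maximiser) (simp_all add: borel_measurable_continuous_on_restrict[OF Qc] w_def)
  then show ?thesis by (simp add: P_def)
qed

end
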